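(* There is a randomized algorithm (Algorithm $k$-CMedians) which, given an instance $\mathcal{G}=\{G_1,\dots,G_n\}$ of $k$-CMedians in $\mathbb{R}^d$ with $k\ge 2$ and a small constant $\epsilon>0$, outputs with constant probability a $(5+\epsilon)$-approximation for $k$-CMedians on $\mathcal{G}$, in $O\big(2^{\mathrm{poly}(k/\epsilon)}\,n(\log n)^{2k}d\big)$ time.
   Context: An instance of $k$-CMedians is a set $\mathcal{G}=\{G_1,\dots,G_n\}$ of $n$ point-sets, each $G_i=\{p^i_1,\dots,p^i_{k_i}\}$ consisting of $k_i\le k$ points in $\mathbb{R}^d$. A chromatic partition of $\mathcal{G}$ is a partition of the $\sum_i k_i$ points into $k$ sets $U_1,\dots,U_k$ such that each $U_j$ contains at most one point from each $G_i$. The $k$-CMedians problem is to find $m_1,\dots,m_k\in\mathbb{R}^d$ and a chromatic partition $U_1,\dots,U_k$ minimizing $\frac1n\sum_j\sum_{q\in U_j}\|q-m_j\|$. A $(5+\epsilon)$-approximation is a solution whose objective value is at most $(5+\epsilon)$ times the minimum. Here $k$ is a fixed number, $\mathrm{poly}(k/\epsilon)$ denotes some fixed polynomial in $k/\epsilon$, and "constant probability" means a positive constant independent of the input. *)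

theory Defs
  imports "HOL-Probability.Probability" "HOL-Computational_Algebra.Polynomial"
begin

section \<open>The chromatic k-medians problem\<close>

text \<open>
  The dimension is a parameter of the instance, so a point of $R^d$ is a list of length \<open>d\<close>.
\<close>

type_synonym point = "real list"

definition euclid_dist :: "point \<Rightarrow> point \<Rightarrow> real" where
  "euclid_dist p q = L2_set (\<lambda>c. p ! c - q ! c) {..<length p}"

text \<open>
  \<open>G ! i\<close> enumerates the point-set $G_i$. Different $G_i$ may share points, or even coincide, so a
  point is identified by its index pair \<open>(i, j)\<close>.
\<close>

type_synonym point_sets = "point list list"

definition cmedians_instance :: "nat \<Rightarrow> nat \<Rightarrow> point_sets \<Rightarrow> bool" where
  "cmedians_instance k d G \<longleftrightarrow>
     G \<noteq> [] \<and> (\<forall>P \<in> set G. distinct P \<and> length P \<le> k \<and> (\<forall>p \<in> set P. length p = d))"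

definition point_indices :: "point_sets \<Rightarrow> (nat \<times> nat) set" where
  "point_indices G = {(i, j). i < length G \<and> j < length (G ! i)}"

text \<open>
  Some of the \<open>k\<close> sets may be empty. Injectivity of \<open>fst\<close> says that \<open>U l\<close> has at most one point
  from each $G_i$.
\<close>

definition chromatic_partition :: "nat \<Rightarrow> point_sets \<Rightarrow> (nat \<Rightarrow> (nat \<times> nat) set) \<Rightarrow> bool" where
  "chromatic_partition k G U \<longleftrightarrow>
     (\<Union>l<k. U l) = point_indices G \<and> disjoint_family_on U {..<k} \<and> (\<forall>l<k. inj_on fst (U l))"

type_synonym solution = "(nat \<Rightarrow> point) \<times> (nat \<Rightarrow> (nat \<times> nat) set)"

definition solutions :: "nat \<Rightarrow> nat \<Rightarrow> point_sets \<Rightarrow> solution set" where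
  "solutions k d G = {(m, U). (\<forall>l<k. length (m l) = d) \<and> chromatic_partition k G U}"

definition cost :: "nat \<Rightarrow> point_sets \<Rightarrow> solution \<Rightarrow> real" where
  "cost k G = (\<lambda>(m, U). 1 / real (length G) *
     (\<Sum>l<k. \<Sum>(i, j)\<in>U l. euclid_dist (G ! i ! j) (m l)))"

text \<open>
  The infimum is attained: there are finitely many chromatic partitions, and for a fixed one the
  cost is continuous and coercive in the medians of its nonempty sets.
\<close>

definition opt :: "nat \<Rightarrow> nat \<Rightarrow> point_sets \<Rightarrow> real" where
  "opt k d G = (INF S \<in> solutions k d G. cost k G S)"

definition is_approximation :: "real \<Rightarrow> nat \<Rightarrow> nat \<Rightarrow> point_sets \<Rightarrow> solution \<Rightarrow> bool" where
  "is_approximation \<alpha> k d G S \<longleftrightarrow> S \<in> solutions k d G \<and> cost k G S \<le> \<alpha> * opt k d G"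


section \<open>Randomized algorithms: a while-language over the real RAM\<close>

text \<open>
  The store consists of arrays of natural numbers and arrays of reals, with any number of
  indices; scalars are arrays accessed with the empty index list. The clock counts executed steps
  and is not accessible to programs.
\<close>

type_synonym vname = string

record state =
  nmem :: "vname \<Rightarrow> nat list \<Rightarrow> nat"
  rmem :: "vname \<Rightarrow> nat list \<Rightarrow> real"
  clock :: nat

datatype nexp =
    NConst nat
  | NVar vname "nexp list"
  | NAdd nexp nexp
  | NSub nexp nexp
  | NMul nexp nexp

text \<open>
  There are no literals for arbitrary reals (a single one could encode an uncomputable oracle) and
  no rounding from reals to natural numbers.
\<close>

datatype rexp =
    RNat nexp
  | RVar vname "nexp list"
  | RAdd rexp rexp
  | RSub rexp rexp
  | RMul rexp rexp
  | RDiv rexp rexp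
  | RSqrt rexp

datatype bexp =
    NLess nexp nexp
  | RLess rexp rexp
  | Not bexp
  | And bexp bexp

datatype com =
    Skip
  | NAssign vname "nexp list" nexp
  | RAssign vname "nexp list" rexp
  | Random vname "nexp list" nexp
  | Seq com com
  | If bexp com com
  | While bexp com

primrec nval :: "nexp \<Rightarrow> state \<Rightarrow> nat" where
  "nval (NConst n) s = n"
| "nval (NVar x es) s = nmem s x (map (\<lambda>e. nval e s) es)"
| "nval (NAdd e f) s = nval e s + nval f s"
| "nval (NSub e f) s = nval e s - nval f s"
| "nval (NMul e f) s = nval e s * nval f s"

primrec rval :: "rexp \<Rightarrow> state \<Rightarrow> real" where
  "rval (RNat e) s = real (nval e s)"
| "rval (RVar x es) s = rmem s x (map (\<lambda>e. nval e s) es)"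
| "rval (RAdd e f) s = rval e s + rval f s"
| "rval (RSub e f) s = rval e s - rval f s"
| "rval (RMul e f) s = rval e s * rval f s"
| "rval (RDiv e f) s = rval e s / rval f s"
| "rval (RSqrt e) s = sqrt (rval e s)"

primrec bval :: "bexp \<Rightarrow> state \<Rightarrow> bool" where
  "bval (NLess e f) s \<longleftrightarrow> nval e s < nval f s"
| "bval (RLess e f) s \<longleftrightarrow> rval e s < rval f s"
| "bval (Not b) s \<longleftrightarrow> \<not> bval b s"
| "bval (And b c) s \<longleftrightarrow> bval b s \<and> bval c s"

definition nwrite :: "vname \<Rightarrow> nat list \<Rightarrow> nat \<Rightarrow> state \<Rightarrow> state" where
  "nwrite x a v s = s\<lparr>nmem := (nmem s)(x := (nmem s x)(a := v))\<rparr>"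

definition rwrite :: "vname \<Rightarrow> nat list \<Rightarrow> real \<Rightarrow> state \<Rightarrow> state" where
  "rwrite x a v s = s\<lparr>rmem := (rmem s)(x := (rmem s x)(a := v))\<rparr>"

definition tick :: "state \<Rightarrow> state" where
  "tick s = s\<lparr>clock := Suc (clock s)\<rparr>"

partial_function (spmf) while_spmf :: "('s \<Rightarrow> bool) \<Rightarrow> ('s \<Rightarrow> 's spmf) \<Rightarrow> 's \<Rightarrow> 's spmf" where
  "while_spmf b f s =
     (if b s then bind_spmf (f s) (\<lambda>s'. while_spmf b f s') else return_spmf s)"

text \<open>
  Assignments, random draws and guard evaluations are charged one step each: the expressions in
  a fixed program have bounded size, so charging every arithmetic operation separately would
  change the running time only by a constant factor. \<open>Random x es e\<close> draws uniformly from
  \<open>{0..e}\<close>. Nontermination shows up as missing probability mass.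
\<close>

primrec exec :: "com \<Rightarrow> state \<Rightarrow> state spmf" where
  "exec Skip s = return_spmf (tick s)"
| "exec (NAssign x es e) s =
     return_spmf (tick (nwrite x (map (\<lambda>e. nval e s) es) (nval e s) s))"
| "exec (RAssign x es e) s =
     return_spmf (tick (rwrite x (map (\<lambda>e. nval e s) es) (rval e s) s))"
| "exec (Random x es e) s =
     map_spmf (\<lambda>v. tick (nwrite x (map (\<lambda>e. nval e s) es) v s)) (spmf_of_set {0..nval e s})"
| "exec (Seq c1 c2) s = bind_spmf (exec c1 s) (exec c2)"
| "exec (If b c1 c2) s = (if bval b s then exec c1 (tick s) else exec c2 (tick s))"
| "exec (While b c) s = while_spmf (bval b) (\<lambda>s'. exec c (tick s')) (tick s)"


section \<open>Input and output conventions\<close>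

text \<open>All memory not mentioned here is initially zero.\<close>

definition input_state :: "nat \<Rightarrow> nat \<Rightarrow> real \<Rightarrow> point_sets \<Rightarrow> state" where
  "input_state k d \<epsilon> G = \<lparr>
     nmem = (\<lambda>x a.
       if x = ''k'' \<and> a = [] then k
       else if x = ''d'' \<and> a = [] then d
       else if x = ''n'' \<and> a = [] then length G
       else if x = ''size'' then
         (case a of [i] \<Rightarrow> if i < length G then length (G ! i) else 0 | _ \<Rightarrow> 0)
       else 0),
     rmem = (\<lambda>x a.
       if x = ''eps'' \<and> a = [] then \<epsilon>
       else if x = ''point'' then
         (case a of [i, j, c] \<Rightarrow> if (i, j) \<in> point_indices G \<and> c < d then G ! i ! j ! c else 0
          | _ \<Rightarrow> 0)
       else 0),
     clock = 0\<rparr>"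

text \<open>
  The output consists of the coordinates of the medians and, for each point of each $G_i$, the
  number of the set it is put into. A label that is not below \<open>k\<close> makes the output infeasible.
\<close>

definition output_solution :: "nat \<Rightarrow> point_sets \<Rightarrow> state \<Rightarrow> solution" where
  "output_solution d G s =
     ((\<lambda>l. map (\<lambda>c. rmem s ''median'' [l, c]) [0..<d]),
      (\<lambda>l. {(i, j) \<in> point_indices G. nmem s ''label'' [i, j] = l}))"

end

theory Submission
  imports Defs
begin

text \<open>
  The candidate medians come from adaptive sampling: starting with one point, repeatedly add a point
  chosen with probability (almost) proportional to its distance to the points chosen so far. Fix a
  solution with clusters $U_l$, medians $m_l$ and cluster costs $A_l$, and call cluster $l$ bad if
  $|U_l| \cdot d(m_l, C) > 3 A_l$. As long as $\sum_l |U_l| \cdot d(m_l, C) > 4 \sum_l A_l$, a constant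
  fraction of the sampling mass lies on points of bad clusters at distance at most $2 A_l / |U_l|$ from
  their median, and choosing such a point makes the cluster good. So after \<open>120 * k\<close> draws the
  inequality fails with probability at least one half. Then moving every median to its nearest
  candidate gives cost at most $5 \sum_l A_l$, and all tuples of candidates, together with all chromatic
  labelings of every $G_i$, can be searched exhaustively.
\<close>


section \<open>Total correctness with running time\<close>

text \<open>The thresholds 2 < 3 < 4 are spaced for slack. By Markov, half of a cluster lies within
  twice the average distance of its median, and in a bad cluster such points keep a third of the
  distance from the median to the candidates. This yields a share of 1/30 of the sampling mass, 1/60
  after discretisation, and \<open>60 * k / (120 * k)\<close> is the failure bound. The factor 5 is
  1 + 4 by the triangle inequality.

  The number of candidates depends on \<open>k\<close> alone, and once a tuple of medians is fixed
  the sets $G_i$ can be labeled independently of each other, so exhaustive search stays linear in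
  \<open>n\<close>.

  To separate probability from program verification, all random numbers are drawn before anything
  else happens. The rest is verified for every fixed outcome, and the sampling analysis concerns a
  pure function of a uniformly random list.\<close>

abbreviation seq_com :: "com \<Rightarrow> com \<Rightarrow> com" (infixr ";;" 60) where
  "c1 ;; c2 \<equiv> Seq c1 c2"

abbreviation N0 :: "vname \<Rightarrow> nexp" where "N0 x \<equiv> NVar x []"
abbreviation R0 :: "vname \<Rightarrow> rexp" where "R0 x \<equiv> RVar x []"

text \<open>The bound \<open>e\<close> is evaluated afresh in every round, so the rule for this loop
  asks that its value stay fixed and that the body not write the counter.\<close>

definition For :: "vname \<Rightarrow> nexp \<Rightarrow> com \<Rightarrow> com" where
  "For x e c = NAssign x [] (NConst 0) ;;
     While (NLess (N0 x) e) (c ;; NAssign x [] (NAdd (N0 x) (NConst 1)))"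

primrec nwrites :: "com \<Rightarrow> vname set" where
  "nwrites Skip = {}"
| "nwrites (NAssign x es e) = {x}"
| "nwrites (RAssign x es e) = {}"
| "nwrites (Random x es e) = {x}"
| "nwrites (c1 ;; c2) = nwrites c1 \<union> nwrites c2"
| "nwrites (If b c1 c2) = nwrites c1 \<union> nwrites c2"
| "nwrites (While b c) = nwrites c"

primrec rwrites :: "com \<Rightarrow> vname set" where
  "rwrites Skip = {}"
| "rwrites (NAssign x es e) = {}"
| "rwrites (RAssign x es e) = {x}"
| "rwrites (Random x es e) = {}"
| "rwrites (c1 ;; c2) = rwrites c1 \<union> rwrites c2"
| "rwrites (If b c1 c2) = rwrites c1 \<union> rwrites c2"
| "rwrites (While b c) = rwrites c"

lemma nwrites_For [simp]: "nwrites (For x e c) = insert x (nwrites c)"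
  and rwrites_For [simp]: "rwrites (For x e c) = rwrites c"
  by (auto simp: For_def)

text \<open>Whole arrays are the unit: one written entry makes the array count as changed.
  Invariants therefore describe written arrays entry by entry or as a function update of the old
  array.\<close>

definition frame :: "com \<Rightarrow> state \<Rightarrow> state \<Rightarrow> bool" where
  "frame c s s' \<longleftrightarrow> (\<forall>x. x \<notin> nwrites c \<longrightarrow> nmem s' x = nmem s x) \<and>
                   (\<forall>x. x \<notin> rwrites c \<longrightarrow> rmem s' x = rmem s x)"

text \<open>The frame condition is part of the triple, so that a loop invariant only has to mention the
  variables that its loop changes.\<close>

definition ok :: "com \<Rightarrow> state \<Rightarrow> (state \<Rightarrow> bool) \<Rightarrow> bool" where
  "ok c s Q \<longleftrightarrow> lossless_spmf (exec c s) \<and> (\<forall>s' \<in> set_spmf (exec c s). frame c s s' \<and> Q s')"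

lemma mem_simps [simp]:
  "nmem (tick s) = nmem s" "rmem (tick s) = rmem s" "clock (tick s) = Suc (clock s)"
  "rmem (nwrite x a v s) = rmem s" "clock (nwrite x a v s) = clock s"
  "nmem (rwrite x a r s) = nmem s" "clock (rwrite x a r s) = clock s"
  by (simp_all add: tick_def nwrite_def rwrite_def)

lemma nmem_nwrite [simp]:
  "nmem (nwrite x a v s) y = (if y = x then (nmem s x)(a := v) else nmem s y)"
  by (simp add: nwrite_def)

lemma rmem_rwrite [simp]:
  "rmem (rwrite x a v s) y = (if y = x then (rmem s x)(a := v) else rmem s y)"
  by (simp add: rwrite_def)

lemma frame_nmem: "frame c s s' \<Longrightarrow> x \<notin> nwrites c \<Longrightarrow> nmem s' x = nmem s x"
  and frame_rmem: "frame c s s' \<Longrightarrow> y \<notin> rwrites c \<Longrightarrow> rmem s' y = rmem s y"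
  by (auto simp: frame_def)

lemma ok_conseq:
  assumes "ok c s Q" "\<And>s'. frame c s s' \<Longrightarrow> Q s' \<Longrightarrow> Q' s'"
  shows "ok c s Q'"
  using assms by (auto simp: ok_def)

lemma ok_Skip [simp]: "ok Skip s Q \<longleftrightarrow> Q (tick s)"
  and ok_NAssign [simp]: "ok (NAssign x es e) s Q \<longleftrightarrow>
     Q (tick (nwrite x (map (\<lambda>e. nval e s) es) (nval e s) s))"
  and ok_RAssign [simp]: "ok (RAssign x es f) s Q \<longleftrightarrow>
     Q (tick (rwrite x (map (\<lambda>e. nval e s) es) (rval f s) s))"
  by (auto simp: ok_def frame_def)

lemma set_bind_spmf_iff [simp]:
  "y \<in> set_spmf (bind_spmf p f) \<longleftrightarrow> (\<exists>x \<in> set_spmf p. y \<in> set_spmf (f x))"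
  by (auto simp: set_bind_spmf)

lemma ok_IfI:
  assumes "bval b s \<Longrightarrow> ok c1 (tick s) Q" "\<not> bval b s \<Longrightarrow> ok c2 (tick s) Q"
  shows "ok (If b c1 c2) s Q"
  using assms by (auto simp: ok_def frame_def)

lemma frame_Seq: "frame c1 s s' \<Longrightarrow> frame c2 s' s'' \<Longrightarrow> frame (c1 ;; c2) s s''"
  by (simp add: frame_def)

lemma ok_Seq: "ok c1 s (\<lambda>s'. ok c2 s' Q) \<Longrightarrow> ok (c1 ;; c2) s Q"
proof -
  assume *: "ok c1 s (\<lambda>s'. ok c2 s' Q)"
  have "frame (c1 ;; c2) s s'' \<and> Q s''"
    if "s' \<in> set_spmf (exec c1 s)" "s'' \<in> set_spmf (exec c2 s')" for s' s''
    using * that frame_Seq[of c1 s s' c2 s''] by (simp add: ok_def)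
  with * show ?thesis
    by (auto simp: ok_def)
qed

lemma ok_Skip_Seq: "ok c (tick s) Q \<Longrightarrow> ok (Skip ;; c) s Q"
  and ok_NAssign_Seq: "ok c (tick (nwrite x (map (\<lambda>e. nval e s) es) (nval e s) s)) Q \<Longrightarrow>
     ok (NAssign x es e ;; c) s Q"
  and ok_RAssign_Seq: "ok c (tick (rwrite x (map (\<lambda>e. nval e s) es) (rval f s) s)) Q \<Longrightarrow>
     ok (RAssign x es f ;; c) s Q"
  by (rule ok_Seq, simp)+

lemmas ok_assign = ok_Skip_Seq ok_NAssign_Seq ok_RAssign_Seq
  ok_Skip[THEN iffD2] ok_NAssign[THEN iffD2] ok_RAssign[THEN iffD2]

text \<open>Induction on the number \<open>m\<close> of remaining rounds. A round costs
  \<open>K\<close> for the body plus 2, for the increment and one guard evaluation.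
  \<open>I_tick\<close> and \<open>I_x\<close> make the invariant stable under the changes that
  happen outside \<open>c\<close>; the clock is bounded separately.\<close>

lemma ok_While_count:
  fixes x e c
  defines "body \<equiv> c ;; NAssign x [] (NAdd (N0 x) (NConst 1))"
  assumes x: "x \<notin> nwrites c"
    and e: "\<And>s'. frame body s0 s' \<Longrightarrow> nval e s' = N"
    and I_tick: "\<And>i s. I i s \<Longrightarrow> I i (tick s)"
    and I_x: "\<And>i s v. I i s \<Longrightarrow> I i (nwrite x [] v s)"
    and body: "\<And>i s. i < N \<Longrightarrow> nmem s x [] = i \<Longrightarrow> I i s \<Longrightarrow> frame body s0 s \<Longrightarrow>
                 ok c s (\<lambda>s'. I (Suc i) s' \<and> clock s' \<le> clock s + K)"
  shows "i + m = N \<Longrightarrow> nmem s x [] = i \<Longrightarrow> I i s \<Longrightarrow> frame body s0 s \<Longrightarrow>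
    lossless_spmf (while_spmf (bval (NLess (N0 x) e)) (\<lambda>s'. exec body (tick s')) s) \<and>
    (\<forall>s' \<in> set_spmf (while_spmf (bval (NLess (N0 x) e)) (\<lambda>s'. exec body (tick s')) s).
       frame body s0 s' \<and> I N s' \<and> clock s' \<le> clock s + m * (K + 2))"
proof (induction m arbitrary: i s)
  case 0
  then show ?case
    using e[OF 0(4)] by (subst (1 2) while_spmf.simps) auto
next
  case (Suc m)
  have fr: "frame body s0 (tick s)"
    using Suc.prems(4) by (auto simp: frame_def)
  have *: "ok c (tick s) (\<lambda>s'. I (Suc i) s' \<and> clock s' \<le> clock (tick s) + K)"
    using Suc.prems fr I_tick by (intro body) auto
  have "bval (NLess (N0 x) e) s"
    using Suc.prems e by auto
  moreover have "ok body (tick s) (\<lambda>s'. nmem s' x [] = Suc i \<and> I (Suc i) s' \<and> clock s' \<le> clock s + K + 2)"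
    unfolding body_def
  proof (intro ok_Seq, rule ok_conseq[OF *])
    fix s' assume s': "frame c (tick s) s'" "I (Suc i) s' \<and> clock s' \<le> clock (tick s) + K"
    then have "nmem s' x [] = i"
      using frame_nmem[OF s'(1) x] Suc.prems by simp
    then show "ok (NAssign x [] (NAdd (N0 x) (NConst 1))) s'
        (\<lambda>s'. nmem s' x [] = Suc i \<and> I (Suc i) s' \<and> clock s' \<le> clock s + K + 2)"
      using s' I_tick I_x by auto
  qed
  moreover have "frame body s0 s'" if "frame body (tick s) s'" for s'
    using that fr by (auto simp: frame_def)
  ultimately have unfold: "while_spmf (bval (NLess (N0 x) e)) (\<lambda>s'. exec body (tick s')) s =
        bind_spmf (exec body (tick s)) (while_spmf (bval (NLess (N0 x) e)) (\<lambda>s'. exec body (tick s')))"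
      and lossless: "lossless_spmf (exec body (tick s))"
      and step: "\<And>s'. s' \<in> set_spmf (exec body (tick s)) \<Longrightarrow> frame body s0 s' \<and>
        nmem s' x [] = Suc i \<and> I (Suc i) s' \<and> clock s' \<le> clock s + K + 2"
    by (simp_all add: ok_def while_spmf.simps[of _ _ s])
  show ?case
    unfolding unfold
    using lossless step Suc.IH[of "Suc i"] Suc.prems(1) by fastforce
qed

text \<open>The additive 2 pays for the initial assignment and the first evaluation of the
  guard.\<close>

lemma ok_For:
  assumes x: "x \<notin> nwrites c"
    and e: "\<And>s'. frame (For x e c) s s' \<Longrightarrow> nval e s' = N"
    and I_tick: "\<And>i s. I i s \<Longrightarrow> I i (tick s)"
    and I_x: "\<And>i s v. I i s \<Longrightarrow> I i (nwrite x [] v s)"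
    and I0: "I 0 s"
    and body: "\<And>i s'. i < N \<Longrightarrow> nmem s' x [] = i \<Longrightarrow> I i s' \<Longrightarrow> frame (For x e c) s s' \<Longrightarrow>
                 ok c s' (\<lambda>s''. I (Suc i) s'' \<and> clock s'' \<le> clock s' + K)"
  shows "ok (For x e c) s (\<lambda>s'. I N s' \<and> clock s' \<le> clock s + 2 + N * (K + 2))"
proof -
  let ?body = "c ;; NAssign x [] (NAdd (N0 x) (NConst 1))"
  have fr: "frame (For x e c) = frame ?body"
    by (auto simp: frame_def fun_eq_iff)
  define s1 where "s1 = tick (tick (nwrite x [] 0 s))"
  have fr1: "frame ?body s s1"
    by (auto simp: frame_def s1_def)
  have I1: "I 0 s1" "nmem s1 x [] = 0"
    using I0 I_tick I_x by (auto simp: s1_def)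
  have "exec (For x e c) s =
      while_spmf (bval (NLess (N0 x) e)) (\<lambda>s'. exec ?body (tick s')) s1"
    by (simp add: For_def s1_def)
  moreover have "lossless_spmf (while_spmf (bval (NLess (N0 x) e)) (\<lambda>s'. exec ?body (tick s')) s1) \<and>
    (\<forall>s' \<in> set_spmf (while_spmf (bval (NLess (N0 x) e)) (\<lambda>s'. exec ?body (tick s')) s1).
       frame ?body s s' \<and> I N s' \<and> clock s' \<le> clock s1 + N * (K + 2))"
    by (rule ok_While_count[where i = 0])
       (use x e I_tick I_x body fr fr1 I1 in \<open>auto\<close>)
  moreover have "clock s1 = clock s + 2"
    by (simp add: s1_def)
  ultimately show ?thesis
    by (simp add: ok_def fr)
qed

section \<open>Adaptive sampling\<close>

text \<open>The default 0, taken where \<open>p\<close> never holds, is also the value with which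
  the scan in \<open>pick_com\<close> starts.\<close>

primrec last_true :: "(nat \<Rightarrow> bool) \<Rightarrow> nat \<Rightarrow> nat" where
  "last_true p 0 = 0"
| "last_true p (Suc n) = (if p n then n else last_true p n)"

lemma last_true_less: "0 < n \<Longrightarrow> last_true p n < n"
  by (induction n) (auto simp: less_Suc_eq)

lemma last_true_eq:
  assumes "e < n" "p e" "\<And>f. e < f \<Longrightarrow> f < n \<Longrightarrow> \<not> p f"
  shows "last_true p n = e"
  using assms by (induction n) (auto simp: less_Suc_eq)

definition weight :: "(nat \<Rightarrow> nat \<Rightarrow> real) \<Rightarrow> nat list \<Rightarrow> nat \<Rightarrow> real" where
  "weight dst cs e = Min (dst e ` set cs)"

text \<open>With \<open>r\<close> uniform in \<open>{0..R}\<close>, the last point whose preceding weight is at most \<open>r / (R + 1)\<close>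
  of the total is a sample proportional to \<open>weight\<close>, up to an error of \<open>1 / (R + 1)\<close> per point: the
  language can only draw natural numbers and cannot round reals.\<close>

definition sel :: "nat \<Rightarrow> (nat \<Rightarrow> nat \<Rightarrow> real) \<Rightarrow> nat \<Rightarrow> nat list \<Rightarrow> nat \<Rightarrow> nat" where
  "sel N dst R cs r = last_true (\<lambda>e. (\<Sum>x<e. weight dst cs x) * (real R + 1) \<le>
     (\<Sum>x<N. weight dst cs x) * real r) N"

text \<open>The candidates are a deterministic function of the list of draws, so that the program
  can be compared with \<open>run\<close> for each fixed list, and probabilities are taken over
  lists only.\<close>

primrec run :: "nat \<Rightarrow> (nat \<Rightarrow> nat \<Rightarrow> real) \<Rightarrow> nat \<Rightarrow> nat list \<Rightarrow> nat list \<Rightarrow> nat list" where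
  "run N dst R cs [] = cs"
| "run N dst R cs (r # rs) = run N dst R (cs @ [sel N dst R cs r]) rs"

lemma run_append: "run N dst R cs (rs @ rs') = run N dst R (run N dst R cs rs) rs'"
  by (induction rs arbitrary: cs) auto

lemma length_run [simp]: "length (run N dst R cs rs) = length cs + length rs"
  by (induction rs arbitrary: cs) auto

lemma set_run: "set cs \<subseteq> set (run N dst R cs rs)"
  by (induction rs arbitrary: cs) fastforce+

lemma run_less:
  assumes "0 < N" "set cs \<subseteq> {..<N}"
  shows "set (run N dst R cs rs) \<subseteq> {..<N}"
  using assms(2)
proof (induction rs arbitrary: cs)
  case (Cons r rs)
  have "sel N dst R cs r < N"
    using assms(1) by (simp add: sel_def last_true_less)
  with Cons show ?case
    by auto
qed simp

text \<open>The integers from the ceiling of \<open>x\<close> up to, but excluding, the ceiling of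
  \<open>y\<close> qualify, and rounding loses less than 1.\<close>

lemma card_nat_real_interval:
  fixes x y :: real
  assumes "0 \<le> x" "y \<le> real n"
  shows "y - x - 1 \<le> real (card {r \<in> {..<n}. x \<le> real r \<and> real r < y})"
proof (cases "x \<le> y")
  case True
  have sub: "{nat \<lceil>x\<rceil>..<nat \<lceil>y\<rceil>} \<subseteq> {r \<in> {..<n}. x \<le> real r \<and> real r < y}"
  proof
    fix r assume r: "r \<in> {nat \<lceil>x\<rceil>..<nat \<lceil>y\<rceil>}"
    then have "nat \<lceil>x\<rceil> \<le> r" "int r < \<lceil>y\<rceil>" by auto
    then have "x \<le> real r" "real r < y" by linarith+
    then show "r \<in> {r \<in> {..<n}. x \<le> real r \<and> real r < y}" using assms by simp
  qed
  have "y - x - 1 \<le> real (card {nat \<lceil>x\<rceil>..<nat \<lceil>y\<rceil>})"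
    using assms True by (simp add: of_nat_diff nat_mono ceiling_mono) linarith
  also have "\<dots> \<le> real (card {r \<in> {..<n}. x \<le> real r \<and> real r < y})"
    using card_mono[OF _ sub] by simp
  finally show ?thesis .
next
  case False
  then show ?thesis
    by (smt (verit) of_nat_0_le_iff)
qed

text \<open>The interval from 0 to \<open>R + 1\<close> is cut into consecutive pieces of length
  proportional to the weights. Every integer in the piece of \<open>e\<close> selects
  \<open>e\<close>, and each piece loses at most one integer to rounding, at most \<open>N\<close>
  in total.\<close>

lemma card_sel_ge:
  fixes N R :: nat and cs dst
  defines "w \<equiv> weight dst cs"
  defines "W \<equiv> \<Sum>x<N. w x"
  assumes w: "\<And>e. e < N \<Longrightarrow> 0 \<le> w e" and W: "0 < W" and X: "X \<subseteq> {..<N}"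
  shows "(\<Sum>e\<in>X. w e) / W * (real R + 1) - real N \<le> real (card {r \<in> {..R}. sel N dst R cs r \<in> X})"
proof -
  \<comment> \<open>\<open>lo e\<close> is the left end of the piece of \<open>e\<close>, and
    \<open>J e\<close> is the set of integers in that piece.\<close>
  define lo where "lo e = (\<Sum>x<e. w x) * (real R + 1) / W" for e
  define J where "J e = {r \<in> {..<Suc R}. lo e \<le> real r \<and> real r < lo (Suc e)}" for e
  have mono: "(\<Sum>x<e. w x) \<le> (\<Sum>x<f. w x)" if "e \<le> f" "f \<le> N" for e f
    using that w by (intro sum_mono2) auto
  have lo_mono: "lo e \<le> lo f" if "e \<le> f" "f \<le> N" for e f
    using mono[OF that] W by (simp add: lo_def divide_right_mono mult_right_mono)
  have lo_iff: "lo e \<le> real r \<longleftrightarrow> (\<Sum>x<e. w x) * (real R + 1) \<le> W * real r" for e r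
    using W by (simp add: lo_def field_simps)
  have selJ: "sel N dst R cs r = e" if "e < N" "r \<in> J e" for e r
    unfolding sel_def w_def[symmetric] W_def[symmetric] lo_iff[symmetric]
  proof (rule last_true_eq)
    fix f assume "e < f" "f < N"
    then show "\<not> lo f \<le> real r"
      using lo_mono[of "Suc e" f] that by (auto simp: J_def)
  qed (use that in \<open>auto simp: J_def\<close>)
  have cardJ: "w e / W * (real R + 1) - 1 \<le> real (card (J e))" if "e < N" for e
  proof -
    have "lo N = real (Suc R)"
      using W by (simp add: lo_def W_def)
    then have "lo (Suc e) \<le> real (Suc R)"
      using lo_mono[of "Suc e" N] that by simp
    moreover have "0 \<le> lo e"
      using lo_mono[of 0 e] that by (simp add: lo_def)
    ultimately have "lo (Suc e) - lo e - 1 \<le> real (card (J e))"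
      unfolding J_def by (rule card_nat_real_interval[rotated])
    moreover have "lo (Suc e) - lo e = w e / W * (real R + 1)"
      by (simp add: lo_def add_divide_distrib algebra_simps)
    ultimately show ?thesis
      by simp
  qed
  have fin: "finite X" using X finite_subset by blast
  have "(\<Sum>e\<in>X. w e) / W * (real R + 1) - real N \<le> (\<Sum>e\<in>X. w e / W * (real R + 1) - 1)"
    using card_mono[OF _ X] by (simp add: sum_subtractf sum_divide_distrib sum_distrib_right)
  also have "\<dots> \<le> (\<Sum>e\<in>X. real (card (J e)))"
    using X by (intro sum_mono cardJ) auto
  also have "\<dots> = real (card (\<Union>e\<in>X. J e))"
  proof -
    have "J e \<inter> J f = {}" if "e \<in> X" "f \<in> X" "e \<noteq> f" for e f
      using selJ that X by blast
    then show ?thesis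
      using fin by (subst card_UN_disjoint) (auto simp: J_def)
  qed
  also have "\<dots> \<le> real (card {r \<in> {..R}. sel N dst R cs r \<in> X})"
    using X selJ by (intro of_nat_mono card_mono) (auto simp: J_def)
  finally show ?thesis .
qed

text \<open>\<open>dst\<close> is the distance between two points, \<open>dm l e\<close> the distance of the \<open>l\<close>-th median of the
  solution compared with to the point \<open>e\<close>, and \<open>cl\<close> the cluster of a point.\<close>

locale clustering =
  fixes N k :: nat and dst dm :: "nat \<Rightarrow> nat \<Rightarrow> real" and cl :: "nat \<Rightarrow> nat"
  assumes N_pos: "0 < N"
    and cl_less: "e < N \<Longrightarrow> cl e < k"
    and dm_nonneg: "0 \<le> dm l e" and dst_nonneg: "0 \<le> dst e f"
    and dm_le: "l < k \<Longrightarrow> e < N \<Longrightarrow> f < N \<Longrightarrow> dm l f \<le> dm l e + dst e f"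
    and dst_le: "l < k \<Longrightarrow> e < N \<Longrightarrow> f < N \<Longrightarrow> dst e f \<le> dm l e + dm l f"
begin

definition a :: "nat \<Rightarrow> real" where "a e = dm (cl e) e"
definition D :: "nat list \<Rightarrow> nat \<Rightarrow> real" where "D cs l = Min (dm l ` set cs)"
definition E :: "nat \<Rightarrow> nat set" where "E l = {e \<in> {..<N}. cl e = l}"
definition A :: "nat \<Rightarrow> real" where "A l = (\<Sum>e\<in>E l. a e)"

definition covered :: "nat list \<Rightarrow> bool" where
  "covered cs \<longleftrightarrow> (\<Sum>e<N. D cs (cl e)) \<le> 4 * (\<Sum>e<N. a e)"

definition bad :: "nat list \<Rightarrow> nat set" where
  "bad cs = {l \<in> {..<k}. 3 * A l < real (card (E l)) * D cs l}"

text \<open>The factor 2 is large enough for Markov's inequality to put half of the cluster here,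
  and below the factor 3 in \<open>bad\<close>, so that choosing such a point repairs the cluster.
  Multiplying by the cardinality avoids a division that would be meaningless for empty
  clusters.\<close>

definition near :: "nat \<Rightarrow> nat set" where
  "near l = {e \<in> E l. real (card (E l)) * a e \<le> 2 * A l}"

lemma a_nonneg: "0 \<le> a e" and A_nonneg: "0 \<le> A l"
  by (auto simp: a_def A_def dm_nonneg intro: sum_nonneg)

lemma finite_E [simp]: "finite (E l)" and finite_bad [simp]: "finite (bad cs)"
  and finite_near [simp]: "finite (near l)"
  by (auto simp: E_def bad_def near_def)

lemma near_subset: "near l \<subseteq> E l" and E_subset: "E l \<subseteq> {..<N}"
  by (auto simp: near_def E_def)

lemma sum_clusters: "(\<Sum>e<N. f e) = (\<Sum>l<k. \<Sum>e\<in>E l. f e)" for f :: "nat \<Rightarrow> real"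
  unfolding E_def using cl_less by (intro sum.group[symmetric]) auto

lemma sum_D: "(\<Sum>e<N. D cs (cl e)) = (\<Sum>l<k. real (card (E l)) * D cs l)"
  unfolding sum_clusters by (intro sum.cong refl) (simp add: E_def)

lemma D_nonneg: "cs \<noteq> [] \<Longrightarrow> 0 \<le> D cs l"
  by (auto simp: D_def dm_nonneg)

lemma D_le: "c \<in> set cs \<Longrightarrow> D cs l \<le> dm l c"
  by (auto simp: D_def)

lemma D_antimono: "cs \<noteq> [] \<Longrightarrow> set cs \<subseteq> set cs' \<Longrightarrow> D cs' l \<le> D cs l"
  unfolding D_def by (intro Min_antimono) auto

lemma covered_mono: "cs \<noteq> [] \<Longrightarrow> set cs \<subseteq> set cs' \<Longrightarrow> covered cs \<Longrightarrow> covered cs'"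
  unfolding covered_def by (erule order_trans[rotated], intro sum_mono D_antimono)

lemma bad_antimono: "cs \<noteq> [] \<Longrightarrow> set cs \<subseteq> set cs' \<Longrightarrow> bad cs' \<subseteq> bad cs"
  using D_antimono by (fastforce simp: bad_def intro: mult_left_mono order.strict_trans2)

lemma bad_near:
  assumes "e \<in> near l"
  shows "l \<notin> bad (cs @ [e])"
proof -
  have "D (cs @ [e]) l \<le> a e"
    using assms D_le[of e "cs @ [e]" l] by (auto simp: near_def E_def a_def)
  then have "real (card (E l)) * D (cs @ [e]) l \<le> real (card (E l)) * a e"
    by (intro mult_left_mono) auto
  then show ?thesis
    using assms A_nonneg[of l] by (auto simp: bad_def near_def)
qed

lemma weight_nonneg: "cs \<noteq> [] \<Longrightarrow> 0 \<le> weight dst cs e"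
  by (auto simp: weight_def dst_nonneg)

text \<open>Triangle inequality through the candidate closest to the median. The converse estimate
  \<open>D_le_weight\<close> goes through the candidate closest to \<open>e\<close>.\<close>

lemma weight_le:
  assumes "cs \<noteq> []" "set cs \<subseteq> {..<N}" "e < N" "l < k"
  shows "weight dst cs e \<le> dm l e + D cs l"
proof -
  have "D cs l \<in> dm l ` set cs"
    unfolding D_def using assms by (intro Min_in) auto
  then obtain c where c: "c \<in> set cs" "D cs l = dm l c" by auto
  have "weight dst cs e \<le> dst e c"
    using c by (auto simp: weight_def)
  also have "\<dots> \<le> dm l e + dm l c"
    using assms c by (intro dst_le) auto
  finally show ?thesis using c by simp
qed

lemma D_le_weight:
  assumes "cs \<noteq> []" "set cs \<subseteq> {..<N}" "e < N" "l < k"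
  shows "D cs l \<le> dm l e + weight dst cs e"
proof -
  have "weight dst cs e \<in> dst e ` set cs"
    unfolding weight_def using assms by (intro Min_in) auto
  then obtain c where c: "c \<in> set cs" "weight dst cs e = dst e c" by auto
  have "D cs l \<le> dm l c"
    using c by (auto simp: D_def)
  also have "\<dots> \<le> dm l e + dst e c"
    using assms c by (intro dm_le) auto
  finally show ?thesis using c by simp
qed

text \<open>Markov's inequality: points outside \<open>near l\<close> exceed twice the average, so
  they are at most half of the cluster. If \<open>A l = 0\<close> there is nothing to divide by, but
  then all distances vanish and every point is near.\<close>

lemma card_near: "real (card (E l)) \<le> 2 * real (card (near l))"
proof (cases "A l = 0")
  case True
  then have "near l = E l"
    using a_nonneg sum_nonneg_eq_0_iff[of "E l" a] by (auto simp: near_def A_def)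
  then show ?thesis by simp
next
  case False
  then have pos: "0 < A l" using A_nonneg[of l] by linarith
  have "real (card (E l - near l)) * (2 * A l) = (\<Sum>e\<in>E l - near l. 2 * A l)"
    by simp
  also have "\<dots> \<le> (\<Sum>e\<in>E l - near l. real (card (E l)) * a e)"
    by (intro sum_mono) (auto simp: near_def)
  also have "\<dots> \<le> (\<Sum>e\<in>E l. real (card (E l)) * a e)"
    using a_nonneg by (intro sum_mono2) auto
  also have "\<dots> = real (card (E l)) * A l"
    by (simp add: A_def sum_distrib_left)
  finally have "2 * real (card (E l - near l)) \<le> real (card (E l))"
    using pos by (simp add: mult.assoc[symmetric] mult.commute)
  moreover have "card (E l - near l) = card (E l) - card (near l)" "card (near l) \<le> card (E l)"
    using near_subset[of l] by (auto intro: card_Diff_subset card_mono)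
  ultimately show ?thesis by linarith
qed

text \<open>For a near point of a bad cluster, \<open>a e\<close> is below two thirds of
  \<open>D cs l\<close>, so its weight is at least \<open>D cs l / 3\<close>; at least half of the
  cluster is near.\<close>

lemma mass_near:
  assumes cs: "cs \<noteq> []" "set cs \<subseteq> {..<N}" and l: "l \<in> bad cs"
  shows "real (card (E l)) * D cs l / 6 \<le> (\<Sum>e\<in>near l. weight dst cs e)"
proof -
  have "D cs l / 3 \<le> weight dst cs e" if e: "e \<in> near l" for e
  proof -
    have "real (card (E l)) * (3 * a e) \<le> 6 * A l" "6 * A l < real (card (E l)) * (2 * D cs l)"
      using e l by (simp_all add: near_def bad_def algebra_simps)
    then have "3 * a e < 2 * D cs l"
      by (smt (verit) mult_left_mono of_nat_0_le_iff)
    moreover have "D cs l \<le> a e + weight dst cs e"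
      using D_le_weight[OF cs, of e l] e l by (auto simp: near_def E_def bad_def a_def)
    ultimately show ?thesis by linarith
  qed
  then have "real (card (near l)) * (D cs l / 3) \<le> (\<Sum>e\<in>near l. weight dst cs e)"
    using sum_mono[of "near l" "\<lambda>_. D cs l / 3" "weight dst cs"] by simp
  moreover have "real (card (E l)) * (D cs l / 6) \<le> 2 * real (card (near l)) * (D cs l / 6)"
    using card_near D_nonneg[OF cs(1)] by (intro mult_right_mono) auto
  ultimately show ?thesis by (simp add: algebra_simps)
qed

text \<open>The total mass is at most \<open>T + S\<close>, hence below 5/4 of \<open>S\<close>.
  Clusters that are not bad account for at most \<open>3 * T\<close>, less than 3/4 of
  \<open>S\<close>, so the bad ones hold at least a quarter, of which near points retain a sixth as
  mass: 30 is the product of 5/4, 4 and 6. The mass is positive because it is at least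
  \<open>S - T\<close>.\<close>

lemma mass_progress:
  assumes cs: "cs \<noteq> []" "set cs \<subseteq> {..<N}" and nc: "\<not> covered cs"
  shows "(\<Sum>e<N. weight dst cs e) \<le> 30 * (\<Sum>e\<in>(\<Union>l\<in>bad cs. near l). weight dst cs e)"
    and "0 < (\<Sum>e<N. weight dst cs e)"
proof -
  let ?w = "weight dst cs"
  define S where "S = (\<Sum>e<N. D cs (cl e))"
  define T where "T = (\<Sum>e<N. a e)"
  have T: "0 \<le> T" "4 * T < S"
    using nc a_nonneg by (auto simp: T_def S_def covered_def intro: sum_nonneg)
  have "(\<Sum>e<N. ?w e) \<le> (\<Sum>e<N. a e + D cs (cl e))"
    using weight_le[OF cs] cl_less by (intro sum_mono) (auto simp: a_def)
  then have W_le: "(\<Sum>e<N. ?w e) \<le> T + S"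
    by (simp add: T_def S_def sum.distrib)
  have "S \<le> (\<Sum>e<N. a e + ?w e)"
    unfolding S_def using D_le_weight[OF cs] cl_less by (intro sum_mono) (auto simp: a_def)
  then show "0 < (\<Sum>e<N. ?w e)"
    using T by (simp add: T_def sum.distrib)
  have "S = (\<Sum>l\<in>bad cs. real (card (E l)) * D cs l) + (\<Sum>l\<in>{..<k} - bad cs. real (card (E l)) * D cs l)"
    unfolding S_def sum_D by (intro sum.subset_diff[THEN trans[OF _ add.commute]]) (auto simp: bad_def)
  also have "(\<Sum>l\<in>{..<k} - bad cs. real (card (E l)) * D cs l) \<le> (\<Sum>l\<in>{..<k} - bad cs. 3 * A l)"
    by (intro sum_mono) (auto simp: bad_def)
  also have "\<dots> \<le> (\<Sum>l<k. 3 * A l)"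
    using A_nonneg by (intro sum_mono2) auto
  also have "\<dots> = 3 * T"
    by (simp add: T_def sum_clusters A_def sum_distrib_left)
  finally have "S \<le> 4 * (\<Sum>l\<in>bad cs. real (card (E l)) * D cs l)"
    using T by linarith
  also have "(\<Sum>l\<in>bad cs. real (card (E l)) * D cs l) \<le> (\<Sum>l\<in>bad cs. 6 * (\<Sum>e\<in>near l. ?w e))"
    using mass_near[OF cs] by (intro sum_mono) fastforce
  also have "\<dots> = 6 * (\<Sum>e\<in>(\<Union>l\<in>bad cs. near l). ?w e)"
    by (subst sum.UNION_disjoint) (auto simp: near_def E_def sum_distrib_left)
  finally show "(\<Sum>e<N. ?w e) \<le> 30 * (\<Sum>e\<in>(\<Union>l\<in>bad cs. near l). ?w e)"
    using W_le T by linarith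
qed

text \<open>The rounding loss of \<open>N\<close> draws is at most \<open>R / 60\<close>, half of
  the guaranteed share of 1/30.\<close>

lemma card_progress:
  assumes cs: "cs \<noteq> []" "set cs \<subseteq> {..<N}" and nc: "\<not> covered cs" and R: "60 * N \<le> R"
  shows "real R + 1 \<le> 60 * real (card {r \<in> {..R}. sel N dst R cs r \<in> (\<Union>l\<in>bad cs. near l)})"
proof -
  let ?X = "\<Union>l\<in>bad cs. near l" and ?W = "\<Sum>e<N. weight dst cs e"
  have "1 / 30 \<le> (\<Sum>e\<in>?X. weight dst cs e) / ?W"
    using mass_progress[OF cs nc] by (simp add: field_simps)
  then have "1 / 30 * (real R + 1) \<le> (\<Sum>e\<in>?X. weight dst cs e) / ?W * (real R + 1)"
    by (intro mult_right_mono) auto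
  also have "\<dots> \<le> real (card {r \<in> {..R}. sel N dst R cs r \<in> ?X}) + real N"
    using mass_progress(2)[OF cs nc] weight_nonneg[OF cs(1)] near_subset E_subset
    using card_sel_ge[of N dst cs ?X R] by fastforce
  finally have "1 / 30 * (real R + 1) \<le> real (card {r \<in> {..R}. sel N dst R cs r \<in> ?X}) + real N" .
  moreover have "60 * real N \<le> real R"
    using R by (metis of_nat_le_iff of_nat_mult of_nat_numeral)
  ultimately show ?thesis by argo
qed

section \<open>Failure probability of the sampling\<close>

definition fail :: "nat \<Rightarrow> nat \<Rightarrow> nat list \<Rightarrow> real" where
  "fail R t cs = measure_pmf.prob (replicate_pmf t (pmf_of_set {..R})) {rs. \<not> covered (run N dst R cs rs)}"

text \<open>Conditioning on the first draw, which \<open>run\<close> turns into one more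
  candidate.\<close>

lemma fail_Suc: "fail R (Suc t) cs = (\<Sum>r\<le>R. fail R t (cs @ [sel N dst R cs r])) / (real R + 1)"
proof -
  let ?p = "replicate_pmf t (pmf_of_set {..R})"
  have fin: "finite (set_pmf ?p)"
    using finite_lists_length_eq[of "{..R}" t] by (simp add: set_replicate_pmf lists_eq_set)
  have "fail R (Suc t) cs = measure_pmf.expectation (pmf_of_set {..R} \<bind> (\<lambda>r. map_pmf ((#) r) ?p))
      (indicator {rs. \<not> covered (run N dst R cs rs)})"
    by (simp add: fail_def map_pmf_def)
  also have "\<dots> = (\<Sum>r\<le>R. measure_pmf.expectation (map_pmf ((#) r) ?p)
      (indicator {rs. \<not> covered (run N dst R cs rs)})) / (real R + 1)"
    using fin by (subst pmf_expectation_bind_pmf_of_set) (auto simp: sum_divide_distrib divide_inverse mult.commute add.commute sum_distrib_left)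
  also have "\<dots> = (\<Sum>r\<le>R. fail R t (cs @ [sel N dst R cs r])) / (real R + 1)"
    by (simp add: fail_def vimage_def)
  finally show ?thesis .
qed

text \<open>\<open>60 * card (bad cs)\<close> is a potential: until \<open>covered\<close> holds, a draw removes a bad cluster with
  probability at least \<open>1 / 60\<close>.\<close>

lemma fail_le:
  assumes R: "60 * N \<le> R"
  shows "cs \<noteq> [] \<Longrightarrow> set cs \<subseteq> {..<N} \<Longrightarrow> real t * fail R t cs \<le> 60 * real (card (bad cs))"
proof (induction t arbitrary: cs)
  case (Suc t)
  let ?cs = "\<lambda>r. cs @ [sel N dst R cs r]"
  let ?H = "{r \<in> {..R}. sel N dst R cs r \<in> (\<Union>l\<in>bad cs. near l)}"
  have sub: "set (?cs r) \<subseteq> {..<N}" for r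
    using run_less[OF N_pos Suc.prems(2), of dst R "[r]"] by simp
  show ?case
  proof (cases "covered cs")
    case True
    then have "covered (run N dst R cs rs)" for rs
      using covered_mono[OF Suc.prems(1) set_run] by blast
    then show ?thesis by (simp add: fail_def)
  next
    case False
    have step: "real t * fail R t (?cs r) \<le> 60 * (real (card (bad cs)) - (if r \<in> ?H then 1 else 0))" if "r \<in> {..R}" for r
    proof -
      have "card (bad (?cs r)) + (if r \<in> ?H then 1 else 0) \<le> card (bad cs)"
      proof (cases "r \<in> ?H")
        case True
        then obtain l where "l \<in> bad cs" "sel N dst R cs r \<in> near l" by auto
        then have "bad (?cs r) \<subset> bad cs"
          using bad_near[of _ l cs] bad_antimono[OF Suc.prems(1), of "?cs r"] by auto
        then show ?thesis
          using psubset_card_mono[of "bad cs" "bad (?cs r)"] True by simp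
      next
        case False
        then show ?thesis
          using card_mono[OF finite_bad bad_antimono[OF Suc.prems(1), of "?cs r"]] by auto
      qed
      moreover have "real t * fail R t (?cs r) \<le> 60 * real (card (bad (?cs r)))"
        using sub by (intro Suc.IH) auto
      ultimately show ?thesis by (auto split: if_splits)
    qed
    have "(\<Sum>r\<le>R. real t * fail R t (?cs r)) \<le> (\<Sum>r\<le>R. 60 * (real (card (bad cs)) - (if r \<in> ?H then 1 else 0)))"
      by (intro sum_mono step)
    also have "\<dots> = 60 * (real R + 1) * real (card (bad cs)) - 60 * real (card ?H)"
    proof -
      have "(\<Sum>r\<le>R. if r \<in> ?H then 1 else 0 :: real) = real (card ?H)"
        by (subst sum.inter_filter[symmetric]) auto
      then show ?thesis
        by (simp add: sum_distrib_left[symmetric] sum_subtractf algebra_simps del: mem_Collect_eq)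
    qed
    also have "\<dots> \<le> (60 * real (card (bad cs)) - 1) * (real R + 1)"
      using card_progress[OF Suc.prems False R] by (simp add: algebra_simps)
    finally have "real t * fail R (Suc t) cs \<le> 60 * real (card (bad cs)) - 1"
      by (simp add: fail_Suc sum_distrib_left[symmetric] field_simps)
    \<comment> \<open>The potential drops by 1 on average, and this pays for the one extra summand
      when \<open>t\<close> becomes \<open>Suc t\<close>, because a probability is at most
      1.\<close>
    moreover have "fail R (Suc t) cs \<le> 1"
      by (simp add: fail_def)
    ultimately show ?thesis by (simp add: algebra_simps)
  qed
qed simp

text \<open>At most \<open>k\<close> clusters are bad at the start, so the potential begins at no
  more than \<open>60 * k\<close>, half the number of draws.\<close>

lemma fail_le_half:
  assumes R: "60 * N \<le> R"
  shows "fail R (120 * k) [0] \<le> 1 / 2"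
proof -
  have "real (120 * k) * fail R (120 * k) [0] \<le> 60 * real (card (bad [0]))"
    using N_pos by (intro fail_le[OF R]) auto
  also have "card (bad [0]) \<le> card {..<k}"
    by (intro card_mono) (auto simp: bad_def)
  then have "60 * real (card (bad [0])) \<le> real (120 * k) * (1 / 2)"
    by simp
  finally show ?thesis
    using cl_less[OF N_pos] by simp
qed

end

section \<open>The program\<close>

definition env :: "nat \<Rightarrow> nat \<Rightarrow> point_sets \<Rightarrow> state \<Rightarrow> bool" where
  "env k d G s \<longleftrightarrow> nmem s ''k'' [] = k \<and> nmem s ''d'' [] = d \<and> nmem s ''n'' [] = length G \<and>
     (\<forall>i<length G. nmem s ''size'' [i] = length (G ! i)) \<and>
     (\<forall>i j c. (i, j) \<in> point_indices G \<longrightarrow> c < d \<longrightarrow> rmem s ''point'' [i, j, c] = G ! i ! j ! c)"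

lemma env_frame:
  assumes "frame c s s'" "env k d G s"
    "{''k'', ''d'', ''n'', ''size''} \<inter> nwrites c = {}" "''point'' \<notin> rwrites c"
  shows "env k d G s'"
  using assms by (simp add: env_def frame_nmem frame_rmem)

lemma env_simps [simp]:
  "env k d G (tick s) = env k d G s"
  "x \<notin> {''k'', ''d'', ''n'', ''size''} \<Longrightarrow> env k d G (nwrite x a v s) = env k d G s"
  "x \<noteq> ''point'' \<Longrightarrow> env k d G (rwrite x a r s) = env k d G s"
  by (auto simp: env_def)

text \<open>The prefix parameter serves the invariant of the enumeration loop; afterwards the full
  list \<open>points G\<close> fixes the numbering.\<close>

definition prefix_points :: "point_sets \<Rightarrow> nat \<Rightarrow> (nat \<times> nat) list" where
  "prefix_points G i = concat (map (\<lambda>i. map (Pair i) [0..<length (G ! i)]) [0..<i])"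

abbreviation points :: "point_sets \<Rightarrow> (nat \<times> nat) list" where
  "points G \<equiv> prefix_points G (length G)"

lemma set_points: "set (points G) = point_indices G"
  by (auto simp: prefix_points_def point_indices_def)

lemma distinct_prefix_points: "distinct (prefix_points G i)"
  by (induction i) (auto simp: prefix_points_def distinct_map inj_on_def)

lemma length_prefix_points:
  assumes "cmedians_instance k d G" "i \<le> length G"
  shows "length (prefix_points G i) \<le> i * k"
  using assms(2)
proof (induction i)
  case (Suc i)
  moreover have "length (G ! i) \<le> k"
    using assms(1) Suc.prems by (auto simp: cmedians_instance_def)
  ultimately show ?case by (simp add: prefix_points_def)
qed (simp add: prefix_points_def)

text \<open>
  Memory layout: the points are numbered consecutively, \<open>e\<close> is the point \<open>(pi [e], pj [e])\<close> and
  \<open>idx\<close> is the inverse map. \<open>ce [t]\<close> is the number of the \<open>t\<close>-th candidate, \<open>dst [e, t]\<close> its distance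
  to point \<open>e\<close>, and \<open>near [e]\<close> the nearest candidate so far. A number \<open>v\<close> below \<open>X\<close>, which is \<open>M ^ k\<close>,
  stands for the tuple of its digits \<open>dig [v, j]\<close> in base \<open>M\<close>: either \<open>k\<close> candidates, or the labels
  of the points of one set. \<open>bi [u, i]\<close> is the best labeling of the \<open>i\<close>-th set for the candidates \<open>u\<close>.
\<close>

definition enumerated :: "(nat \<times> nat) list \<Rightarrow> state \<Rightarrow> bool" where
  "enumerated xs s \<longleftrightarrow> nmem s ''N'' [] = length xs \<and>
     (\<forall>e<length xs. nmem s ''pi'' [e] = fst (xs ! e) \<and> nmem s ''pj'' [e] = snd (xs ! e)) \<and>
     (\<forall>(i, j)\<in>set xs. nmem s ''idx'' [i, j] < length xs \<and> xs ! nmem s ''idx'' [i, j] = (i, j))"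

text \<open>The new state is given through its arrays instead of as an updated state, so that the
  rule applies regardless of ticks and unrelated writes in between.\<close>

lemma enumerated_snoc:
  assumes "enumerated xs s" "nmem s' ''N'' [] = Suc (nmem s ''N'' [])"
    and "nmem s' ''pi'' = (nmem s ''pi'')([nmem s ''N'' []] := i)"
    and "nmem s' ''pj'' = (nmem s ''pj'')([nmem s ''N'' []] := j)"
    and "nmem s' ''idx'' = (nmem s ''idx'')([i, j] := nmem s ''N'' [])"
  shows "enumerated (xs @ [(i, j)]) s'"
  using assms unfolding enumerated_def
  by (auto simp: nth_append less_Suc_eq case_prod_beta)

lemma enumerated_frame:
  assumes "frame c s s'" "enumerated xs s" "{''N'', ''pi'', ''pj'', ''idx''} \<inter> nwrites c = {}"
  shows "enumerated xs s'"
  using assms by (simp add: enumerated_def frame_nmem)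

lemma enumerated_simps [simp]:
  "enumerated xs (tick s) = enumerated xs s"
  "x \<notin> {''N'', ''pi'', ''pj'', ''idx''} \<Longrightarrow> enumerated xs (nwrite x a v s) = enumerated xs s"
  "enumerated xs (rwrite x a r s) = enumerated xs s"
  by (auto simp: enumerated_def)

definition enumerate_com :: com where
  "enumerate_com = NAssign ''N'' [] (NConst 0) ;;
     For ''i'' (N0 ''n'') (For ''j'' (NVar ''size'' [N0 ''i''])
       (NAssign ''pi'' [N0 ''N''] (N0 ''i'') ;; NAssign ''pj'' [N0 ''N''] (N0 ''j'') ;;
        NAssign ''idx'' [N0 ''i'', N0 ''j''] (N0 ''N'') ;; NAssign ''N'' [] (NAdd (N0 ''N'') (NConst 1))))"

lemma ok_enumerate:
  assumes env: "env k d G s" and G: "cmedians_instance k d G"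
  shows "ok enumerate_com s (\<lambda>s'. enumerated (points G) s' \<and>
           clock s' \<le> clock s + 3 + length G * (6 * k + 4))"
proof -
  have inner: "ok (For ''j'' (NVar ''size'' [N0 ''i''])
       (NAssign ''pi'' [N0 ''N''] (N0 ''i'') ;; NAssign ''pj'' [N0 ''N''] (N0 ''j'') ;;
        NAssign ''idx'' [N0 ''i'', N0 ''j''] (N0 ''N'') ;; NAssign ''N'' [] (NAdd (N0 ''N'') (NConst 1)))) s1
      (\<lambda>s'. enumerated (prefix_points G (Suc i)) s' \<and> clock s' \<le> clock s1 + (6 * k + 2))"
    if i: "i < length G" "nmem s1 ''i'' [] = i" "env k d G s1" "enumerated (prefix_points G i) s1" for i s1
  proof -
    have "length (G ! i) \<le> k"
      using G i by (auto simp: cmedians_instance_def)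
    then have *: "length (G ! i) * 6 \<le> 6 * k" by simp
    show ?thesis
      apply (rule ok_conseq[OF ok_For[where N = "length (G ! i)" and K = 4 and
        I = "\<lambda>j s'. enumerated (prefix_points G i @ map (Pair i) [0..<j]) s'"]])
      subgoal by simp
      subgoal for s' using i by (simp add: frame_nmem env_def)
      subgoal by simp
      subgoal by simp
      subgoal using i by simp
      subgoal for j s'
        using i by (intro ok_assign conjI)
          (simp_all add: frame_nmem append_assoc[symmetric] enumerated_snoc del: append_assoc)
      subgoal for s'
        using * by (simp add: prefix_points_def)
      done
  qed
  show ?thesis
    unfolding enumerate_com_def
    apply (intro ok_assign)
    apply (rule ok_conseq[OF ok_For[where N = "length G" and K = "6 * k + 2" and
        I = "\<lambda>i. enumerated (prefix_points G i)"]])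
    subgoal by simp
    subgoal for s' using env by (simp add: frame_nmem env_def)
    subgoal by simp
    subgoal by simp
    subgoal by (simp add: enumerated_def prefix_points_def)
    subgoal for i s'
      using env by (intro inner) (simp_all add: env_frame)
    subgoal by (simp add: algebra_simps)
    done
qed

section \<open>Distances between numbered points\<close>

definition pt :: "point_sets \<Rightarrow> nat \<Rightarrow> point" where
  "pt G e = G ! fst (points G ! e) ! snd (points G ! e)"

definition pdist :: "point_sets \<Rightarrow> nat \<Rightarrow> nat \<Rightarrow> real" where
  "pdist G e f = euclid_dist (pt G e) (pt G f)"

lemma length_pt:
  assumes "cmedians_instance k d G" "e < length (points G)"
  shows "length (pt G e) = d"
proof -
  obtain i j where ij: "points G ! e = (i, j)" "(i, j) \<in> point_indices G"
    using nth_mem[OF assms(2)] unfolding set_points by (metis prod.exhaust)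
  then have "G ! i \<in> set G" "G ! i ! j \<in> set (G ! i)"
    by (auto simp: point_indices_def)
  with assms(1) ij(1) show ?thesis
    by (auto simp: pt_def cmedians_instance_def)
qed

lemma point_read:
  assumes "env k d G s" "enumerated (points G) s" "e < length (points G)" "c < d"
  shows "rmem s ''point'' [nmem s ''pi'' [e], nmem s ''pj'' [e], c] = pt G e ! c"
  using assms nth_mem[OF assms(3)] unfolding set_points
  by (auto simp: env_def enumerated_def pt_def)

definition distance_com :: com where
  "distance_com = RAssign ''acc'' [] (RNat (NConst 0)) ;;
     For ''c'' (N0 ''d'') (
       RAssign ''x'' [] (RSub
         (RVar ''point'' [NVar ''pi'' [N0 ''e''], NVar ''pj'' [N0 ''e''], N0 ''c''])
         (RVar ''point'' [NVar ''pi'' [NVar ''ce'' [N0 ''t'']], NVar ''pj'' [NVar ''ce'' [N0 ''t'']], N0 ''c''])) ;;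
       RAssign ''acc'' [] (RAdd (R0 ''acc'') (RMul (R0 ''x'') (R0 ''x'')))) ;;
     RAssign ''dst'' [N0 ''e'', N0 ''t''] (RSqrt (R0 ''acc''))"

lemma ok_distance:
  assumes env: "env k d G s" and en: "enumerated (points G) s" and G: "cmedians_instance k d G"
    and e: "nmem s ''e'' [] = e" "e < length (points G)"
    and t: "nmem s ''t'' [] = t" "nmem s ''ce'' [t] = f" "f < length (points G)"
  shows "ok distance_com s (\<lambda>s'. rmem s' ''dst'' = (rmem s ''dst'')([e, t] := pdist G e f) \<and>
           clock s' \<le> clock s + (4 + 4 * d))"
  unfolding distance_com_def
  apply (intro ok_assign ok_Seq)
  apply (rule ok_conseq[OF ok_For[where N = d and K = 2 and
        I = "\<lambda>c s'. rmem s' ''acc'' [] = (\<Sum>c<c. (pt G e ! c - pt G f ! c)\<^sup>2)"]])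
  subgoal by simp
  subgoal for s' using env by (simp add: frame_nmem env_def)
  subgoal by simp
  subgoal by simp
  subgoal by simp
  subgoal for c s'
    using env e t env_frame[of _ "tick (rwrite ''acc'' [] 0 s)" s']
      enumerated_frame[of _ "tick (rwrite ''acc'' [] 0 s)" s' "points G"]
      point_read[of k d G s' e c] point_read[of k d G s' f c] en
    by (intro ok_assign) (simp add: frame_nmem power2_eq_square)
  subgoal for s'
    using e t length_pt[OF G e(2)]
    by (simp add: frame_nmem frame_rmem pdist_def euclid_dist_def L2_set_def)
  done

section \<open>Nearest candidates and the weighted choice\<close>

lemma weight_singleton [simp]: "weight dst [c] e = dst e c"
  by (simp add: weight_def)

lemma weight_snoc: "cs \<noteq> [] \<Longrightarrow> weight dst (cs @ [c]) e = min (weight dst cs e) (dst e c)"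
  by (simp add: weight_def min.commute)

definition nearest_dist :: rexp where
  "nearest_dist = RVar ''dst'' [N0 ''e'', NVar ''near'' [N0 ''e'']]"

text \<open>Each pass compares only with the newest candidate and reuses the minimum over the older
  ones, so a draw costs order \<open>N * d\<close> independently of how many candidates
  exist.\<close>

definition weigh_com :: com where
  "weigh_com = RAssign ''W'' [] (RNat (NConst 0)) ;;
     For ''e'' (N0 ''N'') (
       distance_com ;;
       If (RLess (RVar ''dst'' [N0 ''e'', N0 ''t'']) nearest_dist) (NAssign ''near'' [N0 ''e''] (N0 ''t'')) Skip ;;
       RAssign ''W'' [] (RAdd (R0 ''W'') nearest_dist))"

text \<open>The negated test is the inequality of \<open>sel\<close>, with \<open>A\<close> as the
  weight preceding \<open>e\<close>. Overwriting the choice whenever it holds leaves the last such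
  index, as in \<open>last_true\<close>.\<close>

definition pick_com :: com where
  "pick_com = NAssign ''ce'' [NAdd (N0 ''t'') (NConst 1)] (NConst 0) ;;
     RAssign ''A'' [] (RNat (NConst 0)) ;;
     For ''e'' (N0 ''N'') (
       If (Not (RLess (RMul (R0 ''W'') (RNat (NVar ''rnd'' [N0 ''t'']))) (RMul (R0 ''A'') (RNat (NAdd (N0 ''R'') (NConst 1))))))
         (NAssign ''ce'' [NAdd (N0 ''t'') (NConst 1)] (N0 ''e'')) Skip ;;
       RAssign ''A'' [] (RAdd (R0 ''A'') nearest_dist))"

text \<open>For the first center \<open>near\<close> still holds its initial value \<open>0\<close>, so that no case distinction
  is needed in the program.\<close>

definition nearest_ok :: "point_sets \<Rightarrow> nat list \<Rightarrow> nat \<Rightarrow> state \<Rightarrow> nat \<Rightarrow> bool" where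
  "nearest_ok G cs t s e \<longleftrightarrow> nmem s ''near'' [e] \<le> t - 1 \<and>
     (0 < t \<longrightarrow> pdist G e (cs ! nmem s ''near'' [e]) = weight (pdist G) (take t cs) e)"

definition sampled :: "point_sets \<Rightarrow> nat list \<Rightarrow> nat \<Rightarrow> state \<Rightarrow> bool" where
  "sampled G cs t s \<longleftrightarrow> (\<forall>e<length (points G).
     (\<forall>x<t. rmem s ''dst'' [e, x] = pdist G e (cs ! x)) \<and> nearest_ok G cs t s e)"

text \<open>The halfway state of a pass: it leads from \<open>sampled G cs t\<close> at
  \<open>e = 0\<close> to \<open>sampled G cs (Suc t)\<close> when all points have been
  visited.\<close>

definition weighing :: "point_sets \<Rightarrow> nat list \<Rightarrow> nat \<Rightarrow> nat \<Rightarrow> state \<Rightarrow> bool" where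
  "weighing G cs t e s \<longleftrightarrow>
     (\<forall>f<length (points G). \<forall>x<t. rmem s ''dst'' [f, x] = pdist G f (cs ! x)) \<and>
     (\<forall>f<e. rmem s ''dst'' [f, t] = pdist G f (cs ! t) \<and> nearest_ok G cs (Suc t) s f) \<and>
     (\<forall>f<length (points G). e \<le> f \<longrightarrow> nearest_ok G cs t s f) \<and>
     rmem s ''W'' [] = (\<Sum>f<e. weight (pdist G) (take (Suc t) cs) f)"

lemma ok_weigh_body:
  assumes env: "env k d G s" and en: "enumerated (points G) s" and G: "cmedians_instance k d G"
    and e: "nmem s ''e'' [] = e" "e < length (points G)"
    and t: "nmem s ''t'' [] = t" "t < length cs"
    and cs: "\<And>x. x \<le> t \<Longrightarrow> nmem s ''ce'' [x] = cs ! x" "set cs \<subseteq> {..<length (points G)}"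
    and w: "weighing G cs t e s"
  shows "ok (distance_com ;;
       If (RLess (RVar ''dst'' [N0 ''e'', N0 ''t'']) nearest_dist) (NAssign ''near'' [N0 ''e''] (N0 ''t'')) Skip ;;
       RAssign ''W'' [] (RAdd (R0 ''W'') nearest_dist)) s
    (\<lambda>s'. weighing G cs t (Suc e) s' \<and> clock s' \<le> clock s + (4 * d + 7))"
proof (rule ok_Seq, rule ok_conseq[OF ok_distance[OF env en G e t(1) cs(1)[OF order_refl]]])
  have tN: "cs ! t < length (points G)"
    using cs(2) t(2) nth_mem by blast
  show "cs ! t < length (points G)" by fact
  fix s' assume fr: "frame distance_com s s'"
    and s': "rmem s' ''dst'' = (rmem s ''dst'')([e, t] := pdist G e (cs ! t)) \<and> clock s' \<le> clock s + (4 + 4 * d)"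
  have m: "nmem s' ''e'' = nmem s ''e''" "nmem s' ''t'' = nmem s ''t''" "nmem s' ''near'' = nmem s ''near''"
     "rmem s' ''W'' = rmem s ''W''"
    using fr by (simp_all add: frame_nmem frame_rmem distance_com_def)
  let ?b = "nmem s ''near'' [e]"
  have near: "nearest_ok G cs t s e" and dst: "\<And>x. x < t \<Longrightarrow> rmem s ''dst'' [e, x] = pdist G e (cs ! x)"
    using w e by (auto simp: weighing_def)
  \<comment> \<open>In the first pass the stored index is \<open>t\<close> itself, so the new
    distance is compared with itself and nothing changes; later the index points to an older
    candidate.\<close>
  have b: "?b = t \<and> t = 0 \<or> ?b < t \<and> 0 < t"
    using near by (auto simp: nearest_ok_def)
  have take: "take (Suc t) cs = take t cs @ [cs ! t]"
    using t by (simp add: take_Suc_conv_app_nth)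
  have "cs \<noteq> []"
    using t(2) by auto
  have rb: "rmem s' ''dst'' [e, ?b] = pdist G e (cs ! ?b)"
    using b s' dst by auto
  have rt: "rmem s' ''dst'' [e, t] = pdist G e (cs ! t)"
    using s' by auto
  define s'' where "s'' = (if pdist G e (cs ! t) < pdist G e (cs ! ?b) then tick (nwrite ''near'' [e] t (tick s')) else tick (tick s'))"
  define s3 where "s3 = tick (rwrite ''W'' [] (rmem s'' ''W'' [] + rmem s'' ''dst'' [e, nmem s'' ''near'' [e]]) s'')"
  have near3: "nearest_ok G cs (Suc t) s3 e"
    using b near t(2) \<open>cs \<noteq> []\<close> unfolding nearest_ok_def take
    by (auto simp: s3_def s''_def m min_def weight_snoc)
  have W3: "rmem s3 ''W'' [] = (\<Sum>f<Suc e. weight (pdist G) (take (Suc t) cs) f)"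
  proof -
    have "rmem s'' ''dst'' [e, nmem s'' ''near'' [e]] = weight (pdist G) (take (Suc t) cs) e"
      using near3 b rb rt by (auto simp: s3_def s''_def nearest_ok_def m split: if_splits)
    then show ?thesis
      using w by (simp add: s3_def s''_def m weighing_def)
  qed
  have d3: "rmem s3 ''dst'' = (rmem s ''dst'')([e, t] := pdist G e (cs ! t))"
    using s' by (simp add: s3_def s''_def)
  have n3: "nmem s3 ''near'' [f] = nmem s ''near'' [f]" if "f \<noteq> e" for f
    using that by (simp add: s3_def s''_def m)
  have "nearest_ok G cs t' s3 f = nearest_ok G cs t' s f" if "f \<noteq> e" for f t'
    using n3[OF that] by (simp add: nearest_ok_def)
  then have "weighing G cs t (Suc e) s3"
    using w near3 W3 unfolding weighing_def d3 by (auto simp: less_Suc_eq)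
  moreover have "clock s3 \<le> clock s + (4 * d + 7)"
    using s' by (simp add: s3_def s''_def)
  ultimately show "ok (If (RLess (RVar ''dst'' [N0 ''e'', N0 ''t'']) nearest_dist)
        (NAssign ''near'' [N0 ''e''] (N0 ''t'')) Skip ;;
       RAssign ''W'' [] (RAdd (R0 ''W'') nearest_dist)) s'
      (\<lambda>s'. weighing G cs t (Suc e) s' \<and> clock s' \<le> clock s + (4 * d + 7))"
    using rb rt e t unfolding nearest_dist_def
    by (intro ok_Seq ok_IfI ok_assign) (simp_all add: m s3_def s''_def)
qed

text \<open>The bound on \<open>cs\<close> is conditional because all point-sets may be empty, and
  then the starting candidate 0 denotes no point.\<close>

lemma ok_weigh:
  assumes env: "env k d G s" and en: "enumerated (points G) s" and G: "cmedians_instance k d G"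
    and t: "nmem s ''t'' [] = t" "t < length cs"
    and cs: "\<And>x. x \<le> t \<Longrightarrow> nmem s ''ce'' [x] = cs ! x"
       "0 < length (points G) \<Longrightarrow> set cs \<subseteq> {..<length (points G)}"
    and w: "sampled G cs t s"
  shows "ok weigh_com s (\<lambda>s'. sampled G cs (Suc t) s' \<and>
     rmem s' ''W'' [] = (\<Sum>f<length (points G). weight (pdist G) (take (Suc t) cs) f) \<and>
     clock s' \<le> clock s + (3 + length (points G) * (4 * d + 9)))"
  unfolding weigh_com_def
  apply (intro ok_assign)
  apply (rule ok_conseq[OF ok_For[where N = "length (points G)" and K = "4 * d + 7" and
      I = "weighing G cs t"]])
  subgoal by (simp add: distance_com_def)
  subgoal for s' using en by (simp add: frame_nmem enumerated_def distance_com_def)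
  subgoal by (simp add: weighing_def nearest_ok_def)
  subgoal by (simp add: weighing_def nearest_ok_def)
  subgoal using w by (simp add: weighing_def nearest_ok_def sampled_def)
  subgoal for e s'
    using env en t cs(1) cs(2)[OF le_less_trans[OF le0, of e]]
    by (intro ok_weigh_body[OF _ _ G]) (simp_all add: frame_nmem enumerated_frame env_frame distance_com_def)
  subgoal for s'
    by (simp add: weighing_def sampled_def less_Suc_eq algebra_simps)
  done

lemma ok_pick:
  assumes en: "enumerated (points G) s"
    and t: "nmem s ''t'' [] = t" "Suc t = length cs"
    and w: "sampled G cs (Suc t) s"
    and W: "rmem s ''W'' [] = (\<Sum>f<length (points G). weight (pdist G) cs f)"
    and R: "nmem s ''R'' [] = R"
  shows "ok pick_com s (\<lambda>s'. nmem s' ''ce'' = (nmem s ''ce'')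
       ([Suc t] := sel (length (points G)) (pdist G) R cs (nmem s ''rnd'' [t])) \<and>
     clock s' \<le> clock s + (4 + length (points G) * 5))"
proof -
  \<comment> \<open>\<open>p\<close> is the predicate inside \<open>sel\<close>, so the scan has to
    compute \<open>last_true p\<close>.\<close>
  define p where "p e \<longleftrightarrow> (\<Sum>x<e. weight (pdist G) cs x) * (real R + 1) \<le>
     (\<Sum>x<length (points G). weight (pdist G) cs x) * real (nmem s ''rnd'' [t])" for e
  show ?thesis
    unfolding pick_com_def
    apply (intro ok_assign)
    apply (rule ok_conseq[OF ok_For[where N = "length (points G)" and K = 3 and
      I = "\<lambda>e s'. rmem s' ''A'' [] = (\<Sum>f<e. weight (pdist G) cs f) \<and>
             nmem s' ''ce'' = (nmem s ''ce'')([Suc t] := last_true p e)"]])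
    subgoal by simp
    subgoal for s' using en by (simp add: frame_nmem enumerated_def)
    subgoal by simp
    subgoal by simp
    subgoal using t by simp
    subgoal premises prems for e s'
    proof -
      have m: "nmem s' ''t'' [] = t" "nmem s' ''R'' [] = R" "nmem s' ''rnd'' = nmem s ''rnd''"
         "rmem s' ''W'' = rmem s ''W''" "rmem s' ''dst'' = rmem s ''dst''"
         "nmem s' ''near'' = nmem s ''near''"
        using prems t R by (simp_all add: frame_nmem frame_rmem)
      have "rmem s ''dst'' [e, nmem s ''near'' [e]] = weight (pdist G) cs e"
        using w prems(1) t(2) by (auto simp: sampled_def nearest_ok_def less_Suc_eq_le)
      then show ?thesis
        using prems(2,3) W m unfolding nearest_dist_def
        by (intro ok_Seq ok_IfI ok_assign) (auto simp: p_def add.commute)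
    qed
    subgoal by (simp add: sel_def p_def[abs_def])
    done
qed

text \<open>There are \<open>T\<close> draws but \<open>M = T + 1\<close> rounds: the starting
  candidate 0 is given, and the last round supplies the distances of candidate
  \<open>T\<close>.\<close>

definition sample_com :: com where
  "sample_com = For ''t'' (N0 ''M'') (weigh_com ;; pick_com)"

lemma ok_sample:
  fixes G s R
  defines "cs \<equiv> \<lambda>t. run (length (points G)) (pdist G) R [0] (map (\<lambda>t. nmem s ''rnd'' [t]) [0..<t])"
  assumes env: "env k d G s" and en: "enumerated (points G) s" and G: "cmedians_instance k d G"
    and R: "nmem s ''R'' [] = R" and M: "nmem s ''M'' [] = Suc T"
    and init: "\<And>e. nmem s ''near'' [e] = 0" "nmem s ''ce'' [0] = 0"
  shows "ok sample_com s (\<lambda>s'. (\<forall>t\<le>T. nmem s' ''ce'' [t] = cs T ! t) \<and>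
     (\<forall>t\<le>T. \<forall>e<length (points G). rmem s' ''dst'' [e, t] = pdist G e (cs T ! t)) \<and>
     clock s' \<le> clock s + 2 + Suc T * (length (points G) * (4 * d + 14) + 9))"
proof -
  let ?N = "length (points G)"
  have len: "length (cs t) = Suc t" for t
    by (simp add: cs_def)
  have cs_Suc: "cs (Suc t) = cs t @ [sel ?N (pdist G) R (cs t) (nmem s ''rnd'' [t])]" for t
    by (simp add: cs_def run_append)
  have cs_less: "set (cs t) \<subseteq> {..<?N}" if "0 < ?N" for t
    using that unfolding cs_def by (intro run_less) auto
  have nth_Suc: "cs (Suc t) ! x = cs t ! x" if "x \<le> t" for t x
    using that len[of t] by (simp add: cs_Suc nth_append)
  have nth_last: "cs (Suc t) ! Suc t = sel ?N (pdist G) R (cs t) (nmem s ''rnd'' [t])" for t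
    using len[of t] by (simp add: cs_Suc nth_append)
  \<comment> \<open>Distances and nearest indices up to \<open>Suc t\<close> refer to the first
    \<open>Suc t\<close> candidates, so appending the next choice leaves the predicate
    unchanged.\<close>
  have sampled_Suc: "sampled G (cs (Suc t)) (Suc t) s' = sampled G (cs t) (Suc t) s'" for t s'
    using len[of t] nth_Suc[of _ t]
    by (auto simp: sampled_def nearest_ok_def less_Suc_eq_le cs_Suc nth_append)
  show ?thesis
    unfolding sample_com_def
    apply (rule ok_conseq[OF ok_For[where N = "Suc T" and K = "?N * (4 * d + 14) + 7" and
        I = "\<lambda>t s'. (\<forall>x\<le>t. nmem s' ''ce'' [x] = cs t ! x) \<and> sampled G (cs t) t s'"]])
    subgoal by (simp add: weigh_com_def pick_com_def distance_com_def)
    subgoal for s' using M by (simp add: frame_nmem weigh_com_def pick_com_def distance_com_def)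
    subgoal by (simp add: sampled_def nearest_ok_def)
    subgoal by (simp add: sampled_def nearest_ok_def)
    subgoal using init by (simp add: cs_def sampled_def nearest_ok_def)
    subgoal premises prems for t s'
    proof -
      have m: "nmem s' ''R'' [] = R" "nmem s' ''rnd'' = nmem s ''rnd''" "env k d G s'" "enumerated (points G) s'"
        using prems(4) env en R by (simp_all add: frame_nmem env_frame enumerated_frame weigh_com_def pick_com_def distance_com_def)
      show ?thesis
      proof (rule ok_Seq, rule ok_conseq[OF ok_weigh[OF m(3,4) G prems(2)]])
        fix s2 assume fr: "frame weigh_com s' s2" and s2: "sampled G (cs t) (Suc t) s2 \<and>
           rmem s2 ''W'' [] = (\<Sum>f<?N. weight (pdist G) (take (Suc t) (cs t)) f) \<and>
           clock s2 \<le> clock s' + (3 + ?N * (4 * d + 9))"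
        have m2: "nmem s2 ''t'' = nmem s' ''t''" "nmem s2 ''R'' [] = R" "nmem s2 ''rnd'' = nmem s ''rnd''"
           "enumerated (points G) s2" "nmem s2 ''ce'' = nmem s' ''ce''"
          using fr m by (simp_all add: frame_nmem enumerated_frame weigh_com_def distance_com_def)
        show "ok pick_com s2 (\<lambda>s''. ((\<forall>x\<le>Suc t. nmem s'' ''ce'' [x] = cs (Suc t) ! x) \<and>
            sampled G (cs (Suc t)) (Suc t) s'') \<and> clock s'' \<le> clock s' + (?N * (4 * d + 14) + 7))"
        proof (rule ok_conseq[OF ok_pick[where t = t and cs = "cs t" and R = R and G = G]])
          fix s3 assume fr: "frame pick_com s2 s3" and s3: "nmem s3 ''ce'' = (nmem s2 ''ce'')
            ([Suc t] := sel ?N (pdist G) R (cs t) (nmem s2 ''rnd'' [t])) \<and>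
             clock s3 \<le> clock s2 + (4 + ?N * 5)"
          have "rmem s3 ''dst'' = rmem s2 ''dst''" "nmem s3 ''near'' = nmem s2 ''near''"
            using fr by (simp_all add: frame_nmem frame_rmem pick_com_def)
          then have "sampled G (cs t) (Suc t) s3"
            using s2 by (simp add: sampled_def nearest_ok_def)
          then show "((\<forall>x\<le>Suc t. nmem s3 ''ce'' [x] = cs (Suc t) ! x) \<and>
            sampled G (cs (Suc t)) (Suc t) s3) \<and> clock s3 \<le> clock s' + (?N * (4 * d + 14) + 7)"
            using s2 s3 prems(3) m2 by (auto simp: sampled_Suc nth_Suc nth_last le_Suc_eq algebra_simps)
        qed (use m2 prems s2 len[of t] in auto)
      qed (use prems len[of t] cs_less[of t] in auto)
    qed
    subgoal for s'
      by (auto simp: sampled_Suc sampled_def nth_Suc less_Suc_eq_le algebra_simps)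
    done
qed

section \<open>Tuples as numbers in base \<open>M\<close>\<close>

definition power_com :: com where
  "power_com = NAssign ''X'' [] (NConst 1) ;; For ''i'' (N0 ''k'') (NAssign ''X'' [] (NMul (N0 ''X'') (N0 ''M'')))"

lemma ok_power:
  "ok power_com s (\<lambda>s'. nmem s' ''X'' [] = nmem s ''M'' [] ^ nmem s ''k'' [] \<and> clock s' \<le> clock s + (3 + nmem s ''k'' [] * 3))"
  unfolding power_com_def
  apply (intro ok_assign)
  apply (rule ok_conseq[OF ok_For[where N = "nmem s ''k'' []" and K = 1 and I = "\<lambda>i s'. nmem s' ''X'' [] = nmem s ''M'' [] ^ i"]])
  by (auto simp: frame_nmem)

text \<open>The language has no division, so \<open>q\<close> and \<open>r\<close> are carried along
  as quotient and remainder of \<open>v\<close>. The digits of \<open>v\<close> are \<open>r\<close>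
  followed by those of \<open>q\<close>, and the row of \<open>q\<close> is already in the
  table.\<close>

definition table_com :: com where
  "table_com = NAssign ''q'' [] (NConst 0) ;; NAssign ''r'' [] (NConst 0) ;;
     For ''v'' (N0 ''X'') (
       NAssign ''dig'' [N0 ''v'', NConst 0] (N0 ''r'') ;;
       For ''j'' (N0 ''k'') (NAssign ''dig'' [N0 ''v'', NAdd (N0 ''j'') (NConst 1)] (NVar ''dig'' [N0 ''q'', N0 ''j''])) ;;
       NAssign ''r'' [] (NAdd (N0 ''r'') (NConst 1)) ;;
       If (Not (NLess (N0 ''r'') (N0 ''M''))) (NAssign ''r'' [] (NConst 0) ;; NAssign ''q'' [] (NAdd (N0 ''q'') (NConst 1))) Skip)"

definition digit :: "nat \<Rightarrow> nat \<Rightarrow> nat \<Rightarrow> nat" where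
  "digit M v j = v div M ^ j mod M"

lemma digit_0: "digit M v 0 = v mod M" and digit_Suc: "digit M v (Suc j) = digit M (v div M) j"
  by (simp_all add: digit_def div_mult2_eq)

text \<open>Horner's scheme: \<open>f 0 + M * v\<close> puts the digit \<open>f 0\<close> in front
  of the digits of \<open>v\<close>.\<close>

lemma ex_digits:
  assumes "\<And>j. j < k \<Longrightarrow> f j < M"
  shows "\<exists>v < M ^ k. \<forall>j<k. digit M v j = f j"
  using assms
proof (induction k arbitrary: f)
  case (Suc k)
  obtain v where v: "v < M ^ k" "\<forall>j<k. digit M v j = f (Suc j)"
    using Suc.IH[of "\<lambda>j. f (Suc j)"] Suc.prems by auto
  have f0: "f 0 < M" using Suc.prems by simp
  have "f 0 + M * v < M * Suc v" using f0 by simp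
  also have "\<dots> \<le> M * M ^ k" using v by (intro mult_le_mono2) simp
  finally have "f 0 + M * v < M ^ Suc k" by simp
  moreover have "digit M (f 0 + M * v) j = f j" if "j < Suc k" for j
    using that v f0 by (cases j) (auto simp: digit_0 digit_Suc)
  ultimately show ?case by blast
qed simp

lemma ok_table:
  assumes M: "2 \<le> nmem s ''M'' []"
  shows "ok table_com s (\<lambda>s'. (\<forall>v<nmem s ''X'' []. \<forall>j\<le>nmem s ''k'' []. nmem s' ''dig'' [v, j] = digit (nmem s ''M'' []) v j) \<and>
     clock s' \<le> clock s + (4 + nmem s ''X'' [] * (3 * nmem s ''k'' [] + 9)))"
proof -
  let ?M = "nmem s ''M'' []" and ?X = "nmem s ''X'' []" and ?k = "nmem s ''k'' []"
  have body: "ok (NAssign ''dig'' [N0 ''v'', NConst 0] (N0 ''r'') ;;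
       For ''j'' (N0 ''k'') (NAssign ''dig'' [N0 ''v'', NAdd (N0 ''j'') (NConst 1)] (NVar ''dig'' [N0 ''q'', N0 ''j''])) ;;
       NAssign ''r'' [] (NAdd (N0 ''r'') (NConst 1)) ;;
       If (Not (NLess (N0 ''r'') (N0 ''M''))) (NAssign ''r'' [] (NConst 0) ;; NAssign ''q'' [] (NAdd (N0 ''q'') (NConst 1))) Skip) s1
     (\<lambda>s'. ((nmem s' ''q'' [] = Suc v div ?M \<and> nmem s' ''r'' [] = Suc v mod ?M) \<and>
         (\<forall>w<Suc v. \<forall>j\<le>?k. nmem s' ''dig'' [w, j] = digit ?M w j)) \<and> clock s' \<le> clock s1 + (3 * ?k + 7))"
    if s1: "nmem s1 ''v'' [] = v" "nmem s1 ''q'' [] = v div ?M" "nmem s1 ''r'' [] = v mod ?M"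
      "\<forall>w<v. \<forall>j\<le>?k. nmem s1 ''dig'' [w, j] = digit ?M w j" "nmem s1 ''M'' [] = ?M" "nmem s1 ''k'' [] = ?k" for v s1
    apply (intro ok_assign ok_Seq)
    apply (rule ok_conseq[OF ok_For[where N = ?k and K = 1 and
       I = "\<lambda>j s'. (\<forall>w<v. \<forall>j\<le>?k. nmem s' ''dig'' [w, j] = digit ?M w j) \<and> (\<forall>x\<le>j. nmem s' ''dig'' [v, x] = digit ?M v x)"]])
    subgoal by simp
    subgoal for s' using s1 by (simp add: frame_nmem)
    subgoal by simp
    subgoal by simp
    subgoal using s1 by (simp add: digit_0)
    subgoal premises prems for j s'
    proof -
      have m: "nmem s' ''v'' [] = v" "nmem s' ''q'' [] = v div ?M"
        using prems s1 by (simp_all add: frame_nmem)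
      \<comment> \<open>For \<open>v = 0\<close> the row being read is the row being written, but
        its entries up to \<open>j\<close> are already 0. For positive \<open>v\<close>,
        \<open>M \<ge> 2\<close> makes the quotient smaller, so its row is finished.\<close>
      have "nmem s' ''dig'' [v div ?M, j] = digit ?M v (Suc j)"
      proof (cases "v = 0")
        case True
        then show ?thesis using prems(3) by (simp add: digit_def)
      next
        case False
        then have "v div ?M < v" using M by simp
        then show ?thesis using prems(1,3) by (simp add: digit_Suc)
      qed
      then show ?thesis
        using m prems(2,3) by (intro ok_assign) (auto simp: le_Suc_eq)
    qed
    subgoal premises prems for s'
    proof -
      have m: "nmem s' ''v'' [] = v" "nmem s' ''q'' [] = v div ?M" "nmem s' ''r'' [] = v mod ?M" "nmem s' ''M'' [] = ?M"
        using prems s1 by (simp_all add: frame_nmem)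
      have "clock s' \<le> clock s1 + 3 + 3 * ?k"
        using prems by simp
      moreover have "Suc (v mod ?M) < ?M \<or> Suc (v mod ?M) = ?M"
        using M mod_less_divisor[of ?M v] by linarith
      ultimately show ?thesis
        using m prems(2) by (intro ok_assign ok_IfI) (auto simp: less_Suc_eq div_Suc mod_Suc)
    qed
    done
  show ?thesis
    unfolding table_com_def
    apply (intro ok_assign)
    apply (rule ok_conseq[OF ok_For[where N = ?X and K = "3 * ?k + 7" and
       I = "\<lambda>v s'. (nmem s' ''q'' [] = v div ?M \<and> nmem s' ''r'' [] = v mod ?M) \<and> (\<forall>w<v. \<forall>j\<le>?k. nmem s' ''dig'' [w, j] = digit ?M w j)"]])
    subgoal by simp
    subgoal for s' by (simp add: frame_nmem)
    subgoal by simp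
    subgoal by simp
    subgoal by simp
    subgoal for v s'
      by (rule body) (simp_all add: frame_nmem)
    subgoal by (simp add: algebra_simps)
    done
qed

section \<open>The best labeling of one point-set\<close>

definition feasible :: "nat \<Rightarrow> nat \<Rightarrow> (nat \<Rightarrow> nat) \<Rightarrow> bool" where
  "feasible k m f \<longleftrightarrow> (\<forall>j<m. f j < k) \<and> inj_on f {..<m}"

lemma feasible_0 [simp]: "feasible k 0 f"
  and feasible_Suc: "feasible k (Suc m) f \<longleftrightarrow> feasible k m f \<and> f m < k \<and> (\<forall>x<m. f x \<noteq> f m)"
  by (auto simp: feasible_def lessThan_Suc less_Suc_eq image_iff) (metis lessThan_iff)

text \<open>Digits range below \<open>M\<close>, which can exceed \<open>k\<close>, hence the
  explicit range check; equality of digits is expressed by two negated comparisons. The cost is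
  accumulated whether or not \<open>v\<close> turns out to be feasible.\<close>

definition evaluate_com :: com where
  "evaluate_com = NAssign ''bad'' [N0 ''v''] (NConst 0) ;; RAssign ''cst'' [N0 ''v''] (RNat (NConst 0)) ;;
     For ''j'' (NVar ''size'' [N0 ''i'']) (
       If (NLess (NVar ''dig'' [N0 ''v'', N0 ''j'']) (N0 ''k'')) Skip (NAssign ''bad'' [N0 ''v''] (NConst 1)) ;;
       For ''h'' (N0 ''j'') (
         If (And (Not (NLess (NVar ''dig'' [N0 ''v'', N0 ''h'']) (NVar ''dig'' [N0 ''v'', N0 ''j''])))
                 (Not (NLess (NVar ''dig'' [N0 ''v'', N0 ''j'']) (NVar ''dig'' [N0 ''v'', N0 ''h'']))))
           (NAssign ''bad'' [N0 ''v''] (NConst 1)) Skip) ;;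
       RAssign ''cst'' [N0 ''v''] (RAdd (RVar ''cst'' [N0 ''v''])
         (RVar ''dst'' [NVar ''idx'' [N0 ''i'', N0 ''j''], NVar ''dig'' [N0 ''u'', NVar ''dig'' [N0 ''v'', N0 ''j'']]])))"

text \<open>This refers to whatever the tables contain. For a feasible labeling all digits of
  \<open>v\<close> address filled entries in the row of \<open>u\<close>, and it is for these that
  the value is later identified with a true distance sum.\<close>

definition set_cost :: "state \<Rightarrow> nat \<Rightarrow> nat \<Rightarrow> nat \<Rightarrow> real" where
  "set_cost s u i v = (\<Sum>j<nmem s ''size'' [i]. rmem s ''dst''
     [nmem s ''idx'' [i, j], nmem s ''dig'' [u, nmem s ''dig'' [v, j]]])"

abbreviation feas :: "state \<Rightarrow> nat \<Rightarrow> nat \<Rightarrow> bool" where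
  "feas s i v \<equiv> feasible (nmem s ''k'' []) (nmem s ''size'' [i]) (\<lambda>j. nmem s ''dig'' [v, j])"

lemma ok_evaluate:
  assumes s: "nmem s ''u'' [] = u" "nmem s ''i'' [] = i" "nmem s ''v'' [] = v"
    and size: "nmem s ''size'' [i] \<le> nmem s ''k'' []"
  shows "ok evaluate_com s (\<lambda>s'. nmem s' ''bad'' = (nmem s ''bad'')([v] := if feas s i v then 0 else 1) \<and>
     rmem s' ''cst'' = (rmem s ''cst'')([v] := set_cost s u i v) \<and>
     clock s' \<le> clock s + (4 + nmem s ''k'' [] * (7 + 4 * nmem s ''k'' [])))"
proof -
  let ?k = "nmem s ''k'' []" and ?dg = "\<lambda>v j. nmem s ''dig'' [v, j]"
  let ?c = "\<lambda>m. \<Sum>j<m. rmem s ''dst'' [nmem s ''idx'' [i, j], ?dg u (?dg v j)]"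
  let ?I = "\<lambda>j s'. nmem s' ''bad'' = (nmem s ''bad'')([v] := if feasible ?k j (?dg v) then 0 else 1) \<and>
                  rmem s' ''cst'' = (rmem s ''cst'')([v] := ?c j)"
  have body: "ok (If (NLess (NVar ''dig'' [N0 ''v'', N0 ''j'']) (N0 ''k'')) Skip (NAssign ''bad'' [N0 ''v''] (NConst 1)) ;;
       For ''h'' (N0 ''j'') (
         If (And (Not (NLess (NVar ''dig'' [N0 ''v'', N0 ''h'']) (NVar ''dig'' [N0 ''v'', N0 ''j''])))
                 (Not (NLess (NVar ''dig'' [N0 ''v'', N0 ''j'']) (NVar ''dig'' [N0 ''v'', N0 ''h'']))))
           (NAssign ''bad'' [N0 ''v''] (NConst 1)) Skip) ;;
       RAssign ''cst'' [N0 ''v''] (RAdd (RVar ''cst'' [N0 ''v''])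
         (RVar ''dst'' [NVar ''idx'' [N0 ''i'', N0 ''j''], NVar ''dig'' [N0 ''u'', NVar ''dig'' [N0 ''v'', N0 ''j'']]]))) s1
      (\<lambda>s'. ?I (Suc j) s' \<and> clock s' \<le> clock s1 + (5 + 4 * ?k))"
    if s1: "nmem s1 ''v'' [] = v" "nmem s1 ''j'' [] = j" "nmem s1 ''i'' [] = i" "nmem s1 ''u'' [] = u"
      "nmem s1 ''dig'' = nmem s ''dig''" "nmem s1 ''idx'' = nmem s ''idx''" "nmem s1 ''k'' [] = ?k"
      "rmem s1 ''dst'' = rmem s ''dst''" "?I j s1" "j < ?k" for j s1
  proof -
    \<comment> \<open>At \<open>h = 0\<close> this is the state after the range check; at
      \<open>h = j\<close> the condition is that of \<open>feasible_Suc\<close>.\<close>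
    let ?b = "\<lambda>h. (nmem s ''bad'')([v] := if feasible ?k j (?dg v) \<and> ?dg v j < ?k \<and> (\<forall>x<h. ?dg v x \<noteq> ?dg v j) then 0 else 1)"
    have "ok (If (NLess (NVar ''dig'' [N0 ''v'', N0 ''j'']) (N0 ''k'')) Skip (NAssign ''bad'' [N0 ''v''] (NConst 1))) s1
       (\<lambda>s'. nmem s' ''bad'' = ?b 0 \<and> clock s' \<le> clock s1 + 2)"
      using s1 by (intro ok_IfI ok_assign) auto
    then show ?thesis
    proof (intro ok_Seq, elim ok_conseq)
      fix s2 assume fr: "frame (If (NLess (NVar ''dig'' [N0 ''v'', N0 ''j'']) (N0 ''k'')) Skip (NAssign ''bad'' [N0 ''v''] (NConst 1))) s1 s2"
        and s2: "nmem s2 ''bad'' = ?b 0 \<and> clock s2 \<le> clock s1 + 2"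
      have m: "nmem s2 x = nmem s1 x" if "x \<noteq> ''bad''" for x
        using fr that by (simp add: frame_nmem)
      have mr: "rmem s2 x = rmem s1 x" for x
        using fr by (simp add: frame_rmem)
      show "ok (For ''h'' (N0 ''j'') (
         If (And (Not (NLess (NVar ''dig'' [N0 ''v'', N0 ''h'']) (NVar ''dig'' [N0 ''v'', N0 ''j''])))
                 (Not (NLess (NVar ''dig'' [N0 ''v'', N0 ''j'']) (NVar ''dig'' [N0 ''v'', N0 ''h'']))))
           (NAssign ''bad'' [N0 ''v''] (NConst 1)) Skip) ;;
         RAssign ''cst'' [N0 ''v''] (RAdd (RVar ''cst'' [N0 ''v''])
         (RVar ''dst'' [NVar ''idx'' [N0 ''i'', N0 ''j''], NVar ''dig'' [N0 ''u'', NVar ''dig'' [N0 ''v'', N0 ''j'']]]))) s2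
            (\<lambda>s'. ?I (Suc j) s' \<and> clock s' \<le> clock s1 + (5 + 4 * ?k))"
        apply (rule ok_Seq)
        apply (rule ok_conseq[OF ok_For[where N = j and K = 2 and I = "\<lambda>h s'. nmem s' ''bad'' = ?b h"]])
        subgoal by simp
        subgoal for s' using s1 by (simp add: frame_nmem m)
        subgoal by simp
        subgoal by simp
        subgoal using s2 by simp
        subgoal premises prems for h s'
        proof -
          have n: "nmem s' ''dig'' = nmem s ''dig''" "nmem s' ''j'' [] = j" "nmem s' ''v'' [] = v"
            using prems s1 by (simp_all add: frame_nmem m)
          show ?thesis
            using n prems(2,3) by (intro ok_IfI ok_assign) (auto simp: less_Suc_eq)
        qed
        subgoal premises prems for s'
        proof -
          have n: "nmem s' ''dig'' = nmem s ''dig''" "nmem s' ''j'' [] = j" "nmem s' ''v'' [] = v" "nmem s' ''u'' [] = u"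
            "nmem s' ''i'' [] = i" "nmem s' ''idx'' = nmem s ''idx''" "rmem s' ''dst'' = rmem s ''dst''" "rmem s' ''cst'' = rmem s1 ''cst''"
            using prems s1 by (simp_all add: frame_nmem frame_rmem m mr)
          show ?thesis
            using n prems(2) s2 s1(9,10) by (intro ok_assign) (auto simp: feasible_Suc)
        qed
        done
    qed
  qed
  show ?thesis
    unfolding evaluate_com_def
    apply (intro ok_assign)
    apply (rule ok_conseq[OF ok_For[where N = "nmem s ''size'' [i]" and K = "5 + 4 * ?k" and I = ?I]])
    subgoal by simp
    subgoal for s' using s by (simp add: frame_nmem)
    subgoal by simp
    subgoal by simp
    subgoal using s by simp
    subgoal for j s'
      using s size by (intro body) (simp_all add: frame_nmem frame_rmem)
    subgoal premises prems for s'
    proof -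
      have "nmem s ''size'' [i] * (5 + 4 * ?k + 2) \<le> ?k * (5 + 4 * ?k + 2)"
        using size by (rule mult_le_mono1)
      moreover have "clock s' \<le> clock s + 4 + nmem s ''size'' [i] * (5 + 4 * ?k + 2)"
        using prems by (simp del: add_mult_distrib2)
      ultimately have "clock s' \<le> clock s + 4 + ?k * (5 + 4 * ?k + 2)"
        by linarith
      then show ?thesis
        using prems by (simp add: set_cost_def algebra_simps)
    qed
    done
qed

lemma all_less_Suc: "(\<forall>w<Suc u. P w) \<longleftrightarrow> (\<forall>w<u. P w) \<and> P u"
  by (auto simp: less_Suc_eq)

text \<open>\<open>;;\<close> associates to the right, while in \<open>search_com\<close> the reset
  of the total and the loop after it are handled as one unit.\<close>

lemma ok_Seq_assoc:
  assumes "ok ((c1 ;; c2) ;; c3) s Q"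
  shows "ok (c1 ;; c2 ;; c3) s Q"
proof -
  have "exec (c2 ;; c3) = (\<lambda>s. exec c2 s \<bind> exec c3)"
    by (simp add: fun_eq_iff)
  then have "exec (c1 ;; c2 ;; c3) s = exec ((c1 ;; c2) ;; c3) s"
    by simp
  moreover have "frame (c1 ;; c2 ;; c3) = frame ((c1 ;; c2) ;; c3)"
    by (simp add: frame_def fun_eq_iff)
  ultimately show ?thesis
    using assms unfolding ok_def by metis
qed

lemma evaluate_writes [simp]:
  "nwrites evaluate_com = {''bad'', ''j'', ''h''}" "rwrites evaluate_com = {''cst''}"
  by (auto simp: evaluate_com_def)

text \<open>The current choice is replaced by a feasible \<open>v\<close> if it is infeasible itself
  or strictly more expensive. It may thus start at 0 without 0 being feasible.\<close>

definition choose_com :: com where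
  "choose_com = NAssign ''bi'' [N0 ''u'', N0 ''i''] (NConst 0) ;;
     For ''v'' (N0 ''X'') (
       evaluate_com ;;
       If (And (NLess (NVar ''bad'' [N0 ''v'']) (NConst 1))
              (Not (And (NLess (NVar ''bad'' [NVar ''bi'' [N0 ''u'', N0 ''i'']]) (NConst 1))
                        (Not (RLess (RVar ''cst'' [N0 ''v'']) (RVar ''cst'' [NVar ''bi'' [N0 ''u'', N0 ''i'']]))))))
         (NAssign ''bi'' [N0 ''u'', N0 ''i''] (N0 ''v'')) Skip)"

lemma choose_writes [simp]:
  "nwrites choose_com = {''bi'', ''v'', ''bad'', ''j'', ''h''}" "rwrites choose_com = {''cst''}"
  by (auto simp: choose_com_def)

text \<open>Feasibility of \<open>b\<close> is conditional on some labeling being feasible; the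
  identity labeling provides one later.\<close>

definition best :: "state \<Rightarrow> nat \<Rightarrow> nat \<Rightarrow> nat \<Rightarrow> bool" where
  "best s u i b \<longleftrightarrow> b < nmem s ''X'' [] \<and> (\<forall>v<nmem s ''X'' []. feas s i v \<longrightarrow> feas s i b \<and> set_cost s u i b \<le> set_cost s u i v)"

lemma ok_choose:
  assumes s: "nmem s ''u'' [] = u" "nmem s ''i'' [] = i"
    and size: "nmem s ''size'' [i] \<le> nmem s ''k'' []" and X: "0 < nmem s ''X'' []"
  shows "ok choose_com s (\<lambda>s'. \<exists>b. nmem s' ''bi'' = (nmem s ''bi'')([u, i] := b) \<and> best s u i b \<and>
     rmem s' ''cst'' [b] = set_cost s u i b \<and>
     clock s' \<le> clock s + (3 + nmem s ''X'' [] * (8 + nmem s ''k'' [] * (7 + 4 * nmem s ''k'' []))))"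
proof -
  let ?k = "nmem s ''k'' []" and ?X = "nmem s ''X'' []"
  let ?I = "\<lambda>v s'. \<exists>b. nmem s' ''bi'' = (nmem s ''bi'')([u, i] := b) \<and> b \<le> v - 1 \<and>
     (\<forall>w<v. nmem s' ''bad'' [w] = (if feas s i w then 0 else 1) \<and> rmem s' ''cst'' [w] = set_cost s u i w) \<and>
     (\<forall>w<v. feas s i w \<longrightarrow> feas s i b \<and> set_cost s u i b \<le> set_cost s u i w)"
  show ?thesis
    unfolding choose_com_def
    apply (intro ok_assign)
    apply (rule ok_conseq[OF ok_For[where N = ?X and K = "4 + ?k * (7 + 4 * ?k) + 2" and I = ?I]])
    subgoal by simp
    subgoal for s' by (simp add: frame_nmem)
    subgoal by simp
    subgoal by simp
    subgoal using s by auto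
    subgoal premises prems for v s1
    proof -
      have m: "nmem s1 ''u'' [] = u" "nmem s1 ''i'' [] = i" "nmem s1 ''dig'' = nmem s ''dig''"
        "nmem s1 ''size'' = nmem s ''size''" "nmem s1 ''k'' = nmem s ''k''" "rmem s1 ''dst'' = rmem s ''dst''"
        "nmem s1 ''idx'' = nmem s ''idx''"
        using prems(4) s by (simp_all add: frame_nmem frame_rmem)
      have cost: "set_cost s1 = set_cost s"
        using m by (simp add: set_cost_def fun_eq_iff)
      obtain b where b: "nmem s1 ''bi'' = (nmem s ''bi'')([u, i] := b)" "b \<le> v - 1"
        "\<forall>w<v. nmem s1 ''bad'' [w] = (if feas s i w then 0 else 1) \<and> rmem s1 ''cst'' [w] = set_cost s u i w"
        "\<forall>w<v. feas s i w \<longrightarrow> feas s i b \<and> set_cost s u i b \<le> set_cost s u i w"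
        using prems(3) by blast
      show ?thesis
      proof (rule ok_Seq, rule ok_conseq[OF ok_evaluate[OF m(1,2) prems(2)]])
        show "nmem s1 ''size'' [i] \<le> nmem s1 ''k'' []"
          using size m by simp
        fix s2 assume fr: "frame evaluate_com s1 s2"
          and s2: "nmem s2 ''bad'' = (nmem s1 ''bad'')([v] := if feas s1 i v then 0 else 1) \<and>
           rmem s2 ''cst'' = (rmem s1 ''cst'')([v] := set_cost s1 u i v) \<and>
           clock s2 \<le> clock s1 + (4 + nmem s1 ''k'' [] * (7 + 4 * nmem s1 ''k'' []))"
        have n: "nmem s2 ''u'' [] = u" "nmem s2 ''i'' [] = i" "nmem s2 ''bi'' = nmem s1 ''bi''" "nmem s2 ''v'' [] = v"
          using fr m prems(2) by (simp_all add: frame_nmem)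
        have bad: "nmem s2 ''bad'' [w] = (if feas s i w then 0 else 1)"
          and cst: "rmem s2 ''cst'' [w] = set_cost s u i w" if "w \<le> v" for w
          using that s2 b(3) m cost by auto
        \<comment> \<open>The truncated subtraction in \<open>b \<le> v - 1\<close> covers the
          start: for \<open>v = 0\<close> the choice is 0, which has just been evaluated, so the
          entries of \<open>b\<close> in \<open>bad\<close> and \<open>cst\<close> are always valid
          here.\<close>
        have bv: "b \<le> v" using b(2) by simp
        let ?t = "feas s i v \<and> \<not> (feas s i b \<and> \<not> set_cost s u i v < set_cost s u i b)"
        have cond: "bval (And (NLess (NVar ''bad'' [N0 ''v'']) (NConst 1))
              (Not (And (NLess (NVar ''bad'' [NVar ''bi'' [N0 ''u'', N0 ''i'']]) (NConst 1))
                        (Not (RLess (RVar ''cst'' [N0 ''v'']) (RVar ''cst'' [NVar ''bi'' [N0 ''u'', N0 ''i'']])))))) s2 \<longleftrightarrow> ?t"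
          using n b(1) bad[of v] bad[OF bv] cst[of v] cst[OF bv] by simp
        define c where "c = (if ?t then v else b)"
        have c: "c \<le> v" "\<forall>w\<le>v. feas s i w \<longrightarrow> feas s i c \<and> set_cost s u i c \<le> set_cost s u i w"
          using bv b(4) by (auto simp: c_def le_less intro: order_trans)
        let ?cond = "And (NLess (NVar ''bad'' [N0 ''v'']) (NConst 1))
              (Not (And (NLess (NVar ''bad'' [NVar ''bi'' [N0 ''u'', N0 ''i'']]) (NConst 1))
                        (Not (RLess (RVar ''cst'' [N0 ''v'']) (RVar ''cst'' [NVar ''bi'' [N0 ''u'', N0 ''i'']])))))"
        have "ok (If ?cond (NAssign ''bi'' [N0 ''u'', N0 ''i''] (N0 ''v'')) Skip) s2
           (\<lambda>s'. nmem s' ''bi'' = (nmem s ''bi'')([u, i] := c) \<and> nmem s' ''bad'' = nmem s2 ''bad'' \<and>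
               rmem s' ''cst'' = rmem s2 ''cst'' \<and> clock s' = clock s2 + 2)"
        proof (rule ok_IfI)
          assume "bval ?cond s2"
          then have "c = v" unfolding cond c_def by auto
          then show "ok (NAssign ''bi'' [N0 ''u'', N0 ''i''] (N0 ''v'')) (tick s2) (\<lambda>s'. nmem s' ''bi'' = (nmem s ''bi'')([u, i] := c) \<and>
               nmem s' ''bad'' = nmem s2 ''bad'' \<and> rmem s' ''cst'' = rmem s2 ''cst'' \<and> clock s' = clock s2 + 2)"
            using n b(1) by simp
        next
          assume "\<not> bval ?cond s2"
          then have "c = b" unfolding cond c_def by auto
          then show "ok Skip (tick s2) (\<lambda>s'. nmem s' ''bi'' = (nmem s ''bi'')([u, i] := c) \<and>
               nmem s' ''bad'' = nmem s2 ''bad'' \<and> rmem s' ''cst'' = rmem s2 ''cst'' \<and> clock s' = clock s2 + 2)"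
            using n b(1) by simp
        qed
        then show "ok (If ?cond (NAssign ''bi'' [N0 ''u'', N0 ''i''] (N0 ''v'')) Skip) s2
           (\<lambda>s'. ?I (Suc v) s' \<and> clock s' \<le> clock s1 + (4 + ?k * (7 + 4 * ?k) + 2))"
        proof (rule ok_conseq)
          fix s3 assume s3: "nmem s3 ''bi'' = (nmem s ''bi'')([u, i] := c) \<and> nmem s3 ''bad'' = nmem s2 ''bad'' \<and>
               rmem s3 ''cst'' = rmem s2 ''cst'' \<and> clock s3 = clock s2 + 2"
          have "\<forall>w<Suc v. nmem s3 ''bad'' [w] = (if feas s i w then 0 else 1) \<and> rmem s3 ''cst'' [w] = set_cost s u i w"
            using s3 bad cst by (simp add: less_Suc_eq_le)
          moreover have "clock s3 \<le> clock s1 + (4 + ?k * (7 + 4 * ?k) + 2)"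
            using s2 s3 m(5) by simp
          ultimately show "?I (Suc v) s3 \<and> clock s3 \<le> clock s1 + (4 + ?k * (7 + 4 * ?k) + 2)"
            using s3 c unfolding less_Suc_eq_le by (intro conjI exI[of _ c]) simp_all
        qed
      qed
    qed
    subgoal premises prems for s'
    proof -
      obtain b where "nmem s' ''bi'' = (nmem s ''bi'')([u, i] := b)" "b \<le> ?X - 1"
        "\<forall>w<?X. rmem s' ''cst'' [w] = set_cost s u i w"
        "\<forall>w<?X. feas s i w \<longrightarrow> feas s i b \<and> set_cost s u i b \<le> set_cost s u i w"
        using prems(2) by blast
      moreover have "clock s' \<le> clock s + (3 + ?X * (8 + ?k * (7 + 4 * ?k)))"
        using prems(2) by (simp add: algebra_simps)
      ultimately show ?thesis
        using X by (intro exI[of _ b]) (auto simp: best_def)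
    qed
    done
qed

section \<open>Minimising over all candidate tuples\<close>

definition search_com :: com where
  "search_com = NAssign ''gu'' [] (NConst 0) ;;
     For ''u'' (N0 ''X'') (
       RAssign ''tot'' [N0 ''u''] (RNat (NConst 0)) ;;
       For ''i'' (N0 ''n'') (
         choose_com ;;
         RAssign ''tot'' [N0 ''u''] (RAdd (RVar ''tot'' [N0 ''u'']) (RVar ''cst'' [NVar ''bi'' [N0 ''u'', N0 ''i'']]))) ;;
       If (RLess (RVar ''tot'' [N0 ''u'']) (RVar ''tot'' [N0 ''gu''])) (NAssign ''gu'' [] (N0 ''u'')) Skip)"

lemma search_writes [simp]:
  "nwrites search_com = {''gu'', ''u'', ''i'', ''bi'', ''v'', ''bad'', ''j'', ''h''}" "rwrites search_com = {''tot'', ''cst''}"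
  by (auto simp: search_com_def)

text \<open>The total of \<open>u\<close> is the sum over the sets of their separately optimal
  labelings, because the chromatic condition never links two different sets. The best tuple is then
  a running minimum.\<close>

lemma ok_search:
  fixes s
  defines "k \<equiv> nmem s ''k'' []" and "X \<equiv> nmem s ''X'' []" and "n \<equiv> nmem s ''n'' []"
  assumes size: "\<And>i. i < n \<Longrightarrow> nmem s ''size'' [i] \<le> k" and X: "0 < X"
  shows "ok search_com s (\<lambda>s'. nmem s' ''gu'' [] < X \<and> (\<forall>u<X. \<forall>i<n. best s u i (nmem s' ''bi'' [u, i])) \<and>
     (\<forall>u<X. (\<Sum>i<n. set_cost s (nmem s' ''gu'' []) i (nmem s' ''bi'' [nmem s' ''gu'' [], i])) \<le>
            (\<Sum>i<n. set_cost s u i (nmem s' ''bi'' [u, i]))) \<and>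
     clock s' \<le> clock s + (3 + X * (7 + n * (6 + X * (8 + k * (7 + 4 * k))))))"
proof -
  let ?tc = "X * (8 + k * (7 + 4 * k))"
  let ?loop = "For ''i'' (N0 ''n'') (
         choose_com ;;
         RAssign ''tot'' [N0 ''u''] (RAdd (RVar ''tot'' [N0 ''u'']) (RVar ''cst'' [NVar ''bi'' [N0 ''u'', N0 ''i'']])))"
  have loop: "ok (RAssign ''tot'' [N0 ''u''] (RNat (NConst 0)) ;; ?loop) s1
     (\<lambda>s'. (\<forall>w i. w \<noteq> u \<longrightarrow> nmem s' ''bi'' [w, i] = nmem s1 ''bi'' [w, i]) \<and>
        (\<forall>i<n. best s u i (nmem s' ''bi'' [u, i])) \<and>
        rmem s' ''tot'' = (rmem s1 ''tot'')([u] := \<Sum>i<n. set_cost s u i (nmem s' ''bi'' [u, i])) \<and>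
        clock s' \<le> clock s1 + (3 + n * (6 + ?tc)))"
    if s1: "nmem s1 ''u'' [] = u" "nmem s1 ''k'' = nmem s ''k''" "nmem s1 ''X'' = nmem s ''X''"
      "nmem s1 ''n'' = nmem s ''n''" "nmem s1 ''size'' = nmem s ''size''"
      "nmem s1 ''dig'' = nmem s ''dig''" "nmem s1 ''idx'' = nmem s ''idx''" "rmem s1 ''dst'' = rmem s ''dst''" for u s1
    apply (intro ok_assign)
    apply (rule ok_conseq[OF ok_For[where N = n and K = "3 + ?tc + 1" and
       I = "\<lambda>i s'. (\<forall>w i. w \<noteq> u \<longrightarrow> nmem s' ''bi'' [w, i] = nmem s1 ''bi'' [w, i]) \<and>
        (\<forall>x<i. best s u x (nmem s' ''bi'' [u, x])) \<and>
        rmem s' ''tot'' = (rmem s1 ''tot'')([u] := \<Sum>i<i. set_cost s u i (nmem s' ''bi'' [u, i]))"]])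
    subgoal by simp
    subgoal for s' using s1 by (simp add: frame_nmem n_def)
    subgoal by simp
    subgoal by simp
    subgoal using s1 by simp
    subgoal premises prems for i s2
    proof -
      have m: "nmem s2 ''u'' [] = u" "nmem s2 ''i'' [] = i" "nmem s2 ''k'' = nmem s ''k''" "nmem s2 ''X'' = nmem s ''X''"
        "nmem s2 ''size'' = nmem s ''size''" "nmem s2 ''dig'' = nmem s ''dig''" "nmem s2 ''idx'' = nmem s ''idx''"
        "rmem s2 ''dst'' = rmem s ''dst''"
        using prems(2,4) s1 by (simp_all add: frame_nmem frame_rmem)
      have cost: "set_cost s2 = set_cost s"
        using m by (simp add: set_cost_def fun_eq_iff)
      have best: "best s2 = best s"
        using m cost by (simp add: best_def fun_eq_iff)
      show ?thesis
      proof (rule ok_Seq, rule ok_conseq[OF ok_choose[OF m(1,2)]])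
        show "nmem s2 ''size'' [i] \<le> nmem s2 ''k'' []" "0 < nmem s2 ''X'' []"
          using size[OF prems(1)] X m by (simp_all add: k_def X_def)
        fix s3 assume fr: "frame choose_com s2 s3" and "\<exists>b. nmem s3 ''bi'' = (nmem s2 ''bi'')([u, i] := b) \<and>
           best s2 u i b \<and> rmem s3 ''cst'' [b] = set_cost s2 u i b \<and>
           clock s3 \<le> clock s2 + (3 + nmem s2 ''X'' [] * (8 + nmem s2 ''k'' [] * (7 + 4 * nmem s2 ''k'' [])))"
        then obtain b where b: "nmem s3 ''bi'' = (nmem s2 ''bi'')([u, i] := b)" "best s u i b"
          "rmem s3 ''cst'' [b] = set_cost s u i b" "clock s3 \<le> clock s2 + (3 + ?tc)"
          unfolding best cost m(3,4) k_def X_def by blast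
        have n: "nmem s3 ''u'' [] = u" "nmem s3 ''i'' [] = i" "rmem s3 ''tot'' = rmem s2 ''tot''"
          using fr m by (simp_all add: frame_nmem frame_rmem)
        show "ok (RAssign ''tot'' [N0 ''u''] (RAdd (RVar ''tot'' [N0 ''u'']) (RVar ''cst'' [NVar ''bi'' [N0 ''u'', N0 ''i'']]))) s3
          (\<lambda>s'. ((\<forall>w i. w \<noteq> u \<longrightarrow> nmem s' ''bi'' [w, i] = nmem s1 ''bi'' [w, i]) \<and>
        (\<forall>x<Suc i. best s u x (nmem s' ''bi'' [u, x])) \<and>
        rmem s' ''tot'' = (rmem s1 ''tot'')([u] := \<Sum>i<Suc i. set_cost s u i (nmem s' ''bi'' [u, i]))) \<and>
         clock s' \<le> clock s2 + (3 + ?tc + 1))"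
          using n b prems(3) by (intro ok_assign) (simp add: less_Suc_eq)
      qed
    qed
    subgoal by (simp add: algebra_simps)
    done
  have upd: "ok (If (RLess (RVar ''tot'' [N0 ''u'']) (RVar ''tot'' [N0 ''gu''])) (NAssign ''gu'' [] (N0 ''u'')) Skip) s2
     (\<lambda>s'. nmem s' ''bi'' = nmem s2 ''bi'' \<and> rmem s' ''tot'' = rmem s2 ''tot'' \<and>
        nmem s' ''gu'' [] \<le> u \<and> (\<forall>w<Suc u. rmem s2 ''tot'' [nmem s' ''gu'' []] \<le> rmem s2 ''tot'' [w]) \<and> clock s' \<le> clock s2 + 2)"
    if "nmem s2 ''u'' [] = u" "nmem s2 ''gu'' [] \<le> u - 1" "\<forall>w<u. rmem s2 ''tot'' [nmem s2 ''gu'' []] \<le> rmem s2 ''tot'' [w]" for u s2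
    using that by (intro ok_IfI ok_assign) (auto simp: less_Suc_eq intro: order_trans less_imp_le)
  \<comment> \<open>\<open>J\<close> takes the relevant memory components instead of the state, so
    ticks and writes to other variables leave it literally unchanged.\<close>
  define J where "J gu bi tot u \<longleftrightarrow> gu \<le> u - 1 \<and> (\<forall>w<u. \<forall>i<n. best s w i (bi [w, i])) \<and>
      (\<forall>w<u. tot [w] = (\<Sum>i<n. set_cost s w i (bi [w, i]))) \<and> (\<forall>w<u. tot [gu] \<le> tot [w])"
    for gu u :: nat and bi :: "nat list \<Rightarrow> nat" and tot :: "nat list \<Rightarrow> real"
  let ?I = "\<lambda>u s'. J (nmem s' ''gu'' []) (nmem s' ''bi'') (rmem s' ''tot'') u"
  show ?thesis
    unfolding search_com_def
    apply (intro ok_assign)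
    apply (rule ok_conseq[OF ok_For[where N = X and K = "(3 + n * (6 + ?tc)) + 2" and I = ?I]])
    subgoal by simp
    subgoal for s' by (simp add: frame_nmem X_def)
    subgoal by simp
    subgoal by simp
    subgoal by (simp add: J_def)
    subgoal premises prems for u s1
    proof -
      have m: "nmem s1 ''k'' = nmem s ''k''" "nmem s1 ''X'' = nmem s ''X''"
      "nmem s1 ''n'' = nmem s ''n''" "nmem s1 ''size'' = nmem s ''size''"
      "nmem s1 ''dig'' = nmem s ''dig''" "nmem s1 ''idx'' = nmem s ''idx''" "rmem s1 ''dst'' = rmem s ''dst''"
        using prems(4) by (simp_all add: frame_nmem frame_rmem)
      have "ok ((RAssign ''tot'' [N0 ''u''] (RNat (NConst 0)) ;; ?loop) ;;
         If (RLess (RVar ''tot'' [N0 ''u'']) (RVar ''tot'' [N0 ''gu''])) (NAssign ''gu'' [] (N0 ''u'')) Skip) s1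
         (\<lambda>s'. ?I (Suc u) s' \<and> clock s' \<le> clock s1 + ((3 + n * (6 + ?tc)) + 2))"
      proof (rule ok_Seq, rule ok_conseq[OF loop[OF prems(2) m]])
        fix s2 assume fr: "frame (RAssign ''tot'' [N0 ''u''] (RNat (NConst 0)) ;; ?loop) s1 s2" and s2:
         "(\<forall>w i. w \<noteq> u \<longrightarrow> nmem s2 ''bi'' [w, i] = nmem s1 ''bi'' [w, i]) \<and>
        (\<forall>i<n. best s u i (nmem s2 ''bi'' [u, i])) \<and>
        rmem s2 ''tot'' = (rmem s1 ''tot'')([u] := \<Sum>i<n. set_cost s u i (nmem s2 ''bi'' [u, i])) \<and>
        clock s2 \<le> clock s1 + (3 + n * (6 + ?tc))"
        have n: "nmem s2 ''u'' [] = u" "nmem s2 ''gu'' = nmem s1 ''gu''"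
          using fr prems(2) by (simp_all add: frame_nmem)
        \<comment> \<open>If \<open>u\<close> is positive, \<open>gu\<close> is an older index, so
          writing \<open>tot [u]\<close> does not disturb the current minimum.\<close>
        have gu: "nmem s1 ''gu'' [] < u \<or> u = 0"
          using prems(3) by (auto simp: J_def)
        have "\<forall>w<u. rmem s2 ''tot'' [nmem s2 ''gu'' []] \<le> rmem s2 ''tot'' [w]"
          using prems(3) s2 n gu by (auto simp: J_def)
        then have "ok (If (RLess (RVar ''tot'' [N0 ''u'']) (RVar ''tot'' [N0 ''gu''])) (NAssign ''gu'' [] (N0 ''u'')) Skip) s2
     (\<lambda>s'. nmem s' ''bi'' = nmem s2 ''bi'' \<and> rmem s' ''tot'' = rmem s2 ''tot'' \<and>
        nmem s' ''gu'' [] \<le> u \<and> (\<forall>w<Suc u. rmem s2 ''tot'' [nmem s' ''gu'' []] \<le> rmem s2 ''tot'' [w]) \<and> clock s' \<le> clock s2 + 2)"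
          using prems(3) n by (intro upd) (auto simp: J_def)
        then show "ok (If (RLess (RVar ''tot'' [N0 ''u'']) (RVar ''tot'' [N0 ''gu''])) (NAssign ''gu'' [] (N0 ''u'')) Skip) s2
          (\<lambda>s'. ?I (Suc u) s' \<and> clock s' \<le> clock s1 + ((3 + n * (6 + ?tc)) + 2))"
        proof (rule ok_conseq)
          fix s3 assume s3: "nmem s3 ''bi'' = nmem s2 ''bi'' \<and> rmem s3 ''tot'' = rmem s2 ''tot'' \<and>
        nmem s3 ''gu'' [] \<le> u \<and> (\<forall>w<Suc u. rmem s2 ''tot'' [nmem s3 ''gu'' []] \<le> rmem s2 ''tot'' [w]) \<and> clock s3 \<le> clock s2 + 2"
          then show "?I (Suc u) s3 \<and> clock s3 \<le> clock s1 + ((3 + n * (6 + ?tc)) + 2)"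
            using s2 prems(3) unfolding J_def by (simp add: all_less_Suc)
        qed
      qed
      then show ?thesis
        by (rule ok_Seq_assoc)
    qed
    subgoal premises prems for s'
    proof -
      have gu: "nmem s' ''gu'' [] < X" using prems(2) X by (auto simp: J_def)
      moreover have "clock s' \<le> clock s + (3 + X * (7 + n * (6 + ?tc)))"
        using prems(2) by (simp add: algebra_simps)
      moreover have J: "\<forall>w<X. \<forall>i<n. best s w i (nmem s' ''bi'' [w, i])"
        "\<forall>w<X. rmem s' ''tot'' [w] = (\<Sum>i<n. set_cost s w i (nmem s' ''bi'' [w, i]))"
        "\<forall>w<X. rmem s' ''tot'' [nmem s' ''gu'' []] \<le> rmem s' ''tot'' [w]"
        using prems(2) unfolding J_def by blast+
      moreover have "(\<Sum>i<n. set_cost s (nmem s' ''gu'' []) i (nmem s' ''bi'' [nmem s' ''gu'' [], i])) \<le>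
            (\<Sum>i<n. set_cost s w i (nmem s' ''bi'' [w, i]))" if "w < X" for w
        using J(3)[rule_format, OF that] unfolding J(2)[rule_format, OF that] J(2)[rule_format, OF gu] .
      ultimately show ?thesis
        by blast
    qed
    done
qed

section \<open>Writing medians and labels\<close>

definition output_com :: com where
  "output_com = For ''l'' (N0 ''k'') (For ''c'' (N0 ''d'') (
       RAssign ''median'' [N0 ''l'', N0 ''c''] (RVar ''point''
         [NVar ''pi'' [NVar ''ce'' [NVar ''dig'' [N0 ''gu'', N0 ''l'']]],
          NVar ''pj'' [NVar ''ce'' [NVar ''dig'' [N0 ''gu'', N0 ''l'']]], N0 ''c'']))) ;;
     For ''i'' (N0 ''n'') (For ''j'' (NVar ''size'' [N0 ''i'']) (
       NAssign ''label'' [N0 ''i'', N0 ''j''] (NVar ''dig'' [NVar ''bi'' [N0 ''gu'', N0 ''i''], N0 ''j''])))"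

lemma ok_output:
  fixes s
  defines "k \<equiv> nmem s ''k'' []" and "d \<equiv> nmem s ''d'' []" and "n \<equiv> nmem s ''n'' []" and "gu \<equiv> nmem s ''gu'' []"
  assumes size: "\<And>i. i < n \<Longrightarrow> nmem s ''size'' [i] \<le> k"
  shows "ok output_com s (\<lambda>s'.
     (\<forall>l<k. \<forall>c<d. rmem s' ''median'' [l, c] = rmem s ''point''
        [nmem s ''pi'' [nmem s ''ce'' [nmem s ''dig'' [gu, l]]], nmem s ''pj'' [nmem s ''ce'' [nmem s ''dig'' [gu, l]]], c]) \<and>
     (\<forall>i<n. \<forall>j<nmem s ''size'' [i]. nmem s' ''label'' [i, j] = nmem s ''dig'' [nmem s ''bi'' [gu, i], j]) \<and>
     clock s' \<le> clock s + (4 + k * (4 + 3 * d) + n * (4 + 3 * k)))"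
proof -
  let ?med = "\<lambda>l c. rmem s ''point''
        [nmem s ''pi'' [nmem s ''ce'' [nmem s ''dig'' [gu, l]]], nmem s ''pj'' [nmem s ''ce'' [nmem s ''dig'' [gu, l]]], c]"
  let ?first = "For ''l'' (N0 ''k'') (For ''c'' (N0 ''d'') (
       RAssign ''median'' [N0 ''l'', N0 ''c''] (RVar ''point''
         [NVar ''pi'' [NVar ''ce'' [NVar ''dig'' [N0 ''gu'', N0 ''l'']]],
          NVar ''pj'' [NVar ''ce'' [NVar ''dig'' [N0 ''gu'', N0 ''l'']]], N0 ''c''])))"
  have "ok ?first s (\<lambda>s'. (\<forall>l<k. \<forall>c<d. rmem s' ''median'' [l, c] = ?med l c) \<and> clock s' \<le> clock s + 2 + k * (2 + d * 3 + 2))"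
    apply (rule ok_For[where I = "\<lambda>l s'. \<forall>x<l. \<forall>c<d. rmem s' ''median'' [x, c] = ?med x c"])
    subgoal by simp
    subgoal for s' by (simp add: frame_nmem k_def)
    subgoal by simp
    subgoal by simp
    subgoal by simp
    subgoal premises prems for l s1
      apply (rule ok_conseq[OF ok_For[where N = d and K = 1 and
         I = "\<lambda>c s'. (\<forall>x<l. \<forall>c<d. rmem s' ''median'' [x, c] = ?med x c) \<and> (\<forall>x<c. rmem s' ''median'' [l, x] = ?med l x)"]])
      subgoal by simp
      subgoal for s' using prems by (simp add: frame_nmem d_def)
      subgoal by simp
      subgoal by simp
      subgoal using prems by simp
      subgoal premises p for c s'
      proof -
        have n: "nmem s' ''l'' [] = l" "nmem s' ''gu'' [] = gu" "nmem s' ''dig'' = nmem s ''dig''"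
          "nmem s' ''ce'' = nmem s ''ce''" "nmem s' ''pi'' = nmem s ''pi''" "nmem s' ''pj'' = nmem s ''pj''"
          "rmem s' ''point'' = rmem s ''point''"
          using p(4) prems(2,4) by (simp_all add: frame_nmem frame_rmem gu_def)
        then show ?thesis
          using p(2,3) by (intro ok_assign) (simp add: less_Suc_eq)
      qed
      subgoal by (auto simp: less_Suc_eq)
      done
    done
  then show ?thesis
    unfolding output_com_def
  proof (rule ok_Seq[OF ok_conseq])
    fix s1 assume fr: "frame ?first s s1" and s1: "(\<forall>l<k. \<forall>c<d. rmem s1 ''median'' [l, c] = ?med l c) \<and>
       clock s1 \<le> clock s + 2 + k * (2 + d * 3 + 2)"
    have n1: "nmem s1 ''n'' = nmem s ''n''" "nmem s1 ''size'' = nmem s ''size''" "nmem s1 ''gu'' = nmem s ''gu''"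
      "nmem s1 ''dig'' = nmem s ''dig''" "nmem s1 ''bi'' = nmem s ''bi''"
      using fr by (simp_all add: frame_nmem)
    let ?lab = "\<lambda>i j. nmem s ''dig'' [nmem s ''bi'' [gu, i], j]"
    show "ok (For ''i'' (N0 ''n'') (For ''j'' (NVar ''size'' [N0 ''i'']) (
       NAssign ''label'' [N0 ''i'', N0 ''j''] (NVar ''dig'' [NVar ''bi'' [N0 ''gu'', N0 ''i''], N0 ''j''])))) s1
      (\<lambda>s'. (\<forall>l<k. \<forall>c<d. rmem s' ''median'' [l, c] = ?med l c) \<and>
     (\<forall>i<n. \<forall>j<nmem s ''size'' [i]. nmem s' ''label'' [i, j] = ?lab i j) \<and>
     clock s' \<le> clock s + (4 + k * (4 + 3 * d) + n * (4 + 3 * k)))"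
      apply (rule ok_conseq[OF ok_For[where N = n and K = "2 + 3 * k" and
        I = "\<lambda>i s'. \<forall>x<i. \<forall>j<nmem s ''size'' [x]. nmem s' ''label'' [x, j] = ?lab x j"]])
      subgoal by simp
      subgoal for s' using n1 by (simp add: frame_nmem n_def)
      subgoal by simp
      subgoal by simp
      subgoal by simp
      subgoal premises prems for i s2
        apply (rule ok_conseq[OF ok_For[where N = "nmem s ''size'' [i]" and K = 1 and
           I = "\<lambda>j s'. (\<forall>x<i. \<forall>j<nmem s ''size'' [x]. nmem s' ''label'' [x, j] = ?lab x j) \<and> (\<forall>x<j. nmem s' ''label'' [i, x] = ?lab i x)"]])
        subgoal by simp
        subgoal for s' using prems n1 by (simp add: frame_nmem)
        subgoal by simp
        subgoal by simp
        subgoal using prems by simp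
        subgoal premises p for j s'
        proof -
          have "nmem s' ''i'' [] = i" "nmem s' ''gu'' [] = gu" "nmem s' ''dig'' = nmem s ''dig''" "nmem s' ''bi'' = nmem s ''bi''"
            using p(4) prems(2,4) n1 by (simp_all add: frame_nmem gu_def)
          then show ?thesis
            using p(2,3) by (intro ok_assign) (simp add: less_Suc_eq)
        qed
        subgoal using size[OF prems(1)] by (auto simp: less_Suc_eq)
        done
      subgoal for s'
        using s1 by (auto simp: frame_rmem algebra_simps)
      done
  qed
qed

section \<open>Probability of good random bits\<close>

definition draw_com :: com where
  "draw_com = For ''t'' (N0 ''T'') (Random ''rnd'' [N0 ''t''] (N0 ''R''))"

abbreviation drawn :: "nat \<Rightarrow> state \<Rightarrow> nat list" where
  "drawn T s \<equiv> map (\<lambda>t. nmem s ''rnd'' [t]) [0..<T]"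

lemma ok_Random:
  assumes "\<And>v. v \<le> nval e s \<Longrightarrow> Q (tick (nwrite x (map (\<lambda>e. nval e s) es) v s))"
  shows "ok (Random x es e) s Q"
  using assms by (auto simp: ok_def frame_def)

text \<open>This bounds the time for all outcomes; the distribution of the outcomes is the business
  of \<open>draw_dist\<close>.\<close>

lemma ok_draw:
  "ok draw_com s (\<lambda>s'. clock s' \<le> clock s + 2 + nmem s ''T'' [] * 3)"
  unfolding draw_com_def
  apply (rule ok_conseq[OF ok_For[where I = "\<lambda>_ _. True" and N = "nmem s ''T'' []" and K = 1]])
  by (auto simp: frame_nmem intro!: ok_Random)

text \<open>Induction on the number \<open>m\<close> of outstanding draws: the prefix
  \<open>drawn i s\<close> is already fixed, and the loop appends \<open>m\<close> independent
  uniform numbers to it.\<close>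

lemma while_draw_dist:
  defines "body \<equiv> Random ''rnd'' [N0 ''t''] (N0 ''R'') ;; NAssign ''t'' [] (NAdd (N0 ''t'') (NConst 1))"
  shows "i + m = T \<Longrightarrow> nmem s ''t'' [] = i \<Longrightarrow> nmem s ''T'' [] = T \<Longrightarrow> nmem s ''R'' [] = R \<Longrightarrow>
    map_spmf (drawn T) (while_spmf (bval (NLess (N0 ''t'') (N0 ''T''))) (\<lambda>s'. exec body (tick s')) s) =
    spmf_of_pmf (map_pmf ((@) (drawn i s)) (replicate_pmf m (pmf_of_set {..R})))"
proof (induction m arbitrary: i s)
  case 0
  then show ?case
    by (subst while_spmf.simps) simp
next
  case (Suc m)
  let ?W = "while_spmf (bval (NLess (N0 ''t'') (N0 ''T''))) (\<lambda>s'. exec body (tick s'))"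
  let ?g = "\<lambda>v. tick (nwrite ''t'' [] (Suc i) (tick (nwrite ''rnd'' [i] v (tick s))))"
  have drawn: "drawn (Suc i) (?g v) = drawn i s @ [v]" for v
    by simp
  have body: "exec body (tick s) = bind_pmf (pmf_of_set {..R}) (\<lambda>v. return_spmf (?g v))"
    using Suc.prems
    by (simp add: body_def bind_map_pmf atLeast0AtMost flip: spmf_of_pmf_pmf_of_set)
  have "map_spmf (drawn T) (?W s) = bind_pmf (pmf_of_set {..R}) (\<lambda>v. map_spmf (drawn T) (?W (?g v)))"
    using Suc.prems
    by (subst while_spmf.simps) (simp add: body map_spmf_bind_spmf o_def bind_spmf_def bind_assoc_pmf bind_return_pmf map_bind_pmf map_pmf_comp)
  also have "\<dots> = bind_pmf (pmf_of_set {..R}) (\<lambda>v. spmf_of_pmf (map_pmf ((@) (drawn (Suc i) (?g v))) (replicate_pmf m (pmf_of_set {..R}))))"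
    using Suc.prems by (intro bind_pmf_cong refl Suc.IH) auto
  also have "\<dots> = spmf_of_pmf (map_pmf ((@) (drawn i s)) (replicate_pmf (Suc m) (pmf_of_set {..R})))"
    unfolding drawn
    by (simp add: spmf_of_pmf_bind map_bind_pmf map_pmf_def bind_assoc_pmf bind_return_pmf)
  finally show ?case .
qed

lemma draw_dist:
  assumes "nmem s ''T'' [] = T" "nmem s ''R'' [] = R"
  shows "map_spmf (drawn T) (exec draw_com s) = spmf_of_pmf (replicate_pmf T (pmf_of_set {..R}))"
  using while_draw_dist[of 0 T T "tick (tick (nwrite ''t'' [] 0 s))" R] assms
  by (simp add: draw_com_def For_def append_Nil[abs_def] map_pmf_ident)

text \<open>Consider the joint law of \<open>h x\<close> and the final result. Losslessness of the
  continuation makes its first marginal equal to \<open>q\<close>, its second marginal is the law of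
  the program, and the event \<open>B\<close> on the first component forces \<open>A\<close> on the
  second.\<close>

lemma measure_bind_spmf_ge:
  assumes dist: "map_spmf h p = spmf_of_pmf q"
    and lossless: "\<And>x. x \<in> set_spmf p \<Longrightarrow> lossless_spmf (f x)"
    and sub: "\<And>x y. x \<in> set_spmf p \<Longrightarrow> h x \<in> B \<Longrightarrow> y \<in> set_spmf (f x) \<Longrightarrow> y \<in> A"
  shows "measure_pmf.prob q B \<le> measure (measure_spmf (bind_spmf p f)) A"
proof -
  define J where "J = bind_spmf p (\<lambda>x. map_spmf (Pair (h x)) (f x))"
  have "map_spmf fst J = bind_spmf p (\<lambda>x. map_spmf (\<lambda>_. h x) (f x))"
    by (simp add: J_def map_spmf_bind_spmf o_def spmf.map_comp)
  also have "\<dots> = bind_spmf p (\<lambda>x. return_spmf (h x))"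
    by (intro bind_spmf_cong refl) (simp add: map_spmf_conv_bind_spmf bind_spmf_const lossless lossless_weight_spmfD)
  also have "\<dots> = spmf_of_pmf q"
    by (simp add: dist flip: map_spmf_conv_bind_spmf)
  finally have "measure_pmf.prob q B = measure (measure_spmf (map_spmf fst J)) B"
    by simp
  also have "\<dots> = measure (measure_spmf J) (fst -` B)"
    by (simp add: measure_map_spmf)
  also have "\<dots> \<le> measure (measure_spmf J) (snd -` A)"
    using sub by (intro measure_spmf.finite_measure_mono_AE) (auto simp: J_def)
  also have "\<dots> = measure (measure_spmf (map_spmf snd J)) A"
    by (simp add: measure_map_spmf)
  also have "map_spmf snd J = bind_spmf p f"
    by (simp add: J_def map_spmf_bind_spmf o_def spmf.map_comp)
  finally show ?thesis .
qed

section \<open>Costs and labelings\<close>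

lemma euclid_dist_nonneg: "0 \<le> euclid_dist p q"
  by (simp add: euclid_dist_def)

lemma euclid_dist_commute: "length p = length q \<Longrightarrow> euclid_dist p q = euclid_dist q p"
  by (simp add: euclid_dist_def L2_set_def power2_commute)

lemma euclid_dist_triangle:
  assumes "length p = length q"
  shows "euclid_dist p r \<le> euclid_dist p q + euclid_dist q r"
  using L2_set_triangle_ineq[of "\<lambda>c. p ! c - q ! c" "\<lambda>c. q ! c - r ! c" "{..<length p}"] assms
  by (simp add: euclid_dist_def)

definition label_of :: "nat \<Rightarrow> (nat \<Rightarrow> (nat \<times> nat) set) \<Rightarrow> nat \<times> nat \<Rightarrow> nat" where
  "label_of k U p = (SOME l. l < k \<and> p \<in> U l)"

lemma label_of:
  assumes U: "chromatic_partition k G U" and p: "p \<in> point_indices G"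
  shows "label_of k U p < k" "p \<in> U (label_of k U p)"
proof -
  have "\<exists>l. l < k \<and> p \<in> U l"
    using U p unfolding chromatic_partition_def by blast
  from someI_ex[OF this] show "label_of k U p < k" "p \<in> U (label_of k U p)"
    by (simp_all add: label_of_def)
qed

lemma label_of_eq:
  assumes "chromatic_partition k G U" "l < k"
  shows "{p \<in> point_indices G. label_of k U p = l} = U l"
proof -
  have sub: "U l \<subseteq> point_indices G"
    using assms unfolding chromatic_partition_def by blast
  have "label_of k U p = l" if "p \<in> U l" for p
    using label_of[OF assms(1), of p] sub that assms
    unfolding chromatic_partition_def disjoint_family_on_def by blast
  then show ?thesis
    using label_of[OF assms(1)] sub by blast
qed

lemma finite_point_indices: "finite (point_indices G)"
  unfolding set_points[symmetric] by simp

lemma sum_point_indices: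
  "(\<Sum>p\<in>point_indices G. f p) = (\<Sum>i<length G. \<Sum>j<length (G ! i). f (i, j))"
proof -
  have "point_indices G = Sigma {..<length G} (\<lambda>i. {..<length (G ! i)})"
    by (auto simp: point_indices_def)
  then show ?thesis
    by (simp add: sum.Sigma)
qed

lemma sum_points: "(\<Sum>e<length (points G). f (points G ! e)) = (\<Sum>p\<in>point_indices G. f p)"
  using bij_betw_nth[OF distinct_prefix_points refl refl, of G "length G"]
  unfolding set_points[symmetric] by (rule sum.reindex_bij_betw)

text \<open>Summation by clusters becomes summation by points, the common form of the sampling bound
  and of the sums in the search.\<close>

lemma cost_eq:
  assumes "chromatic_partition k G U"
  shows "cost k G (m, U) =
    (\<Sum>p\<in>point_indices G. euclid_dist (G ! fst p ! snd p) (m (label_of k U p))) / real (length G)"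
proof -
  have "(\<Sum>l<k. \<Sum>(i, j)\<in>U l. euclid_dist (G ! i ! j) (m l)) =
     (\<Sum>l<k. \<Sum>p\<in>{p \<in> point_indices G. label_of k U p = l}. euclid_dist (G ! fst p ! snd p) (m (label_of k U p)))"
  proof (intro sum.cong)
    fix l p assume "l \<in> {..<k}" and p: "p \<in> {p \<in> point_indices G. label_of k U p = l}"
    then show "(case p of (i, j) \<Rightarrow> euclid_dist (G ! i ! j) (m l)) =
        euclid_dist (G ! fst p ! snd p) (m (label_of k U p))"
      by (simp add: case_prod_beta)
  qed (simp_all add: label_of_eq[OF assms])
  also have "\<dots> = (\<Sum>p\<in>point_indices G. euclid_dist (G ! fst p ! snd p) (m (label_of k U p)))"
    using label_of(1)[OF assms] by (intro sum.group) (auto simp: finite_point_indices)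
  finally show ?thesis
    by (simp add: cost_def)
qed

section \<open>From sampled candidates to approximate solutions\<close>

definition covers :: "nat \<Rightarrow> point_sets \<Rightarrow> solution \<Rightarrow> nat list \<Rightarrow> bool" where
  "covers k G = (\<lambda>(m, U) cs.
     (\<Sum>p\<in>point_indices G. Min ((\<lambda>e. euclid_dist (m (label_of k U p)) (pt G e)) ` set cs)) \<le>
     4 * (\<Sum>p\<in>point_indices G. euclid_dist (G ! fst p ! snd p) (m (label_of k U p))))"

lemma point_indices_length:
  assumes "cmedians_instance k d G" "p \<in> point_indices G"
  shows "length (G ! fst p ! snd p) = d"
proof -
  have "G ! fst p \<in> set G" "G ! fst p ! snd p \<in> set (G ! fst p)"
    using assms(2) by (auto simp: point_indices_def)
  then show ?thesis
    using assms(1) by (auto simp: cmedians_instance_def)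
qed

text \<open>The labels and medians of \<open>S\<close> instantiate the \<open>clustering\<close>
  locale. An instance without points is split off because the locale requires \<open>0 < N\<close>;
  there both sums are empty.\<close>

lemma prob_covers:
  assumes G: "cmedians_instance k d G" and S: "S \<in> solutions k d G"
    and R: "60 * length (points G) \<le> R"
  shows "1 / 2 \<le> measure_pmf.prob (replicate_pmf (120 * k) (pmf_of_set {..R}))
    {rs. covers k G S (run (length (points G)) (pdist G) R [0] rs)}"
proof (cases "points G = []")
  case True
  then have "point_indices G = {}"
    unfolding set_points[symmetric] by simp
  then have "covers k G S cs" for cs
    by (cases S) (simp add: covers_def)
  then show ?thesis by simp
next
  case False
  obtain m U where mU: "S = (m, U)" by (cases S)
  let ?N = "length (points G)" and ?q = "replicate_pmf (120 * k) (pmf_of_set {..R})"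
  define dm where "dm l e = euclid_dist (m l) (pt G e)" for l e
  define cl where "cl e = label_of k U (points G ! e)" for e
  have m: "length (m l) = d" if "l < k" for l
    using S that by (simp add: mU solutions_def)
  have U: "chromatic_partition k G U"
    using S by (simp add: mU solutions_def)
  have pt: "length (pt G e) = d" if "e < ?N" for e
    using length_pt[OF G that] .
  have cl: "cl e < k" if "e < ?N" for e
    using label_of(1)[OF U] nth_mem[OF that] unfolding cl_def set_points by simp
  interpret clustering ?N k "pdist G" dm cl
  proof
    fix l e f assume *: "l < k" "e < ?N" "f < ?N"
    show "dm l f \<le> dm l e + pdist G e f"
      unfolding dm_def pdist_def using * m pt by (intro euclid_dist_triangle) simp
    show "pdist G e f \<le> dm l e + dm l f"
      using euclid_dist_triangle[of "pt G e" "m l" "pt G f"] euclid_dist_commute[of "m l" "pt G e"] * m pt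
      by (simp add: dm_def pdist_def)
  qed (use False cl in \<open>auto simp: dm_def pdist_def euclid_dist_nonneg\<close>)
  have covers: "covers k G S cs" if "covered cs" for cs
  proof -
    have "(\<Sum>e<?N. dm (cl e) e) = (\<Sum>e<?N. euclid_dist (G ! fst (points G ! e) ! snd (points G ! e)) (m (label_of k U (points G ! e))))"
    proof (intro sum.cong refl)
      fix e assume "e \<in> {..<?N}"
      then show "dm (cl e) e = euclid_dist (G ! fst (points G ! e) ! snd (points G ! e)) (m (label_of k U (points G ! e)))"
        using euclid_dist_commute[of "m (cl e)" "pt G e"] m[OF cl] pt
        by (simp add: dm_def cl_def pt_def)
    qed
    also have "\<dots> = (\<Sum>p\<in>point_indices G. euclid_dist (G ! fst p ! snd p) (m (label_of k U p)))"
      by (rule sum_points)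
    finally show ?thesis
      using that sum_points[of "\<lambda>p. Min ((\<lambda>e. euclid_dist (m (label_of k U p)) (pt G e)) ` set cs)" G]
      unfolding covered_def covers_def mU D_def a_def by (simp add: dm_def cl_def)
  qed
  have "measure_pmf.prob ?q {rs. covered (run ?N (pdist G) R [0] rs)} = 1 - fail R (120 * k) [0]"
    using measure_pmf.prob_compl[of "{rs. \<not> covered (run ?N (pdist G) R [0] rs)}" ?q]
    by (simp add: fail_def Compl_eq_Diff_UNIV[symmetric] Collect_neg_eq[symmetric])
  then have "1 / 2 \<le> measure_pmf.prob ?q {rs. covered (run ?N (pdist G) R [0] rs)}"
    using fail_le_half[OF R] by simp
  also have "\<dots> \<le> measure_pmf.prob ?q {rs. covers k G S (run ?N (pdist G) R [0] rs)}"
    using covers by (intro measure_pmf.finite_measure_mono) auto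
  finally show ?thesis .
qed

text \<open>\<open>\<tau>\<close> sends every label to a position of the candidate nearest to its
  median. The triangle inequality adds the move of the median, at most 4 times the old sum, to the
  old sum itself.\<close>

lemma covers_tuple:
  assumes G: "cmedians_instance k d G" and S: "(m, U) \<in> solutions k d G" and cs: "cs \<noteq> []"
    "points G \<noteq> [] \<Longrightarrow> set cs \<subseteq> {..<length (points G)}"
    and cov: "covers k G (m, U) cs"
  obtains \<tau> where "\<And>l. \<tau> l < length cs"
    "(\<Sum>p\<in>point_indices G. euclid_dist (G ! fst p ! snd p) (pt G (cs ! \<tau> (label_of k U p)))) \<le>
     5 * (\<Sum>p\<in>point_indices G. euclid_dist (G ! fst p ! snd p) (m (label_of k U p)))"
proof -
  let ?near = "\<lambda>l. Min ((\<lambda>e. euclid_dist (m l) (pt G e)) ` set cs)"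
  have "\<exists>t<length cs. euclid_dist (m l) (pt G (cs ! t)) = ?near l" for l
  proof -
    have "?near l \<in> (\<lambda>e. euclid_dist (m l) (pt G e)) ` set cs"
      using cs by (intro Min_in) auto
    then show ?thesis
      by (metis (no_types, lifting) imageE in_set_conv_nth)
  qed
  then obtain \<tau> where \<tau>: "\<And>l. \<tau> l < length cs" "\<And>l. euclid_dist (m l) (pt G (cs ! \<tau> l)) = ?near l"
    by metis
  have U: "chromatic_partition k G U" and m: "\<And>l. l < k \<Longrightarrow> length (m l) = d"
    using S by (simp_all add: solutions_def)
  have "(\<Sum>p\<in>point_indices G. euclid_dist (G ! fst p ! snd p) (pt G (cs ! \<tau> (label_of k U p)))) \<le>
    (\<Sum>p\<in>point_indices G. euclid_dist (G ! fst p ! snd p) (m (label_of k U p)) + ?near (label_of k U p))"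
    using m[OF label_of(1)[OF U]] point_indices_length[OF G]
    by (intro sum_mono) (simp add: euclid_dist_triangle flip: \<tau>(2))
  also have "\<dots> \<le> 5 * (\<Sum>p\<in>point_indices G. euclid_dist (G ! fst p ! snd p) (m (label_of k U p)))"
    using cov by (simp add: covers_def sum.distrib)
  finally show ?thesis
    using \<tau>(1) that by blast
qed

lemma cost_nonneg: "0 \<le> cost k G S"
  by (cases S) (auto simp: cost_def euclid_dist_nonneg intro!: divide_nonneg_nonneg sum_nonneg)

text \<open>The infimum \<open>opt\<close> need not be known to be attained: along solutions whose cost tends to
  \<open>opt\<close>, the random bits with \<open>covers\<close> range over subsets of a finite set, so that one of these
  subsets occurs infinitely often.\<close>

lemma ex_good_bits:
  assumes G: "cmedians_instance k d G" and ne: "solutions k d G \<noteq> {}"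
    and R: "60 * length (points G) \<le> R"
  obtains B where "1 / 2 \<le> measure_pmf.prob (replicate_pmf (120 * k) (pmf_of_set {..R})) B"
    "\<And>rs c. rs \<in> B \<Longrightarrow>
       (\<And>S. S \<in> solutions k d G \<Longrightarrow> covers k G S (run (length (points G)) (pdist G) R [0] rs) \<Longrightarrow> c \<le> 5 * cost k G S) \<Longrightarrow>
       c \<le> 5 * opt k d G"
proof -
  let ?q = "replicate_pmf (120 * k) (pmf_of_set {..R})"
  let ?run = "run (length (points G)) (pdist G) R [0]"
  have fin: "finite (set_pmf ?q)"
    using finite_lists_length_eq[of "{..R}" "120 * k"] by (simp add: set_replicate_pmf lists_eq_set conj_commute)
  have bdd: "bdd_below (cost k G ` solutions k d G)"
    using cost_nonneg by (auto intro: bdd_belowI[of _ 0])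
  have "\<exists>S \<in> solutions k d G. cost k G S < opt k d G + 1 / real (Suc j)" for j
    using cINF_less_iff[OF ne bdd, of "opt k d G + 1 / real (Suc j)"] unfolding opt_def by simp
  then obtain S where S: "\<And>j. S j \<in> solutions k d G" "\<And>j. cost k G (S j) < opt k d G + 1 / real (Suc j)"
    by metis
  \<comment> \<open>Intersecting with the support keeps the probability and leaves only finitely
    many possible sets, as the pigeonhole argument requires.\<close>
  define B where "B j = {rs \<in> set_pmf ?q. covers k G (S j) (?run rs)}" for j
  have "finite (range B)"
    using fin by (intro finite_subset[of "range B" "Pow (set_pmf ?q)"]) (auto simp: B_def)
  then obtain j0 where inf: "infinite {j. B j = B j0}"
    using pigeonhole_infinite[of UNIV B] by auto
  show ?thesis
  proof (rule that[of "B j0"])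
    have "1 / 2 \<le> measure_pmf.prob ?q {rs. covers k G (S j0) (?run rs)}"
      by (rule prob_covers[OF G S(1) R])
    also have "\<dots> = measure_pmf.prob ?q (B j0)"
      by (intro measure_pmf.finite_measure_eq_AE) (auto simp: B_def AE_measure_pmf_iff)
    finally show "1 / 2 \<le> measure_pmf.prob ?q (B j0)" .
    fix rs c assume rs: "rs \<in> B j0"
      and c: "\<And>S. S \<in> solutions k d G \<Longrightarrow> covers k G S (?run rs) \<Longrightarrow> c \<le> 5 * cost k G S"
    show "c \<le> 5 * opt k d G"
    proof (rule field_le_epsilon)
      fix e :: real assume "0 < e"
      then obtain J where J: "5 / e < real J" using reals_Archimedean2 by blast
      obtain j where j: "J \<le> j" "B j = B j0"
        using inf unfolding infinite_nat_iff_unbounded_le by blast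
      have "c \<le> 5 * cost k G (S j)"
        using rs j(2) by (intro c S(1)) (auto simp: B_def)
      also have "\<dots> \<le> 5 * opt k d G + 5 / real (Suc j)"
        using S(2)[of j] by simp
      also have "5 / real (Suc j) \<le> e"
      proof -
        have "5 < e * real J" using J \<open>0 < e\<close> by (simp add: field_simps)
        also have "\<dots> \<le> e * real (Suc j)" using j(1) \<open>0 < e\<close> by (intro mult_left_mono) auto
        finally show ?thesis by (simp add: field_simps)
      qed
      finally show "c \<le> 5 * opt k d G + e" by simp
    qed
  qed
qed

text \<open>Injectivity of each labeling becomes injectivity of \<open>fst\<close> on each output
  set. Medians are described only if points exist; otherwise any coordinates give a solution of cost
  0.\<close>

lemma output_solution_labels:
  assumes G: "cmedians_instance k d G"
    and label: "\<And>i j. (i, j) \<in> point_indices G \<Longrightarrow> nmem s ''label'' [i, j] = f i j"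
    and f: "\<And>i. i < length G \<Longrightarrow> feasible k (length (G ! i)) (f i)"
    and median: "\<And>l c. points G \<noteq> [] \<Longrightarrow> l < k \<Longrightarrow> c < d \<Longrightarrow> rmem s ''median'' [l, c] = pt G (g l) ! c"
    and g: "\<And>l. points G \<noteq> [] \<Longrightarrow> l < k \<Longrightarrow> g l < length (points G)"
  shows "output_solution d G s \<in> solutions k d G"
    and "cost k G (output_solution d G s) =
      (\<Sum>p\<in>point_indices G. euclid_dist (G ! fst p ! snd p) (pt G (g (f (fst p) (snd p))))) / real (length G)"
proof -
  obtain m U where mU: "output_solution d G s = (m, U)" by fastforce
  then have m_eq: "m = (\<lambda>l. map (\<lambda>c. rmem s ''median'' [l, c]) [0..<d])"
    and U_eq: "U = (\<lambda>l. {(i, j) \<in> point_indices G. nmem s ''label'' [i, j] = l})"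
    by (simp_all add: output_solution_def)
  have U_iff: "(i, j) \<in> U l \<longleftrightarrow> (i, j) \<in> point_indices G \<and> f i j = l" for i j l
    using label by (auto simp: U_eq)
  have f_less: "f i j < k" if "(i, j) \<in> point_indices G" for i j
    using f that by (auto simp: feasible_def point_indices_def)
  have U: "chromatic_partition k G U"
    unfolding chromatic_partition_def
  proof (intro conjI allI impI)
    show "(\<Union>l<k. U l) = point_indices G"
      using f_less by (auto simp: U_iff)
    show "disjoint_family_on U {..<k}"
      by (auto simp: disjoint_family_on_def U_iff)
    show "inj_on fst (U l)" for l
      using f by (fastforce simp: inj_on_def U_iff feasible_def point_indices_def)
  qed
  then show "output_solution d G s \<in> solutions k d G"
    by (simp add: mU solutions_def m_eq)
  have "m (label_of k U p) = pt G (g (f (fst p) (snd p)))" if p: "p \<in> point_indices G" for p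
  proof -
    have ne: "points G \<noteq> []"
      using p unfolding set_points[symmetric] by auto
    have lab: "label_of k U p = f (fst p) (snd p)"
      using label_of(2)[OF U p] U_iff[of "fst p" "snd p"] by simp
    show ?thesis
      using label_of(1)[OF U p] ne median g length_pt[OF G] unfolding lab
      by (intro nth_equalityI) (auto simp: m_eq)
  qed
  then show "cost k G (output_solution d G s) =
      (\<Sum>p\<in>point_indices G. euclid_dist (G ! fst p ! snd p) (pt G (g (f (fst p) (snd p))))) / real (length G)"
    by (simp add: mU cost_eq[OF U])
qed

lemma partition_feasible:
  assumes "chromatic_partition k G U" "i < length G"
  shows "feasible k (length (G ! i)) (\<lambda>j. label_of k U (i, j))"
proof -
  have *: "(i, j) \<in> point_indices G" if "j < length (G ! i)" for j
    using that assms(2) by (simp add: point_indices_def)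
  have "j = j'" if "j < length (G ! i)" "j' < length (G ! i)" "label_of k U (i, j) = label_of k U (i, j')" for j j'
  proof -
    let ?l = "label_of k U (i, j)"
    have "inj_on fst (U ?l)"
      using assms(1) label_of(1)[OF assms(1) *[OF that(1)]] by (simp add: chromatic_partition_def)
    moreover have "(i, j) \<in> U ?l" "(i, j') \<in> U ?l"
      using label_of(2)[OF assms(1) *[OF that(1)]] label_of(2)[OF assms(1) *[OF that(2)]] that(3)
      by simp_all
    ultimately show ?thesis
      using inj_onD[of fst "U ?l" "(i, j)" "(i, j')"] by simp
  qed
  then show ?thesis
    using label_of(1)[OF assms(1) *] by (auto simp: feasible_def inj_on_def)
qed

section \<open>Correctness of the program\<close>

text \<open>The search did at least as well as the tuple \<open>u\<close> that encodes
  \<open>\<tau>\<close>, and for this tuple each set did at least as well as with its labels from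
  the partition of \<open>S\<close>, encoded by \<open>v i\<close>. Both codes are below
  \<open>M ^ k\<close>, for the labels because \<open>k \<le> M\<close>.\<close>

lemma covers_bound:
  fixes G :: point_sets and cs :: "nat list" and b :: "nat \<Rightarrow> nat \<Rightarrow> nat" and M :: nat
  defines "ct \<equiv> \<lambda>u i v. \<Sum>j<length (G ! i). euclid_dist (G ! i ! j) (pt G (cs ! digit M u (digit M v j)))"
  assumes G: "cmedians_instance k d G" and cs: "length cs = M" "k \<le> M" "0 < M"
    "points G \<noteq> [] \<Longrightarrow> set cs \<subseteq> {..<length (points G)}"
    and best: "\<And>u i v. u < M ^ k \<Longrightarrow> i < length G \<Longrightarrow> v < M ^ k \<Longrightarrow> feasible k (length (G ! i)) (digit M v) \<Longrightarrow>
       ct u i (b u i) \<le> ct u i v"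
    and gu: "\<And>u. u < M ^ k \<Longrightarrow> (\<Sum>i<length G. ct gu i (b gu i)) \<le> (\<Sum>i<length G. ct u i (b u i))"
    and S: "S \<in> solutions k d G" and cov: "covers k G S cs"
  shows "(\<Sum>i<length G. ct gu i (b gu i)) / real (length G) \<le> 5 * cost k G S"
proof -
  obtain m U where mU: "S = (m, U)" by (cases S)
  have U: "chromatic_partition k G U"
    using S by (simp add: mU solutions_def)
  have ne: "cs \<noteq> []" using cs by auto
  obtain \<tau> where \<tau>: "\<And>l. \<tau> l < length cs"
    "(\<Sum>p\<in>point_indices G. euclid_dist (G ! fst p ! snd p) (pt G (cs ! \<tau> (label_of k U p)))) \<le>
     5 * (\<Sum>p\<in>point_indices G. euclid_dist (G ! fst p ! snd p) (m (label_of k U p)))"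
    using covers_tuple[OF G S[unfolded mU] ne cs(4) cov[unfolded mU]] by blast
  obtain u where u: "u < M ^ k" "\<And>l. l < k \<Longrightarrow> digit M u l = \<tau> l"
    using ex_digits[of k \<tau> M] \<tau>(1) cs(1) by auto
  have size: "length (G ! i) \<le> k" if "i < length G" for i
    using G that by (auto simp: cmedians_instance_def)
  have "\<exists>v<M ^ k. \<forall>j<length (G ! i). digit M v j = label_of k U (i, j)" if i: "i < length G" for i
  proof -
    have "label_of k U (i, j) < M" if "j < length (G ! i)" for j
      using label_of(1)[OF U, of "(i, j)"] that i cs(2) by (simp add: point_indices_def)
    \<comment> \<open>A set may have fewer than \<open>k\<close> points; the remaining digits are
      padded with 0.\<close>
    then have "\<exists>v<M ^ k. \<forall>j<k. digit M v j = (if j < length (G ! i) then label_of k U (i, j) else 0)"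
      using cs(3) by (intro ex_digits) auto
    then show ?thesis
      using size[OF i] by (metis order_less_le_trans)
  qed
  then obtain v where v: "\<And>i. i < length G \<Longrightarrow> v i < M ^ k"
    "\<And>i j. i < length G \<Longrightarrow> j < length (G ! i) \<Longrightarrow> digit M (v i) j = label_of k U (i, j)"
    by metis
  have "(\<Sum>i<length G. ct gu i (b gu i)) \<le> (\<Sum>i<length G. ct u i (b u i))"
    using gu u(1) by blast
  also have "\<dots> \<le> (\<Sum>i<length G. ct u i (v i))"
  proof (intro sum_mono best)
    fix i assume i: "i \<in> {..<length G}"
    show "feasible k (length (G ! i)) (digit M (v i))"
      using partition_feasible[OF U, of i] i v(2)[of i] by (auto simp: feasible_def inj_on_def)
  qed (use u v in auto)
  also have "\<dots> = (\<Sum>i<length G. \<Sum>j<length (G ! i). euclid_dist (G ! i ! j) (pt G (cs ! \<tau> (label_of k U (i, j)))))"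
    unfolding ct_def
  proof (intro sum.cong refl)
    fix i j assume "i \<in> {..<length G}" "j \<in> {..<length (G ! i)}"
    moreover from this have "label_of k U (i, j) < k"
      using label_of(1)[OF U, of "(i, j)"] by (simp add: point_indices_def)
    ultimately show "euclid_dist (G ! i ! j) (pt G (cs ! digit M u (digit M (v i) j))) =
       euclid_dist (G ! i ! j) (pt G (cs ! \<tau> (label_of k U (i, j))))"
      using u v by simp
  qed
  also have "\<dots> \<le> 5 * (\<Sum>p\<in>point_indices G. euclid_dist (G ! fst p ! snd p) (m (label_of k U p)))"
    using \<tau>(2) by (simp add: sum_point_indices)
  finally show ?thesis
    by (simp add: mU cost_eq[OF U] divide_right_mono)
qed

lemma best_feasible: "best s u i b \<Longrightarrow> v < nmem s ''X'' [] \<Longrightarrow> feas s i v \<Longrightarrow> feas s i b"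
  and best_le: "best s u i b \<Longrightarrow> v < nmem s ''X'' [] \<Longrightarrow> feas s i v \<Longrightarrow> set_cost s u i b \<le> set_cost s u i v"
  by (simp_all add: best_def)

definition solve_com :: com where
  "solve_com = enumerate_com ;; power_com ;; table_com ;; sample_com ;; search_com ;; output_com"

text \<open>One group of summands for each of the six subprograms, in their order of
  execution.\<close>

definition solve_time :: "nat \<Rightarrow> nat \<Rightarrow> nat \<Rightarrow> nat \<Rightarrow> nat \<Rightarrow> nat \<Rightarrow> nat" where
  "solve_time n k d N M X = 3 + n * (6 * k + 4) + (3 + k * 3) + (4 + X * (3 * k + 9)) +
     (2 + M * (N * (4 * d + 14) + 9)) + (3 + X * (7 + n * (6 + X * (8 + k * (7 + 4 * k))))) +
     (4 + k * (4 + 3 * d) + n * (4 + 3 * k))"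

lemma clock_chain:
  fixes c0 :: nat
  assumes "c1 \<le> c0 + 3 + t1" "c2 \<le> c1 + t2" "c3 \<le> c2 + t3" "c4 \<le> c3 + 2 + t4" "c5 \<le> c4 + t5" "c6 \<le> c5 + t6"
  shows "c6 \<le> c0 + (3 + t1 + t2 + t3 + (2 + t4) + t5 + t6)"
  using assms by linarith

lemma com_writes [simp]:
  "nwrites enumerate_com = {''N'', ''i'', ''j'', ''pi'', ''pj'', ''idx''}" "rwrites enumerate_com = {}"
  "nwrites power_com = {''X'', ''i''}" "rwrites power_com = {}"
  "nwrites table_com = {''q'', ''r'', ''v'', ''dig'', ''j''}" "rwrites table_com = {}"
  "nwrites sample_com = {''t'', ''e'', ''c'', ''near'', ''ce''}" "rwrites sample_com = {''W'', ''A'', ''acc'', ''x'', ''dst''}"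
  by (auto simp: enumerate_com_def power_com_def table_com_def sample_com_def weigh_com_def pick_com_def distance_com_def)

text \<open>This is deterministic in the drawn list, which enters only through \<open>cs\<close>.
  The same output is compared with all solutions that \<open>cs\<close> covers, as
  \<open>ex_good_bits\<close> demands.\<close>

lemma ok_solve:
  fixes G s R T
  defines "cs \<equiv> run (length (points G)) (pdist G) R [0] (drawn T s)"
  assumes env: "env k d G s" and G: "cmedians_instance k d G"
    and R: "nmem s ''R'' [] = R" and M: "nmem s ''M'' [] = Suc T" and T: "k \<le> T" "1 \<le> T"
    and init: "nmem s ''near'' = (\<lambda>_. 0)" "nmem s ''ce'' = (\<lambda>_. 0)"
  shows "ok solve_com s (\<lambda>s'. output_solution d G s' \<in> solutions k d G \<and>
     (\<forall>S\<in>solutions k d G. covers k G S cs \<longrightarrow> cost k G (output_solution d G s') \<le> 5 * cost k G S) \<and>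
     clock s' \<le> clock s + solve_time (length G) k d (length (points G)) (Suc T) (Suc T ^ k))"
  unfolding solve_com_def
proof (rule ok_Seq, rule ok_conseq[OF ok_enumerate[OF env G]])
  let ?N = "length (points G)" and ?n = "length G" and ?M = "Suc T" and ?X = "Suc T ^ k"
  let ?Q = "\<lambda>s'. output_solution d G s' \<in> solutions k d G \<and>
     (\<forall>S\<in>solutions k d G. covers k G S cs \<longrightarrow> cost k G (output_solution d G s') \<le> 5 * cost k G S) \<and>
     clock s' \<le> clock s + solve_time ?n k d ?N ?M ?X"
  have size: "length (G ! i) \<le> k" if "i < ?n" for i
    using G that by (auto simp: cmedians_instance_def)
  fix s1 assume f1: "frame enumerate_com s s1" and s1: "enumerated (points G) s1 \<and> clock s1 \<le> clock s + 3 + ?n * (6 * k + 4)"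
  have e1: "env k d G s1" "nmem s1 ''R'' [] = R" "nmem s1 ''M'' [] = ?M" "nmem s1 ''near'' = (\<lambda>_. 0)" "nmem s1 ''ce'' = (\<lambda>_. 0)"
    "nmem s1 ''rnd'' = nmem s ''rnd''"
    using f1 env R M init by (simp_all add: frame_nmem env_frame)
  then have k1: "nmem s1 ''k'' [] = k" by (simp add: env_def)
  show "ok (power_com ;; table_com ;; sample_com ;; search_com ;; output_com) s1 ?Q"
  proof (rule ok_Seq, rule ok_conseq[OF ok_power])
    fix s2 assume f2: "frame power_com s1 s2" and "nmem s2 ''X'' [] = nmem s1 ''M'' [] ^ nmem s1 ''k'' [] \<and>
      clock s2 \<le> clock s1 + (3 + nmem s1 ''k'' [] * 3)"
    then have s2: "nmem s2 ''X'' [] = ?X" "clock s2 \<le> clock s1 + (3 + k * 3)"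
      using e1 k1 by simp_all
    have e2: "env k d G s2" "nmem s2 ''R'' [] = R" "nmem s2 ''M'' [] = ?M" "nmem s2 ''near'' = (\<lambda>_. 0)" "nmem s2 ''ce'' = (\<lambda>_. 0)"
      "nmem s2 ''rnd'' = nmem s ''rnd''" "enumerated (points G) s2" "nmem s2 ''k'' [] = k"
      using f2 e1 s1 k1 by (simp_all add: frame_nmem env_frame enumerated_frame)
    show "ok (table_com ;; sample_com ;; search_com ;; output_com) s2 ?Q"
    proof (rule ok_Seq, rule ok_conseq[OF ok_table])
      show "2 \<le> nmem s2 ''M'' []" using e2 T by simp
      fix s3 assume f3: "frame table_com s2 s3" and "(\<forall>v<nmem s2 ''X'' []. \<forall>j\<le>nmem s2 ''k'' [].
          nmem s3 ''dig'' [v, j] = digit (nmem s2 ''M'' []) v j) \<and>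
        clock s3 \<le> clock s2 + (4 + nmem s2 ''X'' [] * (3 * nmem s2 ''k'' [] + 9))"
      then have s3: "\<And>v j. v < ?X \<Longrightarrow> j \<le> k \<Longrightarrow> nmem s3 ''dig'' [v, j] = digit ?M v j"
        "clock s3 \<le> clock s2 + (4 + ?X * (3 * k + 9))"
        using e2 s2 by simp_all
      have e3: "env k d G s3" "nmem s3 ''R'' [] = R" "nmem s3 ''M'' [] = ?M" "\<And>e. nmem s3 ''near'' [e] = 0" "nmem s3 ''ce'' [0] = 0"
        "nmem s3 ''rnd'' = nmem s ''rnd''" "enumerated (points G) s3" "nmem s3 ''X'' [] = ?X"
        using f3 e2 s2 by (simp_all add: frame_nmem env_frame enumerated_frame)
      show "ok (sample_com ;; search_com ;; output_com) s3 ?Q"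
      proof (rule ok_Seq, rule ok_conseq[OF ok_sample[OF e3(1,7) G e3(2,3,4,5)]])
        fix s4 assume f4: "frame sample_com s3 s4" and
          "(\<forall>t\<le>T. nmem s4 ''ce'' [t] = run ?N (pdist G) R [0] (drawn T s3) ! t) \<and>
           (\<forall>t\<le>T. \<forall>e<?N. rmem s4 ''dst'' [e, t] = pdist G e (run ?N (pdist G) R [0] (drawn T s3) ! t)) \<and>
           clock s4 \<le> clock s3 + 2 + Suc T * (?N * (4 * d + 14) + 9)"
        then have s4: "\<And>t. t \<le> T \<Longrightarrow> nmem s4 ''ce'' [t] = cs ! t"
          "\<And>t e. t \<le> T \<Longrightarrow> e < ?N \<Longrightarrow> rmem s4 ''dst'' [e, t] = pdist G e (cs ! t)"
          "clock s4 \<le> clock s3 + 2 + ?M * (?N * (4 * d + 14) + 9)"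
          by (simp_all add: e3 cs_def)
        have e4: "env k d G s4" "enumerated (points G) s4" "nmem s4 ''X'' [] = ?X"
          using f4 e3 by (simp_all add: frame_nmem env_frame enumerated_frame)
        have dig: "nmem s4 ''dig'' [v, j] = digit ?M v j" if "v < ?X" "j \<le> k" for v j
          using f4 s3 that by (simp add: frame_nmem)
        have mem4: "nmem s4 ''k'' [] = k" "nmem s4 ''d'' [] = d" "nmem s4 ''n'' [] = ?n"
          "\<And>i. i < ?n \<Longrightarrow> nmem s4 ''size'' [i] = length (G ! i)"
          using e4(1) by (simp_all add: env_def)
        define ct where "ct u i v = (\<Sum>j<length (G ! i). euclid_dist (G ! i ! j) (pt G (cs ! digit ?M u (digit ?M v j))))" for u i v
        have feas: "feas s4 i v \<longleftrightarrow> feasible k (length (G ! i)) (digit ?M v)" if "i < ?n" "v < ?X" for i v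
          using size[OF that(1)] that dig by (auto simp: mem4 feasible_def inj_on_def)
        \<comment> \<open>Feasibility keeps the digits of \<open>v\<close> below \<open>k\<close>,
          inside the filled part of the row of \<open>u\<close>.\<close>
        have cost: "set_cost s4 u i v = ct u i v"
          if u: "u < ?X" and i: "i < ?n" and v: "v < ?X" and fv: "feasible k (length (G ! i)) (digit ?M v)" for u i v
          unfolding set_cost_def ct_def mem4(4)[OF i]
        proof (intro sum.cong refl)
          fix j assume j: "j \<in> {..<length (G ! i)}"
          have jk: "j \<le> k" using size[OF i] j by simp
          have dk: "digit ?M v j < k" using fv j by (simp add: feasible_def)
          have dM: "digit ?M u (digit ?M v j) \<le> T"
            by (simp add: digit_def flip: less_Suc_eq_le)
          have ij: "(i, j) \<in> set (points G)"
            using i j unfolding set_points by (simp add: point_indices_def)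
          then have idx: "nmem s4 ''idx'' [i, j] < ?N" "points G ! nmem s4 ''idx'' [i, j] = (i, j)"
            using e4(2) by (auto simp: enumerated_def)
          then show "rmem s4 ''dst'' [nmem s4 ''idx'' [i, j], nmem s4 ''dig'' [u, nmem s4 ''dig'' [v, j]]] =
            euclid_dist (G ! i ! j) (pt G (cs ! digit ?M u (digit ?M v j)))"
            using s4(2)[OF dM idx(1)] dig[OF v jk] dig[OF u, of "digit ?M v j"] dk
            by (simp add: pdist_def pt_def[of G "nmem s4 ''idx'' [i, j]"])
        qed
        have size4: "\<And>i. i < nmem s4 ''n'' [] \<Longrightarrow> nmem s4 ''size'' [i] \<le> nmem s4 ''k'' []"
          by (simp add: mem4 size)
        show "ok (search_com ;; output_com) s4 ?Q"
        proof (rule ok_Seq, rule ok_conseq[OF ok_search[OF size4]])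
          show "0 < nmem s4 ''X'' []" by (simp add: e4)
          fix s5 assume f5: "frame search_com s4 s5" and
            "nmem s5 ''gu'' [] < nmem s4 ''X'' [] \<and>
             (\<forall>u<nmem s4 ''X'' []. \<forall>i<nmem s4 ''n'' []. best s4 u i (nmem s5 ''bi'' [u, i])) \<and>
             (\<forall>u<nmem s4 ''X'' []. (\<Sum>i<nmem s4 ''n'' []. set_cost s4 (nmem s5 ''gu'' []) i (nmem s5 ''bi'' [nmem s5 ''gu'' [], i])) \<le>
                (\<Sum>i<nmem s4 ''n'' []. set_cost s4 u i (nmem s5 ''bi'' [u, i]))) \<and>
             clock s5 \<le> clock s4 + (3 + nmem s4 ''X'' [] * (7 + nmem s4 ''n'' [] * (6 + nmem s4 ''X'' [] * (8 + nmem s4 ''k'' [] * (7 + 4 * nmem s4 ''k'' [])))))"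
          then have s5: "nmem s5 ''gu'' [] < ?X" "\<And>u i. u < ?X \<Longrightarrow> i < ?n \<Longrightarrow> best s4 u i (nmem s5 ''bi'' [u, i])"
            "\<And>u. u < ?X \<Longrightarrow> (\<Sum>i<?n. set_cost s4 (nmem s5 ''gu'' []) i (nmem s5 ''bi'' [nmem s5 ''gu'' [], i])) \<le>
                (\<Sum>i<?n. set_cost s4 u i (nmem s5 ''bi'' [u, i]))"
            "clock s5 \<le> clock s4 + (3 + ?X * (7 + ?n * (6 + ?X * (8 + k * (7 + 4 * k)))))"
            unfolding e4(3) mem4 by blast+
          define gu where "gu = nmem s5 ''gu'' []"
          define b where "b u i = nmem s5 ''bi'' [u, i]" for u i
          have e5: "env k d G s5" "enumerated (points G) s5" "nmem s5 ''dig'' = nmem s4 ''dig''" "nmem s5 ''ce'' = nmem s4 ''ce''"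
            using f5 e4 by (simp_all add: frame_nmem env_frame enumerated_frame)
          have mem5: "nmem s5 ''k'' [] = k" "nmem s5 ''d'' [] = d" "nmem s5 ''n'' [] = ?n"
            "\<And>i. i < ?n \<Longrightarrow> nmem s5 ''size'' [i] = length (G ! i)"
            using e5(1) by (simp_all add: env_def)
          \<comment> \<open>The identity labeling is feasible for every set, because no set has more
            than \<open>k\<close> points; hence every best labeling is feasible too.\<close>
          obtain v0 where v0: "v0 < ?X" "\<And>j. j < k \<Longrightarrow> digit ?M v0 j = j"
            using ex_digits[of k "\<lambda>j. j" ?M] T by auto
          have b: "b u i < ?X" "feasible k (length (G ! i)) (digit ?M (b u i))"
            if u: "u < ?X" and i: "i < ?n" for u i
          proof -
            show *: "b u i < ?X"
              using s5(2)[OF u i] by (simp add: best_def b_def e4)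
            have "feas s4 i v0"
              unfolding feas[OF i v0(1)] using size[OF i] v0(2) by (simp add: feasible_def inj_on_def)
            then have "feas s4 i (b u i)"
              using best_feasible[OF s5(2)[OF u i], of v0] v0(1) by (simp add: b_def e4)
            then show "feasible k (length (G ! i)) (digit ?M (b u i))"
              using feas[OF i *] by simp
          qed
          have best: "ct u i (b u i) \<le> ct u i v"
            if u: "u < ?X" and i: "i < ?n" and v: "v < ?X" "feasible k (length (G ! i)) (digit ?M v)" for u i v
            using best_le[OF s5(2)[OF u i], of v] feas[OF i v(1)] v cost[OF u i v] cost[OF u i b[OF u i]]
            by (simp add: b_def e4)
          have gu: "(\<Sum>i<?n. ct gu i (b gu i)) \<le> (\<Sum>i<?n. ct u i (b u i))" if u: "u < ?X" for u
          proof -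
            have "(\<Sum>i<?n. ct gu i (b gu i)) = (\<Sum>i<?n. set_cost s4 gu i (b gu i))"
              using s5(1) b by (intro sum.cong refl cost[symmetric]) (auto simp: gu_def)
            also have "\<dots> \<le> (\<Sum>i<?n. set_cost s4 u i (b u i))"
              using s5(3)[OF u] by (simp add: gu_def b_def)
            also have "\<dots> = (\<Sum>i<?n. ct u i (b u i))"
              using u b by (intro sum.cong refl cost) auto
            finally show ?thesis .
          qed
          have guX: "gu < ?X" using s5(1) by (simp add: gu_def)
          have len: "length cs = ?M" by (simp add: cs_def)
          have cs_less: "set cs \<subseteq> {..<?N}" if "points G \<noteq> []"
            using that unfolding cs_def by (intro run_less) auto
          have size5: "\<And>i. i < nmem s5 ''n'' [] \<Longrightarrow> nmem s5 ''size'' [i] \<le> nmem s5 ''k'' []"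
            by (simp add: mem5 size)
          show "ok output_com s5 ?Q"
          proof (rule ok_conseq[OF ok_output[OF size5]])
            fix s6 :: state assume "(\<forall>l<nmem s5 ''k'' []. \<forall>c<nmem s5 ''d'' []. rmem s6 ''median'' [l, c] = rmem s5 ''point''
              [nmem s5 ''pi'' [nmem s5 ''ce'' [nmem s5 ''dig'' [nmem s5 ''gu'' [], l]]],
               nmem s5 ''pj'' [nmem s5 ''ce'' [nmem s5 ''dig'' [nmem s5 ''gu'' [], l]]], c]) \<and>
              (\<forall>i<nmem s5 ''n'' []. \<forall>j<nmem s5 ''size'' [i].
                 nmem s6 ''label'' [i, j] = nmem s5 ''dig'' [nmem s5 ''bi'' [nmem s5 ''gu'' [], i], j]) \<and>
              clock s6 \<le> clock s5 + (4 + nmem s5 ''k'' [] * (4 + 3 * nmem s5 ''d'' []) + nmem s5 ''n'' [] * (4 + 3 * nmem s5 ''k'' []))"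
            then have s6: "\<And>l c. l < k \<Longrightarrow> c < d \<Longrightarrow> rmem s6 ''median'' [l, c] = rmem s5 ''point''
              [nmem s5 ''pi'' [nmem s4 ''ce'' [nmem s4 ''dig'' [gu, l]]],
               nmem s5 ''pj'' [nmem s4 ''ce'' [nmem s4 ''dig'' [gu, l]]], c]"
              "\<And>i j. i < ?n \<Longrightarrow> j < length (G ! i) \<Longrightarrow> nmem s6 ''label'' [i, j] = nmem s4 ''dig'' [b gu i, j]"
              "clock s6 \<le> clock s5 + (4 + k * (4 + 3 * d) + ?n * (4 + 3 * k))"
              by (simp_all add: mem5 e5 gu_def b_def)
            have digM: "digit ?M gu l \<le> T" for l
              by (simp add: digit_def flip: less_Suc_eq_le)
            have csN: "cs ! digit ?M gu l < ?N" if "points G \<noteq> []" "l < k" for l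
            proof -
              have "cs ! digit ?M gu l \<in> set cs"
                using digM[of l] len by (intro nth_mem) simp
              then show ?thesis using cs_less[OF that(1)] by auto
            qed
            have label: "nmem s6 ''label'' [i, j] = digit ?M (b gu i) j" if "(i, j) \<in> point_indices G" for i j
              using that s6(2) dig b(1)[OF guX] size[of i] by (auto simp: point_indices_def)
            have feas_gu: "feasible k (length (G ! i)) (digit ?M (b gu i))" if "i < ?n" for i
              using b(2)[OF guX that] .
            have median: "rmem s6 ''median'' [l, c] = pt G (cs ! digit ?M gu l) ! c"
              if "points G \<noteq> []" "l < k" "c < d" for l c
              using s6(1)[OF that(2,3)] s4(1)[OF digM] dig[OF guX] that point_read[OF e5(1,2) csN[OF that(1,2)] that(3)]
              by simp
            note out = output_solution_labels[where f = "\<lambda>i. digit ?M (b gu i)" and g = "\<lambda>l. cs ! digit ?M gu l", OF G label feas_gu median csN]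
            have "cost k G (output_solution d G s6) = (\<Sum>i<?n. ct gu i (b gu i)) / real ?n"
              by (simp add: out(2) sum_point_indices ct_def)
            moreover have "(\<Sum>i<?n. ct gu i (b gu i)) / real ?n \<le> 5 * cost k G S"
              if "S \<in> solutions k d G" "covers k G S cs" for S
              unfolding ct_def
              by (rule covers_bound[where b = b and gu = gu, OF G len _ _ cs_less _ _ that])
                (use best gu T in \<open>simp_all add: ct_def\<close>)
            moreover have "clock s6 \<le> clock s + solve_time ?n k d ?N ?M ?X"
              using clock_chain[OF s1[THEN conjunct2] s2(2) s3(2) s4(3) s5(4) s6(3)]
              unfolding solve_time_def by (simp only: add.assoc)
            ultimately show "?Q s6"
              using out(1) by simp
          qed
        qed
      qed
    qed
  qed
qed

section \<open>Running time and success probability\<close>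

lemma env_input_state: "env k d G (input_state k d \<epsilon> G)"
  by (auto simp: env_def input_state_def)

text \<open>The term \<open>5 + T * 3\<close> is the cost of the three initial assignments and the
  draws. After replacing \<open>k\<close> and \<open>Suc T\<close> by \<open>X\<close> and
  \<open>N\<close> by \<open>n * X\<close>, every monomial is at most \<open>X ^ 4 * n * d\<close>,
  and 125 is the sum of the coefficients.\<close>

lemma solve_time_le:
  assumes "1 \<le> n" "1 \<le> d" "1 \<le> k" "N \<le> n * k" "k \<le> T" "T < X"
  shows "5 + T * 3 + solve_time n k d N (Suc T) X \<le> 125 * (X ^ 4 * n * d)"
proof -
  have "5 + T * 3 + solve_time n k d N (Suc T) X \<le> 5 + X * 3 + solve_time n X d (n * X) X X"
    unfolding solve_time_def using assms
    by (intro add_mono mult_le_mono order_refl order_trans[OF assms(4)]) auto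
  also have "\<dots> = 24 + 35 * X + 8 * n + 15 * (X * n) + 3 * X ^ 2 + 4 * (X ^ 2 * n * d) + 22 * (X ^ 2 * n) +
      7 * (X ^ 3 * n) + 4 * (X ^ 4 * n) + 3 * (X * d)"
    unfolding solve_time_def by algebra
  also have "\<dots> \<le> 125 * (X ^ 4 * n * d)"
  proof -
    define Z where "Z = X ^ 4 * n * d"
    have *: "X ^ i * n ^ a * d ^ b \<le> Z" if "i \<le> 4" "a \<le> 1" "b \<le> 1" for i a b
      unfolding Z_def
      using that assms power_increasing[of i 4 X] power_increasing[of a 1 n] power_increasing[of b 1 d]
      by (intro mult_le_mono) auto
    show ?thesis
      unfolding Z_def[symmetric] using *[of 0 0 0] *[of 1 0 0] *[of 0 1 0] *[of 1 1 0] *[of 2 0 0] *[of 2 1 1] *[of 2 1 0] *[of 3 1 0]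
        *[of 4 1 0] *[of 1 0 1]
      by simp
  qed
  finally show ?thesis .
qed

text \<open>\<open>120 * k + 1\<close> is at most \<open>128 * k\<close>, hence at most
  \<open>2 ^ (7 + k)\<close>. Raising this to the power \<open>4 * k\<close> gives the exponent 28 k
  + 4 k^2, and \<open>\<epsilon> < 1\<close> allows passing from \<open>k\<close> to
  \<open>k / \<epsilon>\<close>.\<close>

lemma tuples_le:
  fixes \<epsilon> :: real
  assumes "1 \<le> k" "0 < \<epsilon>" "\<epsilon> < 1"
  shows "real ((Suc (120 * k) ^ k) ^ 4) \<le> 2 powr poly [:0, 28, 4:] (real k / \<epsilon>)"
proof -
  have "Suc (120 * k) \<le> 128 * k" using assms(1) by simp
  also have "\<dots> \<le> 128 * 2 ^ k" by (intro mult_le_mono2) (simp add: less_imp_le)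
  also have "\<dots> = 2 ^ (7 + k)" by (simp add: power_add)
  finally have "(Suc (120 * k) ^ k) ^ 4 \<le> ((2 ^ (7 + k)) ^ k) ^ 4"
    by (intro power_mono) auto
  also have "\<dots> = 2 ^ (28 * k + 4 * k * k)"
    by (simp add: algebra_simps flip: power_mult)
  finally have "real ((Suc (120 * k) ^ k) ^ 4) \<le> 2 ^ (28 * k + 4 * k * k)"
    by (metis of_nat_le_iff of_nat_numeral of_nat_power)
  also have "\<dots> = 2 powr (28 * real k + 4 * real k * real k)"
    by (simp flip: powr_realpow)
  also have "\<dots> \<le> 2 powr poly [:0, 28, 4:] (real k / \<epsilon>)"
  proof (intro powr_mono)
    define K where "K = real k / \<epsilon>"
    have k: "real k \<le> K"
      using assms by (simp add: K_def field_simps mult_left_le)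
    then have "real k * real k \<le> K * K"
      by (intro mult_mono) auto
    moreover have "poly [:0, 28, 4:] K = 28 * K + 4 * (K * K)"
      by (simp add: algebra_simps)
    ultimately show "28 * real k + 4 * real k * real k \<le> poly [:0, 28, 4:] (real k / \<epsilon>)"
      unfolding K_def[symmetric] using k by linarith
  qed simp
  finally show ?thesis .
qed

definition cmedians_com :: com where
  "cmedians_com = NAssign ''T'' [] (NMul (NConst 120) (N0 ''k'')) ;;
     NAssign ''M'' [] (NAdd (N0 ''T'') (NConst 1)) ;;
     NAssign ''R'' [] (NMul (NConst 60) (NMul (N0 ''n'') (N0 ''k''))) ;;
     draw_com ;; solve_com"

lemma cmedians_com_correct:
  fixes G :: point_sets and k d :: nat and \<epsilon> :: real
  defines "result \<equiv> exec cmedians_com (input_state k d \<epsilon> G)"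
  assumes k: "1 \<le> k" and d: "1 \<le> d" and G: "cmedians_instance k d G"
  shows "lossless_spmf result"
    and "1 / 2 \<le> measure (measure_spmf result) {s. is_approximation 5 k d G (output_solution d G s)}"
    and "\<And>s. s \<in> set_spmf result \<Longrightarrow> clock s \<le> 125 * ((Suc (120 * k) ^ k) ^ 4 * length G * d)"
proof -
  let ?N = "length (points G)" and ?n = "length G" and ?T = "120 * k" and ?X = "Suc (120 * k) ^ k"
  \<comment> \<open>The program knows \<open>n\<close> and \<open>k\<close> before counting points,
    and \<open>n * k\<close> bounds their number.\<close>
  define R where "R = 60 * (?n * k)"
  define s1 where "s1 = tick (nwrite ''R'' [] R (tick (nwrite ''M'' [] (Suc ?T) (tick (nwrite ''T'' [] ?T (input_state k d \<epsilon> G))))))"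
  have input: "nmem (input_state k d \<epsilon> G) ''k'' [] = k" "nmem (input_state k d \<epsilon> G) ''n'' [] = ?n"
    using env_input_state[of k d G \<epsilon>] by (simp_all add: env_def)
  have result: "result = bind_spmf (exec draw_com s1) (exec solve_com)"
    by (simp add: result_def cmedians_com_def s1_def input R_def)
  have N: "?N \<le> ?n * k"
    using length_prefix_points[OF G order_refl] .
  have R: "60 * ?N \<le> R"
    using N by (simp add: R_def)
  have dist: "map_spmf (drawn ?T) (exec draw_com s1) = spmf_of_pmf (replicate_pmf ?T (pmf_of_set {..R}))"
    by (rule draw_dist) (simp_all add: s1_def)
  have draw: "ok draw_com s1 (\<lambda>s. clock s \<le> clock s1 + 2 + ?T * 3)"
    using ok_draw[of s1] by (simp add: s1_def)
  have s1: "env k d G s1" "nmem s1 ''R'' [] = R" "nmem s1 ''M'' [] = Suc ?T"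
    "nmem s1 ''near'' = (\<lambda>_. 0)" "nmem s1 ''ce'' = (\<lambda>_. 0)" "clock s1 = 3"
    using env_input_state[of k d G \<epsilon>] by (simp_all add: s1_def) (simp_all add: input_state_def fun_eq_iff)
  let ?run = "run ?N (pdist G) R [0]"
  let ?Q = "\<lambda>s s'. output_solution d G s' \<in> solutions k d G \<and>
     (\<forall>S\<in>solutions k d G. covers k G S (?run (drawn ?T s)) \<longrightarrow> cost k G (output_solution d G s') \<le> 5 * cost k G S) \<and>
     clock s' \<le> clock s + solve_time ?n k d ?N (Suc ?T) ?X"
  have solve: "ok solve_com s (?Q s)" "clock s \<le> 5 + ?T * 3" if "s \<in> set_spmf (exec draw_com s1)" for s
  proof -
    have fr: "frame draw_com s1 s" and "clock s \<le> clock s1 + 2 + ?T * 3"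
      using draw that by (simp_all add: ok_def)
    then show "clock s \<le> 5 + ?T * 3" using s1 by simp
    show "ok solve_com s (?Q s)"
      using fr s1 k by (intro ok_solve[OF _ G]) (simp_all add: draw_com_def frame_nmem env_frame)
  qed
  show lossless: "lossless_spmf result"
    using draw solve(1) by (auto simp: result ok_def)
  \<comment> \<open>Solutions exist because the program outputs one: a lossless result has nonempty
    support.\<close>
  then obtain s' where "s' \<in> set_spmf result"
    using measure_spmf_zero_iff[of result UNIV] by (auto simp: lossless_spmf_def weight_spmf_def)
  then have ne: "solutions k d G \<noteq> {}"
    using solve(1) by (auto simp: result ok_def)
  obtain B where B: "1 / 2 \<le> measure_pmf.prob (replicate_pmf ?T (pmf_of_set {..R})) B"
    "\<And>rs c. rs \<in> B \<Longrightarrow> (\<And>S. S \<in> solutions k d G \<Longrightarrow> covers k G S (?run rs) \<Longrightarrow> c \<le> 5 * cost k G S) \<Longrightarrow>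
       c \<le> 5 * opt k d G"
    using ex_good_bits[OF G ne R] by blast
  have "is_approximation 5 k d G (output_solution d G s')"
    if "s \<in> set_spmf (exec draw_com s1)" "drawn ?T s \<in> B" "s' \<in> set_spmf (exec solve_com s)" for s s'
  proof -
    have "?Q s s'"
      using solve(1)[OF that(1)] that(3) by (simp add: ok_def)
    then show ?thesis
      using B(2)[OF that(2)] by (simp add: is_approximation_def)
  qed
  then have "measure_pmf.prob (replicate_pmf ?T (pmf_of_set {..R})) B \<le>
      measure (measure_spmf result) {s. is_approximation 5 k d G (output_solution d G s)}"
    unfolding result using solve(1) by (intro measure_bind_spmf_ge[OF dist]) (auto simp: ok_def)
  with B(1) show "1 / 2 \<le> measure (measure_spmf result) {s. is_approximation 5 k d G (output_solution d G s)}"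
    by linarith
  fix s' assume "s' \<in> set_spmf result"
  then obtain s where s: "s \<in> set_spmf (exec draw_com s1)" "s' \<in> set_spmf (exec solve_com s)"
    by (auto simp: result)
  have "clock s' \<le> clock s + solve_time ?n k d ?N (Suc ?T) ?X"
    using solve(1)[OF s(1)] s(2) by (simp add: ok_def)
  also have "\<dots> \<le> 5 + ?T * 3 + solve_time ?n k d ?N (Suc ?T) ?X"
    using solve(2)[OF s(1)] by simp
  also have "\<dots> \<le> 125 * (?X ^ 4 * ?n * d)"
  proof (rule solve_time_le)
    show "1 \<le> ?n" using G by (auto simp: cmedians_instance_def Suc_le_eq)
    show "?T < ?X" using k self_le_power[of "Suc ?T" k] by simp
  qed (use k d N in auto)
  finally show "clock s' \<le> 125 * (?X ^ 4 * ?n * d)" .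
qed

lemma opt_nonneg: "solutions k d G \<noteq> {} \<Longrightarrow> 0 \<le> opt k d G"
  unfolding opt_def using cost_nonneg by (intro cINF_greatest)

text \<open>Enlarging the factor is harmless because \<open>opt\<close> is nonnegative, the infimum
  being over a set that contains \<open>S\<close>.\<close>

lemma is_approximation_mono:
  assumes "is_approximation a k d G S" "a \<le> b"
  shows "is_approximation b k d G S"
proof -
  have "a * opt k d G \<le> b * opt k d G"
    using assms opt_nonneg[of k d G] by (intro mult_right_mono) (auto simp: is_approximation_def)
  then show ?thesis
    using assms(1) by (auto simp: is_approximation_def)
qed

theorem theorem8:
  "\<exists>(alg :: com) (\<delta> :: real) (q :: real poly) (C :: real). \<delta> > 0 \<and> C > 0 \<and>
     (\<forall>(k :: nat) (d :: nat) (\<epsilon> :: real) (G :: point_sets).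
        k \<ge> 2 \<longrightarrow> d \<ge> 1 \<longrightarrow> 0 < \<epsilon> \<longrightarrow> \<epsilon> < 1 \<longrightarrow> cmedians_instance k d G \<longrightarrow>
        (let n = length G; result = exec alg (input_state k d \<epsilon> G) in
           lossless_spmf result \<and>
           measure (measure_spmf result)
             {s. is_approximation (5 + \<epsilon>) k d G (output_solution d G s)} \<ge> \<delta> \<and>
           (n \<ge> 2 \<longrightarrow>
             (\<forall>s \<in> set_spmf result.
                real (clock s) \<le>
                  C * (2 powr poly q (real k / \<epsilon>) * real n * log 2 (real n) ^ (2 * k) * real d)))))"
proof (rule exI[of _ cmedians_com], rule exI[of _ "1 / 2"], rule exI[of _ "[:0, 28, 4:]"], rule exI[of _ 125],
    intro conjI allI impI)
  fix k d :: nat and \<epsilon> :: real and G :: point_sets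
  assume k: "2 \<le> k" and d: "1 \<le> d" and \<epsilon>: "0 < \<epsilon>" "\<epsilon> < 1" and G: "cmedians_instance k d G"
  let ?result = "exec cmedians_com (input_state k d \<epsilon> G)"
  have k1: "1 \<le> k" using k by simp
  note correct = cmedians_com_correct[OF k1 d G, where \<epsilon> = \<epsilon>]
  have "1 / 2 \<le> measure (measure_spmf ?result) {s. is_approximation 5 k d G (output_solution d G s)}"
    by (rule correct(2))
  also have "\<dots> \<le> measure (measure_spmf ?result) {s. is_approximation (5 + \<epsilon>) k d G (output_solution d G s)}"
    using \<epsilon> by (intro measure_spmf.finite_measure_mono) (auto elim: is_approximation_mono)
  finally have prob: "1 / 2 \<le> measure (measure_spmf ?result) {s. is_approximation (5 + \<epsilon>) k d G (output_solution d G s)}" .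
  have time: "real (clock s) \<le> 125 * (2 powr poly [:0, 28, 4:] (real k / \<epsilon>) * real (length G) *
      log 2 (real (length G)) ^ (2 * k) * real d)" if n: "2 \<le> length G" and s: "s \<in> set_spmf ?result" for s
  proof -
    \<comment> \<open>For at least two sets the logarithm is at least 1, so multiplying by its power
      only enlarges the linear bound.\<close>
    have "1 \<le> log 2 (real (length G))"
      using n by (subst le_log_iff) auto
    then have log: "1 \<le> log 2 (real (length G)) ^ (2 * k)"
      by (rule one_le_power)
    have "real (clock s) \<le> 125 * (real ((Suc (120 * k) ^ k) ^ 4) * real (length G) * 1 * real d)"
      using of_nat_mono[OF correct(3)[OF s], where ?'a = real] by (simp only: of_nat_mult of_nat_numeral mult_1_right)
    also have "\<dots> \<le> 125 * (2 powr poly [:0, 28, 4:] (real k / \<epsilon>) * real (length G) *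
      log 2 (real (length G)) ^ (2 * k) * real d)"
      using tuples_le[OF k1 \<epsilon>] log by (intro mult_left_mono mult_mono) auto
    finally show ?thesis .
  qed
  show "let n = length G; result = ?result in lossless_spmf result \<and>
           1 / 2 \<le> measure (measure_spmf result) {s. is_approximation (5 + \<epsilon>) k d G (output_solution d G s)} \<and>
           (2 \<le> n \<longrightarrow> (\<forall>s \<in> set_spmf result. real (clock s) \<le>
              125 * (2 powr poly [:0, 28, 4:] (real k / \<epsilon>) * real n * log 2 (real n) ^ (2 * k) * real d)))"
    unfolding Let_def using correct(1) prob time by blast
qed simp_all

end
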